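(* Let $1<p<\infty$, $p-2<\alpha\le p-1$, and let $g$ be an analytic function in the unit disc $\mathbb{D}$. Then the generalized Hilbert operator $\mathcal{H}_g:\mathcal{D}^p_\alpha\to\mathcal{D}^p_\alpha$ is bounded if and only if $g\in\Lambda\left(p,\frac1p\right)$.
   Context: $\mathbb{D}$ is the open unit disc, $\mathcal{H}ol(\mathbb{D})$ the space of analytic functions in $\mathbb{D}$, and $dA=\frac1\pi dx\,dy$. For $0<p<\infty$ and $\alpha>-1$, set $\|f\|_{A^p_\alpha}=\left((\alpha+1)\int_{\mathbb{D}}|f(z)|^p(1-|z|^2)^\alpha\,dA(z)\right)^{1/p}$; the space of Dirichlet type $\mathcal{D}^p_\alpha$ consists of $f\in\mathcal{H}ol(\mathbb{D})$ with $\|f\|_{\mathcal{D}^p_\alpha}^p=|f(0)|^p+\|f'\|_{A^p_\alpha}^p<\infty$. Given $g\in\mathcal{H}ol(\mathbb{D})$, the generalized Hilbert operator is $\mathcal{H}_g(f)(z)=\int_0^1 f(t)g'(tz)\,dt$, $z\in\mathbb{D}$, defined for $f\in\mathcal{H}ol(\mathbb{D})$ with $\int_0^1|f(t)|\,dt<\infty$ (this holds for every $f\in\mathcal{D}^p_\alpha$ when $p>1$ and $p-2<\alpha\le p-1$); then $\mathcal{H}_g(f)\in\mathcal{H}ol(\mathbb{D})$. Let $M_p(r,f)=\left(\frac1{2\pi}\int_0^{2\pi}|f(re^{it})|^p\,dt\right)^{1/p}$ and let $H^p$ be the Hardy space of $f\in\mathcal{H}ol(\mathbb{D})$ with $\sup_{0<r<1}M_p(r,f)<\infty$.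 Mean Lipschitz spaces: for $1\le p<\infty$ and $0<\alpha\le1$, $\Lambda(p,\alpha)$ is the set of $g\in H^p$ whose boundary function satisfies $\omega_p(g,t)=O(t^\alpha)$ as $t\to0$, where $\omega_p(g,t)=\sup_{0<h\le t}\left(\int_0^{2\pi}|g(e^{i(\theta+h)})-g(e^{i\theta})|^p\frac{d\theta}{2\pi}\right)^{1/p}$. Equivalently (Hardy–Littlewood), $\Lambda(p,\alpha)=\{g\in H^p: M_p(r,g')=O((1-r)^{\alpha-1}),\ r\to1^-\}$. *)

theory Defs
  imports "HOL-Complex_Analysis.Complex_Analysis"
begin

text \<open>
  Analytic functions in the unit disc are total functions on \<^typ>\<open>complex\<close> that are holomorphic on
  \<open>ball 0 1\<close>; no definition below depends on their values outside the disc.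
\<close>

definition bergman_weighted_integrable :: "real \<Rightarrow> real \<Rightarrow> (complex \<Rightarrow> complex) \<Rightarrow> bool" where
  "bergman_weighted_integrable p \<alpha> f \<longleftrightarrow>
     set_integrable lborel (ball 0 1) (\<lambda>z. norm (f z) powr p * (1 - (norm z)\<^sup>2) powr \<alpha>)"

text \<open>The factor \<open>1 / pi\<close> normalises area measure on the disc.\<close>

definition bergman_norm :: "real \<Rightarrow> real \<Rightarrow> (complex \<Rightarrow> complex) \<Rightarrow> real" where
  "bergman_norm p \<alpha> f =
     ((\<alpha> + 1) * (1 / pi *
        (LINT z:ball 0 1|lborel. norm (f z) powr p * (1 - (norm z)\<^sup>2) powr \<alpha>))) powr (1 / p)"

text \<open>
  Since \<^const>\<open>bergman_norm\<close> is real-valued, finiteness of the norm of \<open>f'\<close> is expressed by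
  integrability in the following definition.
\<close>

definition dirichlet_space :: "real \<Rightarrow> real \<Rightarrow> (complex \<Rightarrow> complex) set" where
  "dirichlet_space p \<alpha> =
     {f. f holomorphic_on ball 0 1 \<and> bergman_weighted_integrable p \<alpha> (deriv f)}"

definition dirichlet_norm :: "real \<Rightarrow> real \<Rightarrow> (complex \<Rightarrow> complex) \<Rightarrow> real" where
  "dirichlet_norm p \<alpha> f =
     (norm (f 0) powr p + bergman_norm p \<alpha> (deriv f) powr p) powr (1 / p)"

definition gen_hilbert :: "(complex \<Rightarrow> complex) \<Rightarrow> (complex \<Rightarrow> complex) \<Rightarrow> complex \<Rightarrow> complex" where
  "gen_hilbert g f z =
     (LINT t:{0..<1}|lborel. f (complex_of_real t) * deriv g (complex_of_real t * z))"

definition bounded_on_dirichlet ::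
    "real \<Rightarrow> real \<Rightarrow> ((complex \<Rightarrow> complex) \<Rightarrow> complex \<Rightarrow> complex) \<Rightarrow> bool" where
  "bounded_on_dirichlet p \<alpha> T \<longleftrightarrow>
     (\<forall>f\<in>dirichlet_space p \<alpha>. T f \<in> dirichlet_space p \<alpha>) \<and>
     (\<exists>C. \<forall>f\<in>dirichlet_space p \<alpha>. dirichlet_norm p \<alpha> (T f) \<le> C * dirichlet_norm p \<alpha> f)"

definition integral_mean :: "real \<Rightarrow> real \<Rightarrow> (complex \<Rightarrow> complex) \<Rightarrow> real" where
  "integral_mean p r f =
     (1 / (2 * pi) *
        (LINT t:{0..2 * pi}|lborel. norm (f (complex_of_real r * cis t)) powr p)) powr (1 / p)"

definition hardy_space :: "real \<Rightarrow> (complex \<Rightarrow> complex) set" where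
  "hardy_space p =
     {f. f holomorphic_on ball 0 1 \<and> bdd_above ((\<lambda>r. integral_mean p r f) ` {0<..<1})}"

text \<open>
  \<open>\<phi>\<close> is a Borel representative, on the unit circle, of the almost everywhere defined radial
  boundary function of \<open>f\<close>. By Fatou's theorem such a \<open>\<phi>\<close> exists for every \<open>f\<close> in a Hardy space,
  and it is unique up to null sets.
\<close>

definition is_boundary_function :: "(complex \<Rightarrow> complex) \<Rightarrow> (complex \<Rightarrow> complex) \<Rightarrow> bool" where
  "is_boundary_function f \<phi> \<longleftrightarrow>
     (\<lambda>\<theta>. \<phi> (cis \<theta>)) \<in> borel_measurable lborel \<and>
     (AE \<theta> in lborel. ((\<lambda>r. f (complex_of_real r * cis \<theta>)) \<longlongrightarrow> \<phi> (cis \<theta>)) (at_left 1))"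

text \<open>
  The real-valued integrals and supremum are meaningful for \<open>\<phi>\<close> in \<open>L\<^sup>p\<close> of the circle, \<open>p \<ge> 1\<close>. The
  boundary function of an element of \<^term>\<open>hardy_space p\<close> is of this kind, by Fatou's lemma.
\<close>

definition Lp_modulus :: "real \<Rightarrow> (complex \<Rightarrow> complex) \<Rightarrow> real \<Rightarrow> real" where
  "Lp_modulus p \<phi> t =
     (SUP h\<in>{0<..t}.
        (1 / (2 * pi) *
           (LINT \<theta>:{0..2 * pi}|lborel. norm (\<phi> (cis (\<theta> + h)) - \<phi> (cis \<theta>)) powr p)) powr (1 / p))"

definition mean_lipschitz :: "real \<Rightarrow> real \<Rightarrow> (complex \<Rightarrow> complex) set" where
  "mean_lipschitz p \<beta> =
     {g \<in> hardy_space p.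
        \<exists>\<phi>. is_boundary_function g \<phi> \<and> Lp_modulus p \<phi> \<in> O[at_right 0](\<lambda>t. t powr \<beta>)}"

end

theory Submission
  imports Defs
begin

text \<open>
  Everything is reduced to the growth condition \<open>M\<^sub>p(r, g') = O((1 - r)\<^sup>1\<^sup>/\<^sup>p\<^sup>-\<^sup>1)\<close>, which by
  Hardy and Littlewood characterises the mean Lipschitz space.

  Sufficiency. By Minkowski's inequality \<open>M\<^sub>p(r, \<H>\<^sub>g(f)')\<close> is at most a constant times
  \<open>\<integral> \<bar>f(t)\<bar> (1 - t r)\<^sup>-\<^sup>\<nu> dt\<close> with \<open>\<nu> = 2 - 1/p\<close>. Writing \<open>f(t) = f(0) + \<integral> f'\<close>, this is an integral
  operator applied to \<open>\<bar>f'\<bar>\<close> on the radius, which Schur's test with power weights bounds by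
  \<open>\<integral> \<bar>f'(t)\<bar>\<^sup>p (1 - t)\<^sup>\<alpha>\<^sup>+\<^sup>1 dt\<close>; the Poisson formula dominates the latter by the area integral of
  \<open>\<bar>f'\<bar>\<^sup>p (1 - \<bar>z\<bar>\<^sup>2)\<^sup>\<alpha>\<close>.

  Necessity. Integration by parts in the definition of \<open>\<H>\<^sub>g\<close> inverts the operator:
  \<open>f(1) g'(z) = \<H>\<^sub>g((w f)')(z) + z \<H>\<^sub>g(f)'(z)\<close>. For \<open>f(w) = 1 / (1 - a w)\<close> with \<open>a = r\<close>, differentiating
  once turns the bounds for the two images into \<open>M\<^sub>p(r, g'') = O((1 - r)\<^sup>1\<^sup>/\<^sup>p\<^sup>-\<^sup>2)\<close>.
\<close>

section \<open>Normalised measure on the circle\<close>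

text \<open>The range of \<alpha> acts through one exponent. With \<open>x = 1 - r\<close>, the
  bound for the p-th power of the mean contributes \<open>x powr (1 - p)\<close> and the area weight
  \<open>x powr \<alpha>\<close>; their product has exponent \<open>e = 1 - p + \<alpha>\<close>,
  and \<open>-1 < e \<le> 0\<close> says the same as \<open>p - 2 < \<alpha> \<le> p - 1\<close>.
  The bound \<open>-1 < e\<close> makes the contribution of \<open>f(0)\<close> integrable and
  leaves room for the weights in Schur's test. In the necessity part \<alpha> cancels: the energy of
  the test function of order \<open>k\<close> costs
  \<open>(1 - r) powr (\<alpha> + 2 - (k + 1) * p)\<close>, and passing from the energy to the mean
  at radius \<open>r\<close> costs \<open>(1 - r) powr (-\<alpha> - 1)\<close>. The inversion
  identity is differentiated because one of its terms is an image itself, whereas the norm controls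
  derivatives of images. Nothing is lost by this: the bound for \<open>g''\<close> integrates back
  to the sharp bound for \<open>g'\<close>. Means are kept as \<open>ennreal\<close> integrals of
  p-th powers, so that the inequalities of Tonelli and Minkowski apply before any finiteness is
  known.\<close>

definition circ :: "real measure" where "circ = uniform_measure lborel {0..2*pi}"

lemma sets_circ [simp, measurable_cong]: "sets circ = sets borel"
  by (simp add: circ_def)
lemma space_circ [simp]: "space circ = UNIV"
  by (simp add: circ_def)

lemma nn_integral_circ:
  assumes "f \<in> borel_measurable borel"
  shows "(\<integral>\<^sup>+\<theta>. f \<theta> \<partial>circ) = ennreal (1/(2*pi)) * (\<integral>\<^sup>+\<theta>. f \<theta> * indicator {0..2*pi} \<theta> \<partial>lborel)"
proof -
  have "inverse (ennreal (2*pi)) = ennreal (1/(2*pi))"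
    by (subst inverse_ennreal) (auto simp: inverse_eq_divide)
  then show ?thesis
    using assms unfolding circ_def
    by (subst nn_integral_uniform_measure) (auto simp: divide_ennreal_def mult.commute)
qed

lemma emeasure_circ_UNIV [simp]: "emeasure circ UNIV = 1"
  using emeasure_uniform_measure_1[of lborel "{0..2*pi}"] by (simp add: circ_def)

interpretation circ: finite_measure circ
  by standard simp

interpretation circ: sigma_finite_measure circ ..

lemma integral_circ:
  fixes f :: "real \<Rightarrow> 'a::{banach, second_countable_topology}"
  assumes "f \<in> borel_measurable borel"
  shows "(LINT \<theta>|circ. f \<theta>) = (1/(2*pi)) *\<^sub>R (LINT \<theta>:{0..2*pi}|lborel. f \<theta>)"
proof -
  have *: "uniform_measure lborel {0..2*pi} = density lborel (\<lambda>x. ennreal (indicator {0..2*pi} x / (2*pi)))"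
  proof -
    have "indicator {0..2*pi} x / emeasure lborel {0..2*pi} = ennreal (indicator {0..2*pi} x / (2*pi))" for x :: real
      using divide_ennreal[of "indicator {0..2*pi} x" "2*pi"] by (simp add: ennreal_indicator)
    then show ?thesis unfolding uniform_measure_def by (simp only:)
  qed
  have "(LINT \<theta>|circ. f \<theta>) = (LINT \<theta>|lborel. (indicator {0..2*pi} \<theta> / (2*pi)) *\<^sub>R f \<theta>)"
    unfolding circ_def * using assms by (subst integral_density) auto
  also have "\<dots> = (LINT \<theta>|lborel. (1/(2*pi)) *\<^sub>R (indicator {0..2*pi} \<theta> *\<^sub>R f \<theta>))"
    by (intro Bochner_Integration.integral_cong) auto
  also have "\<dots> = (1/(2*pi)) *\<^sub>R (LINT \<theta>:{0..2*pi}|lborel. f \<theta>)"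
    unfolding set_lebesgue_integral_def by (rule integral_scaleR_right)
  finally show ?thesis .
qed

lemma nn_integral_lborel_shift:
  fixes f :: "real \<Rightarrow> ennreal"
  assumes "f \<in> borel_measurable borel"
  shows "(\<integral>\<^sup>+x. f (x + s) \<partial>lborel) = (\<integral>\<^sup>+x. f x \<partial>lborel)"
  using nn_integral_real_affine[of f 1 s] assms by (simp add: add.commute)

text \<open>The shifted interval is cut at \<open>2*pi\<close> and the part beyond is moved back by
  one period. The two pieces reproduce \<open>{0..2*pi}\<close> up to the points \<open>s\<close>
  and \<open>2*pi\<close>, which are null.\<close>

lemma nn_integral_periodic_interval:
  fixes f :: "real \<Rightarrow> ennreal"
  assumes [measurable]: "f \<in> borel_measurable borel" and per: "\<And>x. f (x + 2*pi) = f x" and s: "0 \<le> s" "s \<le> 2*pi"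
  shows "(\<integral>\<^sup>+x. f (x + s) * indicator {0..2*pi} x \<partial>lborel) = (\<integral>\<^sup>+x. f x * indicator {0..2*pi} x \<partial>lborel)"
proof -
  have "(\<integral>\<^sup>+x. f (x + s) * indicator {0..2*pi} x \<partial>lborel) = (\<integral>\<^sup>+x. f (x + s) * indicator {s..2*pi+s} (x+s) \<partial>lborel)"
    by (intro nn_integral_cong) (auto simp: indicator_def)
  also have "\<dots> = (\<integral>\<^sup>+x. f x * indicator {s..2*pi+s} x \<partial>lborel)"
    by (rule nn_integral_lborel_shift) measurable
  also have "\<dots> = (\<integral>\<^sup>+x. f x * indicator {s..<2*pi} x + f x * indicator {2*pi..2*pi+s} x \<partial>lborel)"
    using s by (intro nn_integral_cong) (auto simp: indicator_def)
  also have "\<dots> = (\<integral>\<^sup>+x. f x * indicator {s..<2*pi} x \<partial>lborel) + (\<integral>\<^sup>+x. f x * indicator {2*pi..2*pi+s} x \<partial>lborel)"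
    by (rule nn_integral_add) measurable
  also have "(\<integral>\<^sup>+x. f x * indicator {2*pi..2*pi+s} x \<partial>lborel) = (\<integral>\<^sup>+x. f (x+2*pi) * indicator {2*pi..2*pi+s} (x+2*pi) \<partial>lborel)"
    by (rule nn_integral_lborel_shift[symmetric]) measurable
  also have "\<dots> = (\<integral>\<^sup>+x. f x * indicator {0..s} x \<partial>lborel)"
    by (intro nn_integral_cong) (auto simp: indicator_def per)
  also have "(\<integral>\<^sup>+x. f x * indicator {s..<2*pi} x \<partial>lborel) + \<dots> = (\<integral>\<^sup>+x. f x * indicator {s..<2*pi} x + f x * indicator {0..s} x \<partial>lborel)"
    by (rule nn_integral_add[symmetric]) measurable
  also have "\<dots> = (\<integral>\<^sup>+x. f x * indicator {0..2*pi} x \<partial>lborel)"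
    using s AE_lborel_singleton[of s] AE_lborel_singleton[of "2*pi"]
    by (intro nn_integral_cong_AE) (auto simp: indicator_def elim!: eventually_elim2)
  finally show ?thesis .
qed

text \<open>The representative of an angle in the half-open period from 0 to \<open>2*pi\<close>; it
  turns a rotation into a self-map of one period.\<close>

definition angle_mod :: "real \<Rightarrow> real" where "angle_mod x = x - 2*pi * of_int \<lfloor>x/(2*pi)\<rfloor>"

lemma angle_mod_measurable [measurable]: "angle_mod \<in> borel_measurable borel"
  unfolding angle_mod_def[abs_def] by measurable

lemma angle_mod_bounds: "0 \<le> angle_mod x" "angle_mod x < 2*pi"
proof -
  have "of_int \<lfloor>x/(2*pi)\<rfloor> \<le> x/(2*pi)" "x/(2*pi) < of_int \<lfloor>x/(2*pi)\<rfloor> + 1" by linarith+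
  then show "0 \<le> angle_mod x" "angle_mod x < 2*pi"
    using pi_gt_zero by (auto simp: angle_mod_def field_simps simp del: of_int_floor_le)
qed

lemma periodic_int:
  assumes "\<And>x. f (x + 2*pi) = f x" 
  shows "f (x + 2*pi * of_int k) = f x"
proof (induction k rule: int_induct[where k=0])
  case (step1 i)
  then show ?case using assms[of "x + 2*pi * of_int i"] by (simp add: algebra_simps)
next
  case (step2 i)
  then show ?case using assms[of "x + 2*pi * of_int (i-1)"] by (simp add: algebra_simps)
qed simp

lemma periodic_angle_mod:
  assumes "\<And>x. f (x + 2*pi) = f x" 
  shows "f (angle_mod x) = f x"
  using periodic_int[of f, OF assms, of "angle_mod x" "\<lfloor>x/(2*pi)\<rfloor>"] by (simp add: angle_mod_def)

lemma nn_integral_circ_rotate: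
  fixes f :: "real \<Rightarrow> ennreal"
  assumes [measurable]: "f \<in> borel_measurable borel" and per: "\<And>x. f (x + 2*pi) = f x"
  shows "(\<integral>\<^sup>+x. f (x + s) \<partial>circ) = (\<integral>\<^sup>+x. f x \<partial>circ)"
proof -
  have "f (x + s) = f (x + angle_mod s)" for x
    using periodic_int[of f "x + angle_mod s" "\<lfloor>s/(2*pi)\<rfloor>", OF per] by (simp add: angle_mod_def)
  then have "(\<integral>\<^sup>+x. f (x + s) \<partial>circ) = (\<integral>\<^sup>+x. f (x + angle_mod s) \<partial>circ)" by simp
  also have "\<dots> = (\<integral>\<^sup>+x. f x \<partial>circ)"
    using nn_integral_periodic_interval[of f "angle_mod s"] angle_mod_bounds[of s]
    by (simp add: nn_integral_circ per)
  finally show ?thesis .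
qed

lemma angle_mod_periodic: "angle_mod (x + 2*pi) = angle_mod x"
proof -
  have "(x + 2*pi)/(2*pi) = x/(2*pi) + 1" by (simp add: field_simps)
  then show ?thesis unfolding angle_mod_def by (simp add: algebra_simps)
qed

lemma AE_circ_angle_mod: "AE x in circ. angle_mod x = x"
proof -
  have "AE x in lborel. x \<in> {0..2*pi} \<longrightarrow> angle_mod x = x"
    using AE_lborel_singleton[of "2*pi"]
  proof eventually_elim
    case (elim x)
    have "x \<in> {0..<2*pi} \<Longrightarrow> \<lfloor>x/(2*pi)\<rfloor> = 0" by (auto simp: floor_eq_iff)
    with elim show ?case by (auto simp: angle_mod_def)
  qed
  then show ?thesis unfolding circ_def by (intro AE_uniform_measureI) auto
qed

text \<open>Invariance for nonnegative integrals, tested on the periodic function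
  \<open>indicator A (angle_mod x)\<close>. As an identity of measures it passes to Bochner
  integrals through \<open>integral_distr\<close>.\<close>

lemma distr_circ_rotate: "distr circ circ (\<lambda>x. angle_mod (x + s)) = circ"
proof (rule measure_eqI)
  fix A assume "A \<in> sets (distr circ circ (\<lambda>x. angle_mod (x + s)))"
  then have [measurable]: "A \<in> sets borel" by simp
  have "emeasure (distr circ circ (\<lambda>x. angle_mod (x + s))) A = (\<integral>\<^sup>+x. indicator A x \<partial>distr circ circ (\<lambda>x. angle_mod (x + s)))"
    by simp
  also have "\<dots> = (\<integral>\<^sup>+x. indicator A (angle_mod (x + s)) \<partial>circ)"
    by (subst nn_integral_distr) auto
  also have "\<dots> = (\<integral>\<^sup>+x. indicator A (angle_mod x) \<partial>circ)"
    by (rule nn_integral_circ_rotate[of "\<lambda>x. indicator A (angle_mod x)"]) (auto simp: angle_mod_periodic)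
  also have "\<dots> = (\<integral>\<^sup>+x. indicator A x \<partial>circ)"
    by (rule nn_integral_cong_AE) (use AE_circ_angle_mod in \<open>auto elim!: eventually_mono\<close>)
  finally show "emeasure (distr circ circ (\<lambda>x. angle_mod (x + s))) A = emeasure circ A" by simp
qed auto

lemma integral_circ_rotate:
  fixes f :: "real \<Rightarrow> 'a::{banach, second_countable_topology}"
  assumes [measurable]: "f \<in> borel_measurable borel" and per: "\<And>x. f (x + 2*pi) = f x"
  shows "(LINT x|circ. f (x + s)) = (LINT x|circ. f x)"
proof -
  have "(LINT x|circ. f x) = (LINT x|distr circ circ (\<lambda>x. angle_mod (x + s)). f x)"
    by (simp add: distr_circ_rotate)
  also have "\<dots> = (LINT x|circ. f (angle_mod (x + s)))"
    by (subst integral_distr) auto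
  also have "\<dots> = (LINT x|circ. f (x + s))"
    by (simp add: periodic_angle_mod[of f, OF per])
  finally show ?thesis by simp
qed

text \<open>Lebesgue measure is determined by its values on boxes, and a complex box is a product of
  two intervals. This opens the way to Fubini in the real and imaginary parts.\<close>

lemma lborel_complex: "lborel = distr (lborel \<Otimes>\<^sub>M lborel) borel (\<lambda>(x,y). Complex x y)"
proof (rule lborel_eqI)
  fix l u :: complex
  assume le: "\<And>b. b \<in> Basis \<Longrightarrow> l \<bullet> b \<le> u \<bullet> b"
  have le': "Re l \<le> Re u" "Im l \<le> Im u"
    using le[of 1] le[of \<i>] by (auto simp: Basis_complex_def inner_complex_def)
  have [measurable]: "(\<lambda>(x,y). Complex x y) \<in> lborel \<Otimes>\<^sub>M lborel \<rightarrow>\<^sub>M borel"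
  proof -
    have "(\<lambda>(x,y). Complex x y) = (\<lambda>p. of_real (fst p) + \<i> * of_real (snd p))" by (auto simp: fun_eq_iff complex_eq_iff)
    then show ?thesis by simp
  qed
  have "(\<lambda>(x,y). Complex x y) -` box l u \<inter> space (lborel \<Otimes>\<^sub>M lborel) = {Re l<..<Re u} \<times> {Im l<..<Im u}"
    by (auto simp: space_pair_measure box_def Basis_complex_def inner_complex_def)
  then show "emeasure (distr (lborel \<Otimes>\<^sub>M lborel) borel (\<lambda>(x,y). Complex x y)) (box l u) = (\<Prod>b\<in>Basis. (u - l) \<bullet> b)"
    using le' by (subst emeasure_distr) (auto simp: lborel.emeasure_pair_measure_Times Basis_complex_def inner_complex_def ennreal_mult' )
qed simp

section \<open>Cauchy's formula and polar coordinates\<close>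

text \<open>The contour integral over the circle has \<open>dw = i R cis t dt\<close>; division by
  \<open>2 pi i\<close> leaves an average over \<open>circ\<close>.\<close>

lemma circ_Cauchy_formula:
  assumes contf: "continuous_on (cball c R) f" and holf: "f holomorphic_on ball c R" and w: "w \<in> ball c R"
  shows "(LINT t|circ. f (c + of_real R * cis t) * (of_real R * cis t) / (c + of_real R * cis t - w) ^ Suc k)
     = (deriv ^^ k) f w / fact k"
proof -
  have R: "R > 0" using w by (metis ball_eq_empty empty_iff not_le)
  define h where "h t = f (c + of_real R * cis t) * (of_real R * cis t) / (c + of_real R * cis t - w) ^ Suc k" for t
  have "((\<lambda>u. f u / (u-w) ^ (Suc k)) has_contour_integral ((2 * pi * \<i>) / (fact k) * (deriv ^^ k) f w)) (part_circlepath c R 0 (2*pi))"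
    using Cauchy_has_contour_integral_higher_derivative_circlepath[OF assms, of k] by (simp add: circlepath_def)
  then have "((\<lambda>t. f (c + R * cis t) / (c + R * cis t - w) ^ (Suc k) * R * \<i> * cis t) has_integral ((2 * pi * \<i>) / (fact k) * (deriv ^^ k) f w)) {0..2*pi}"
    by (subst (asm) has_contour_integral_part_circlepath_iff) auto
  then have "((\<lambda>t. (1/\<i>) * (f (c + R * cis t) / (c + R * cis t - w) ^ (Suc k) * R * \<i> * cis t)) has_integral (1/\<i>) * ((2 * pi * \<i>) / (fact k) * (deriv ^^ k) f w)) {0..2*pi}"
    by (rule has_integral_mult_right)
  moreover have "(1/\<i>) * (f (c + R * cis t) / (c + R * cis t - w) ^ (Suc k) * R * \<i> * cis t) = h t" for t
  proof -
    have "(1/\<i>) * (a / D * r * \<i> * e) = a * (r * e) / D" for a D r e :: complex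
      by (cases "D = 0") (auto simp: field_simps)
    then show ?thesis unfolding h_def by blast
  qed
  moreover have "(1/\<i>) * ((2 * pi * \<i>) / (fact k) * (deriv ^^ k) f w) = (2 * pi) * ((deriv ^^ k) f w / fact k)"
    by (simp add: field_simps)
  ultimately have hi: "(h has_integral (2 * pi) * ((deriv ^^ k) f w / fact k)) {0..2*pi}"
    by (simp only:)
  have onc: "c + of_real R * cis t \<in> cball c R" "c + of_real R * cis t - w \<noteq> 0" for t
    using R w by (auto simp: dist_norm norm_mult norm_minus_commute)
  have conth: "continuous_on UNIV h"
    unfolding h_def
  proof (intro continuous_intros continuous_on_compose2[OF contf])
    show "range (\<lambda>x. c + complex_of_real R * cis x) \<subseteq> cball c R" using onc by blast
  qed (use onc in \<open>auto\<close>)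
  then have meas: "h \<in> borel_measurable borel" by (rule borel_measurable_continuous_onI)
  have "set_integrable lborel {0..2*pi} h"
    by (intro borel_integrable_atLeastAtMost' continuous_on_subset[OF conth]) auto
  then have "(LINT t:{0..2*pi}|lborel. h t) = (2 * pi) * ((deriv ^^ k) f w / fact k)"
    using hi by (simp add: set_borel_integral_eq_integral integral_unique)
  then show ?thesis
    using integral_circ[OF meas] unfolding h_def[symmetric] by (simp add: scaleR_conv_of_real)
qed

section \<open>Rotation invariance of area and polar coordinates\<close>

lemma nn_integral_complex:
  fixes f :: "complex \<Rightarrow> ennreal"
  assumes [measurable]: "f \<in> borel_measurable borel"
  shows "(\<integral>\<^sup>+z. f z \<partial>lborel) = (\<integral>\<^sup>+y. \<integral>\<^sup>+x. f (Complex x y) \<partial>lborel \<partial>lborel)"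
    and "(\<integral>\<^sup>+z. f z \<partial>lborel) = (\<integral>\<^sup>+x. \<integral>\<^sup>+y. f (Complex x y) \<partial>lborel \<partial>lborel)"
proof -
  have [measurable]: "(\<lambda>(x,y). Complex x y) \<in> lborel \<Otimes>\<^sub>M lborel \<rightarrow>\<^sub>M borel"
  proof -
    have "(\<lambda>(x,y). Complex x y) = (\<lambda>p. of_real (fst p) + \<i> * of_real (snd p))" by (auto simp: fun_eq_iff complex_eq_iff)
    then show ?thesis by simp
  qed
  have 1: "(\<integral>\<^sup>+z. f z \<partial>lborel) = (\<integral>\<^sup>+p. f (case p of (x,y) \<Rightarrow> Complex x y) \<partial>(lborel \<Otimes>\<^sub>M lborel))"
    by (subst lborel_complex, subst nn_integral_distr) auto
  show "(\<integral>\<^sup>+z. f z \<partial>lborel) = (\<integral>\<^sup>+y. \<integral>\<^sup>+x. f (Complex x y) \<partial>lborel \<partial>lborel)"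
    unfolding 1 by (subst lborel_pair.nn_integral_snd[symmetric]) auto
  show "(\<integral>\<^sup>+z. f z \<partial>lborel) = (\<integral>\<^sup>+x. \<integral>\<^sup>+y. f (Complex x y) \<partial>lborel \<partial>lborel)"
    unfolding 1 by (subst lborel.nn_integral_fst[symmetric]) auto
qed

lemma Complex_measurable [measurable]:
  assumes [measurable]: "f \<in> borel_measurable M" "g \<in> borel_measurable M"
  shows "(\<lambda>x. Complex (f x) (g x)) \<in> borel_measurable M"
  unfolding Complex_eq by measurable

lemma nn_integral_shear_Re:
  fixes f :: "complex \<Rightarrow> ennreal"
  assumes [measurable]: "f \<in> borel_measurable borel"
  shows "(\<integral>\<^sup>+z. f (Complex (Re z + k * Im z) (Im z)) \<partial>lborel) = (\<integral>\<^sup>+z. f z \<partial>lborel)"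
proof -
  have "(\<integral>\<^sup>+z. f (Complex (Re z + k * Im z) (Im z)) \<partial>lborel) = (\<integral>\<^sup>+y. \<integral>\<^sup>+x. f (Complex (x + k * y) y) \<partial>lborel \<partial>lborel)"
  proof -
    have "(\<lambda>z. f (Complex (Re z + k * Im z) (Im z))) \<in> borel_measurable borel"
      by (rule measurable_compose[OF _ assms]) measurable
    from nn_integral_complex(1)[OF this] show ?thesis by simp
  qed
  also have "\<dots> = (\<integral>\<^sup>+y. \<integral>\<^sup>+x. f (Complex x y) \<partial>lborel \<partial>lborel)"
  proof (rule nn_integral_cong)
    show "(\<integral>\<^sup>+x. f (Complex (x + k * y) y) \<partial>lborel) = (\<integral>\<^sup>+x. f (Complex x y) \<partial>lborel)" for y
      by (rule nn_integral_lborel_shift[of "\<lambda>x. f (Complex x y)"]) measurable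
  qed
  finally show ?thesis by (simp only: nn_integral_complex(1)[OF assms])
qed

lemma nn_integral_shear_Im:
  fixes f :: "complex \<Rightarrow> ennreal"
  assumes [measurable]: "f \<in> borel_measurable borel"
  shows "(\<integral>\<^sup>+z. f (Complex (Re z) (Im z + k * Re z)) \<partial>lborel) = (\<integral>\<^sup>+z. f z \<partial>lborel)"
proof -
  have "(\<integral>\<^sup>+z. f (Complex (Re z) (Im z + k * Re z)) \<partial>lborel) = (\<integral>\<^sup>+x. \<integral>\<^sup>+y. f (Complex x (y + k * x)) \<partial>lborel \<partial>lborel)"
  proof -
    have "(\<lambda>z. f (Complex (Re z) (Im z + k * Re z))) \<in> borel_measurable borel"
      by (rule measurable_compose[OF _ assms]) measurable
    from nn_integral_complex(2)[OF this] show ?thesis by simp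
  qed
  also have "\<dots> = (\<integral>\<^sup>+x. \<integral>\<^sup>+y. f (Complex x y) \<partial>lborel \<partial>lborel)"
  proof (rule nn_integral_cong)
    show "(\<integral>\<^sup>+y. f (Complex x (y + k * x)) \<partial>lborel) = (\<integral>\<^sup>+y. f (Complex x y) \<partial>lborel)" for x
      by (rule nn_integral_lborel_shift[of "\<lambda>y. f (Complex x y)"]) measurable
  qed
  finally show ?thesis by (simp only: nn_integral_complex(2)[OF assms])
qed

text \<open>A rotation other than \<open>z \<mapsto> - z\<close> is a product of three shears, each area preserving by Fubini.\<close>

lemma nn_integral_rotate_complex_aux:
  fixes f :: "complex \<Rightarrow> ennreal"
  assumes [measurable]: "f \<in> borel_measurable borel" and c: "norm c = 1" "c \<noteq> -1"
  shows "(\<integral>\<^sup>+z. f (c * z) \<partial>lborel) = (\<integral>\<^sup>+z. f z \<partial>lborel)"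
proof -
  define a b where "a = Re c" and "b = Im c"
  have ab: "a\<^sup>2 + b\<^sup>2 = 1" using c(1) by (metis a_def b_def cmod_power2 one_power2)
  have a: "1 + a \<noteq> 0"
  proof
    assume "1 + a = 0" then have "a = -1" "b = 0" using ab by (auto simp: add_eq_0_iff)
    then show False using c(2) by (auto simp: a_def b_def complex_eq_iff)
  qed
  \<comment> \<open>For \<open>c = cis t\<close> this is \<open>- tan (t / 2)\<close>, the shear
    factor for which the shears by \<open>k\<close>, \<open>b\<close>, \<open>k\<close> compose to
    the rotation by \<open>t\<close>; it is undefined only at \<open>c = -1\<close>.\<close>
  define k where "k = - b / (1 + a)"
  have "b * b = (1 + a) * (1 - a)" using ab by (simp add: algebra_simps power2_eq_square)
  then have kb: "1 + k * b = a" using a unfolding k_def by (simp add: field_simps)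
  have ka: "k * (1 + a) = - b" using a unfolding k_def by (simp add: field_simps)
  define Sx where "Sx k z = Complex (Re z + k * Im z) (Im z)" for k z
  define Sy where "Sy k z = Complex (Re z) (Im z + k * Re z)" for k z
  have [measurable]: "Sx k \<in> borel_measurable borel" "Sy k \<in> borel_measurable borel" for k
    unfolding Sx_def[abs_def] Sy_def[abs_def] by measurable
  have "c * z = Sx k (Sy b (Sx k z))" for z
  proof -
    have re: "Re (Sx k (Sy b (Sx k z))) = (1 + k * b) * Re z + (k * (1 + (1 + k * b))) * Im z"
      by (simp add: Sx_def Sy_def algebra_simps)
    have im: "Im (Sx k (Sy b (Sx k z))) = b * Re z + (1 + k * b) * Im z"
      by (simp add: Sx_def Sy_def algebra_simps)
    show ?thesis using re im unfolding kb ka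
      by (simp add: complex_eq_iff a_def b_def)
  qed
  then have "(\<integral>\<^sup>+z. f (c * z) \<partial>lborel) = (\<integral>\<^sup>+z. f (Sx k (Sy b (Sx k z))) \<partial>lborel)" by simp
  also have "\<dots> = (\<integral>\<^sup>+z. f (Sx k (Sy b z)) \<partial>lborel)"
    using nn_integral_shear_Re[of "\<lambda>z. f (Sx k (Sy b z))" k] by (simp add: Sx_def)
  also have "\<dots> = (\<integral>\<^sup>+z. f (Sx k z) \<partial>lborel)"
    using nn_integral_shear_Im[of "\<lambda>z. f (Sx k z)" b] by (simp add: Sy_def)
  also have "\<dots> = (\<integral>\<^sup>+z. f z \<partial>lborel)"
    using nn_integral_shear_Re[of f k] by (simp add: Sx_def)
  finally show ?thesis .
qed

lemma nn_integral_rotate_complex: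
  fixes f :: "complex \<Rightarrow> ennreal"
  assumes [measurable]: "f \<in> borel_measurable borel" and c: "norm c = 1"
  shows "(\<integral>\<^sup>+z. f (c * z) \<partial>lborel) = (\<integral>\<^sup>+z. f z \<partial>lborel)"
proof (cases "c = -1")
  \<comment> \<open>The half turn is the square of the quarter turn by \<open>\<i>\<close>, which
    the three shears do cover.\<close>
  case True
  have "(\<integral>\<^sup>+z. f (\<i> * (\<i> * z)) \<partial>lborel) = (\<integral>\<^sup>+z. f (\<i> * z) \<partial>lborel)"
    by (rule nn_integral_rotate_complex_aux[of "\<lambda>z. f (\<i> * z)"]) (auto simp: complex_eq_iff)
  also have "\<dots> = (\<integral>\<^sup>+z. f z \<partial>lborel)"
    by (rule nn_integral_rotate_complex_aux) (auto simp: complex_eq_iff)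
  finally show ?thesis using True by (simp add: mult.assoc[symmetric])
qed (use nn_integral_rotate_complex_aux[OF assms] in auto)

lemma cis_measurable [measurable]: "cis \<in> borel_measurable borel"
  by (intro borel_measurable_continuous_onI continuous_intros)

lemma ball_measurable [measurable]: "ball (c::'a::euclidean_space) r \<in> sets borel"
  by simp

text \<open>Finite measures on the line agree if they agree on all half-lines \<open>{x<..}\<close>.
  For \<open>0 \<le> x \<le> 1\<close> both sides are the area \<open>pi - pi * x^2\<close> of an
  annulus; the other \<open>x\<close> give the full disc or nothing.\<close>

lemma distr_norm_disc:
  "distr (density lborel (indicator (ball (0::complex) 1))) borel norm
    = density lborel (\<lambda>s. ennreal (2 * pi * s) * indicator {0<..<1} s)" (is "?L = ?R")
proof (rule measure_eqI_lessThan)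
  have L: "emeasure ?L {x<..} = emeasure lborel (ball (0::complex) 1 \<inter> {z. x < norm z})" for x
  proof -
    have "emeasure ?L {x<..} = (\<integral>\<^sup>+z. indicator (ball (0::complex) 1) z * indicator {z. x < norm z} z \<partial>lborel)"
    proof -
      have "norm -` {x<..} = {z::complex. x < norm z}" by auto
      moreover have "{z::complex. x < norm z} \<in> sets borel" by measurable
      ultimately show ?thesis by (simp add: emeasure_distr emeasure_density)
    qed
    also have "\<dots> = (\<integral>\<^sup>+z. indicator (ball (0::complex) 1 \<inter> {z. x < norm z}) z \<partial>lborel)"
      by (simp add: indicator_inter_arith)
    finally show ?thesis by simp
  qed
  have D: "emeasure lborel (ball (0::complex) 1) = ennreal pi"
    by (subst emeasure_ball) (auto simp: unit_ball_vol_2)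
  show "emeasure ?L {x<..} < \<infinity>" for x
  proof -
    have "emeasure ?L {x<..} \<le> emeasure lborel (ball (0::complex) 1)"
      unfolding L by (intro emeasure_mono) auto
    then show ?thesis unfolding D by (auto intro: le_less_trans)
  qed
  show "emeasure ?L {x<..} = emeasure ?R {x<..}" for x
  proof -
    have R: "emeasure ?R {x<..} = (\<integral>\<^sup>+s. ennreal (2 * pi * s) * indicator ({0<..<1} \<inter> {x<..}) s \<partial>lborel)"
      by (subst emeasure_density) (auto intro!: nn_integral_cong simp: indicator_def)
    consider "x < 0" | "0 \<le> x" "x \<le> 1" | "x > 1" by linarith
    then show ?thesis
    proof cases
      case 1
      then have "emeasure ?L {x<..} = ennreal pi" unfolding L D[symmetric]
        by (intro arg_cong[where f="emeasure lborel"]) (auto intro: less_le_trans)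
      moreover have "emeasure ?R {x<..} = (\<integral>\<^sup>+s. ennreal (2 * pi * s) * indicator {0..1} s \<partial>lborel)"
        unfolding R using AE_lborel_singleton[of 0] AE_lborel_singleton[of 1] 1
        by (intro nn_integral_cong_AE) (auto simp: indicator_def elim!: eventually_elim2)
      moreover have "\<dots> = ennreal (pi * 1\<^sup>2 - pi * 0\<^sup>2)"
        by (rule nn_integral_FTC_Icc) (auto intro!: derivative_eq_intros)
      ultimately show ?thesis by simp
    next
      case 2
      have "ball (0::complex) 1 \<inter> {z. x < norm z} = ball 0 1 - cball 0 x" by auto
      moreover have "emeasure lborel (ball 0 1 - cball (0::complex) x) = emeasure lborel (ball (0::complex) 1) - emeasure lborel (cball (0::complex) x)"
      proof (cases "x = 1")
        case True
        have "ball 0 1 - cball 0 x = ({} :: complex set)" using True by auto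
        then show ?thesis by (simp only:) (simp add: True D emeasure_cball unit_ball_vol_2)
      next
        case False
        then show ?thesis using 2 by (intro emeasure_Diff) (auto simp: emeasure_cball)
      qed
      ultimately have "emeasure ?L {x<..} = emeasure lborel (ball (0::complex) 1) - emeasure lborel (cball (0::complex) x)"
        unfolding L by simp
      then have "emeasure ?L {x<..} = ennreal (pi - pi * x\<^sup>2)"
        using 2 unfolding D by (simp add: emeasure_cball unit_ball_vol_2 ennreal_minus)
      moreover have "emeasure ?R {x<..} = (\<integral>\<^sup>+s. ennreal (2 * pi * s) * indicator {x..1} s \<partial>lborel)"
        unfolding R using AE_lborel_singleton[of x] AE_lborel_singleton[of 1] 2
        by (intro nn_integral_cong_AE) (auto simp: indicator_def elim!: eventually_elim2)
      moreover have "\<dots> = ennreal (pi * 1\<^sup>2 - pi * x\<^sup>2)"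
        using 2 by (intro nn_integral_FTC_Icc) (auto intro!: derivative_eq_intros)
      ultimately show ?thesis by simp
    next
      case 3
      then have "ball (0::complex) 1 \<inter> {z. x < norm z} = {}" "{0<..<1} \<inter> {x<..} = {}" by auto
      then show ?thesis unfolding L R by (simp del: greaterThan_Int_greaterThan)
    qed
  qed
qed auto

text \<open>Averaging over all rotations makes the integrand radial, so no change of variables is needed.\<close>

lemma nn_integral_disc_polar:
  fixes f :: "complex \<Rightarrow> ennreal"
  assumes [measurable]: "f \<in> borel_measurable borel"
  shows "(\<integral>\<^sup>+z. f z * indicator (ball 0 1) z \<partial>lborel)
    = (\<integral>\<^sup>+s. (\<integral>\<^sup>+\<theta>. f (of_real s * cis \<theta>) \<partial>circ) * ennreal (2 * pi * s) * indicator {0<..<1} s \<partial>lborel)"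
proof -
  interpret pair_sigma_finite circ "lborel :: complex measure" ..
  define M where "M s = (\<integral>\<^sup>+\<theta>. f (of_real s * cis \<theta>) \<partial>circ)" for s
  have [measurable]: "M \<in> borel_measurable borel" unfolding M_def[abs_def] by measurable
  have M: "(\<integral>\<^sup>+\<theta>. f (cis \<theta> * z) \<partial>circ) = M (norm z)" for z
  proof -
    have "f (cis \<theta> * z) = f (of_real (norm z) * cis (\<theta> + Arg z))" for \<theta>
      by (metis cis_mult mult.assoc mult.commute rcis_cmod_Arg rcis_def)
    then have "(\<integral>\<^sup>+\<theta>. f (cis \<theta> * z) \<partial>circ) = (\<integral>\<^sup>+\<theta>. f (of_real (norm z) * cis (\<theta> + Arg z)) \<partial>circ)" by simp
    also have "\<dots> = M (norm z)" unfolding M_def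
      by (rule nn_integral_circ_rotate[of "\<lambda>\<theta>. f (of_real (norm z) * cis \<theta>)"]) (auto simp: cis_mult[symmetric])
    finally show ?thesis .
  qed
  have "(\<integral>\<^sup>+z. f z * indicator (ball 0 1) z \<partial>lborel) = (\<integral>\<^sup>+\<theta>. \<integral>\<^sup>+z. f z * indicator (ball 0 1) z \<partial>lborel \<partial>circ)"
    by (simp add: nn_integral_const)
  also have "\<dots> = (\<integral>\<^sup>+\<theta>. \<integral>\<^sup>+z. f (cis \<theta> * z) * indicator (ball 0 1) z \<partial>lborel \<partial>circ)"
  proof (rule nn_integral_cong)
    fix \<theta>
    have "(\<integral>\<^sup>+z. f (cis \<theta> * z) * indicator (ball 0 1) (cis \<theta> * z) \<partial>lborel) = (\<integral>\<^sup>+z. f z * indicator (ball 0 1) z \<partial>lborel)"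
      by (rule nn_integral_rotate_complex[of "\<lambda>z. f z * indicator (ball 0 1) z"]) auto
    then show "(\<integral>\<^sup>+z. f z * indicator (ball 0 1) z \<partial>lborel) = (\<integral>\<^sup>+z. f (cis \<theta> * z) * indicator (ball 0 1) z \<partial>lborel)"
      by (simp add: indicator_def norm_mult)
  qed
  also have "\<dots> = (\<integral>\<^sup>+z. \<integral>\<^sup>+\<theta>. f (cis \<theta> * z) * indicator (ball 0 1) z \<partial>circ \<partial>lborel)"
    by (rule Fubini'[symmetric]) measurable
  also have "\<dots> = (\<integral>\<^sup>+z. M (norm (z::complex)) * indicator (ball 0 1) z \<partial>lborel)"
    by (subst nn_integral_multc) (auto simp: M)
  also have "\<dots> = (\<integral>\<^sup>+s. M s \<partial>distr (density lborel (indicator (ball (0::complex) 1))) borel norm)"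
    by (subst nn_integral_distr, simp, simp, subst nn_integral_density) (auto simp: mult.commute)
  also have "\<dots> = (\<integral>\<^sup>+s. M s * ennreal (2 * pi * s) * indicator {0<..<1} s \<partial>lborel)"
    unfolding distr_norm_disc by (subst nn_integral_density) (auto simp: mult_ac)
  finally show ?thesis unfolding M_def .
qed

section \<open>Integral inequalities\<close>

text \<open>Rearranged, the convex function \<open>u powr p\<close> lies above its tangent at
  \<open>c\<close>, with equality at \<open>u = c\<close>. The scale \<open>c\<close> stays free in
  order to be optimised later.\<close>

lemma young_tangent:
  fixes u c p :: real
  assumes "u \<ge> 0" "c > 0" "p > 1"
  shows "u \<le> (c powr (1-p) * u powr p + (p-1) * c) / p"
proof (cases "u = 0")
  case False
  then have u: "u > 0" using assms by simp
  have "((u/c) powr p) powr (1/p) * 1 powr (1-1/p) \<le> (1/p) * ((u/c) powr p) + (1-1/p) * 1"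
    using assms u by (intro Youngs_inequality_0) auto
  then have "u/c \<le> (1/p) * ((u/c) powr p) + (1-1/p)"
    using assms u by (simp add: powr_powr)
  then have "c * (u/c) \<le> c * ((1/p) * ((u/c) powr p) + (1-1/p))"
    using assms by (intro mult_left_mono) auto
  also have "\<dots> = (c powr (1-p) * u powr p + (p-1) * c) / p"
    using assms u by (simp add: field_simps powr_diff powr_divide)
  finally show ?thesis using assms by simp
qed (use assms in auto)

text \<open>The tangent estimate is applied pointwise at \<open>c * N x\<close> and then integrated.
  Points with \<open>N x = 0\<close> do no harm because \<open>g x\<close> vanishes there as well.
  The case \<open>B = 0\<close> is separate since the optimal scale would degenerate to
  \<open>0\<close>.\<close>

lemma nn_integral_Hoelder_weighted:
  fixes g N :: "'a \<Rightarrow> real"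
  assumes p: "p > 1" and [measurable]: "g \<in> borel_measurable M" "N \<in> borel_measurable M"
    and g: "\<And>x. g x \<ge> 0" and N: "\<And>x. N x \<ge> 0" "\<And>x. N x = 0 \<Longrightarrow> g x = 0"
    and A: "A > 0" "(\<integral>\<^sup>+x. ennreal (N x) \<partial>M) \<le> ennreal A"
    and B: "B \<ge> 0" "(\<integral>\<^sup>+x. ennreal (g x powr p * N x powr (1-p)) \<partial>M) \<le> ennreal B"
  shows "(\<integral>\<^sup>+x. ennreal (g x) \<partial>M) \<le> ennreal ((A powr (p-1) * B) powr (1/p))"
proof (cases "B = 0")
  case True
  then have "(\<integral>\<^sup>+x. ennreal (g x powr p * N x powr (1-p)) \<partial>M) = 0" using B by simp
  then have "AE x in M. ennreal (g x powr p * N x powr (1-p)) = 0"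
    by (subst (asm) nn_integral_0_iff_AE) auto
  then have "AE x in M. ennreal (g x) = 0"
    by eventually_elim (use N in \<open>auto simp: ennreal_eq_0_iff mult_le_0_iff\<close>)
  then have "(\<integral>\<^sup>+x. ennreal (g x) \<partial>M) = 0" by (subst nn_integral_0_iff_AE) auto
  then show ?thesis by simp
next
  case False
  then have B0: "B > 0" using B by simp
  \<comment> \<open>The balancing scale: it gives \<open>c powr (1-p) * B = c * A\<close>, so that
    the two terms of the tangent estimate add up to \<open>c * A\<close>, which is the Hoelder
    bound.\<close>
  define c where "c = (B/A) powr (1/p)"
  have c: "c > 0" using A B0 by (simp add: c_def)
  have cB: "c powr (1-p) * B = c * A"
  proof -
    have "c powr p = B/A" using A B0 p by (simp add: c_def powr_powr)
    then show ?thesis using c A B0 by (simp add: powr_diff)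
  qed
  have cA: "c * A = (A powr (p-1) * B) powr (1/p)"
  proof -
    have "(c * A) powr p = A powr (p-1) * B"
      using A B0 p c by (simp add: c_def powr_mult powr_powr powr_diff)
    then have "((c * A) powr p) powr (1/p) = (A powr (p-1) * B) powr (1/p)" by simp
    then show ?thesis using p c A by (simp add: powr_powr)
  qed
  have pt: "g x \<le> (c powr (1-p) / p) * (g x powr p * N x powr (1-p)) + ((p-1) * c / p) * N x" for x
  proof (cases "N x = 0")
    case False
    then have Nx: "N x > 0" using N(1)[of x] by simp
    have "g x \<le> ((c * N x) powr (1-p) * g x powr p + (p-1) * (c * N x)) / p"
      using young_tangent[of "g x" "c * N x" p] g c Nx p by simp
    also have "\<dots> = (c powr (1-p) / p) * (g x powr p * N x powr (1-p)) + ((p-1) * c / p) * N x"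
      using c Nx by (simp add: powr_mult add_divide_distrib mult_ac)
    finally show ?thesis .
  qed (use N in auto)
  have "(\<integral>\<^sup>+x. ennreal (g x) \<partial>M) \<le> (\<integral>\<^sup>+x. ennreal (c powr (1-p) / p) * ennreal (g x powr p * N x powr (1-p)) + ennreal ((p-1) * c / p) * ennreal (N x) \<partial>M)"
    by (intro nn_integral_mono) (use pt p c N in \<open>auto simp: ennreal_mult'[symmetric] ennreal_plus[symmetric] simp del: ennreal_plus intro!: ennreal_leI\<close>)
  also have "\<dots> = ennreal (c powr (1-p) / p) * (\<integral>\<^sup>+x. ennreal (g x powr p * N x powr (1-p)) \<partial>M) + ennreal ((p-1) * c / p) * (\<integral>\<^sup>+x. ennreal (N x) \<partial>M)"
    by (subst nn_integral_add) (auto simp: nn_integral_cmult)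
  also have "\<dots> \<le> ennreal (c powr (1-p) / p) * ennreal B + ennreal ((p-1) * c / p) * ennreal A"
    by (intro add_mono mult_left_mono A B) auto
  also have "\<dots> = ennreal ((c powr (1-p) * B) / p + (p-1) * c / p * A)"
    using p c A B by (simp add: ennreal_mult'[symmetric] ennreal_plus[symmetric] del: ennreal_plus)
  also have "(c powr (1-p) * B) / p + (p-1) * c / p * A = c * A"
    unfolding cB using p by (simp add: field_simps)
  finally show ?thesis unfolding cA .
qed

lemma norm_integral_le_nn_integral:
  fixes f :: "'a \<Rightarrow> 'b::{banach, second_countable_topology}"
  shows "ennreal (norm (integral\<^sup>L M f)) \<le> (\<integral>\<^sup>+x. ennreal (norm (f x)) \<partial>M)"
  by (cases "integrable M f") (auto simp: integral_norm_bound_ennreal not_integrable_integral_eq)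

text \<open>No integrability is assumed: the integral of a non-integrable function is \<open>0\<close>.\<close>

lemma norm_integral_powr_le:
  fixes f :: "'a \<Rightarrow> 'b::{banach, second_countable_topology}"
  assumes p: "p > 1" and [measurable]: "f \<in> borel_measurable M" "N \<in> borel_measurable M"
    and N: "\<And>x. N x \<ge> 0" "\<And>x. N x = 0 \<Longrightarrow> f x = 0"
    and A: "A > 0" "(\<integral>\<^sup>+x. ennreal (N x) \<partial>M) \<le> ennreal A"
  shows "ennreal (norm (integral\<^sup>L M f) powr p) \<le> ennreal (A powr (p-1)) * (\<integral>\<^sup>+x. ennreal (norm (f x) powr p * N x powr (1-p)) \<partial>M)"
proof (cases "(\<integral>\<^sup>+x. ennreal (norm (f x) powr p * N x powr (1-p)) \<partial>M)")
  case top
  then show ?thesis using A by (simp add: ennreal_mult_top)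
next
  case (real B)
  have "ennreal (norm (integral\<^sup>L M f)) \<le> (\<integral>\<^sup>+x. ennreal (norm (f x)) \<partial>M)"
    by (rule norm_integral_le_nn_integral)
  also have "\<dots> \<le> ennreal ((A powr (p-1) * B) powr (1/p))"
    by (rule nn_integral_Hoelder_weighted[OF p, of _ _ N]) (use assms real in auto)
  finally have "norm (integral\<^sup>L M f) \<le> (A powr (p-1) * B) powr (1/p)" by simp
  then have "norm (integral\<^sup>L M f) powr p \<le> ((A powr (p-1) * B) powr (1/p)) powr p"
    using p by (intro powr_mono2) auto
  also have "\<dots> = A powr (p-1) * B" using p real A by (simp add: powr_powr)
  finally show ?thesis using real by (simp add: ennreal_mult'[symmetric])
qed

text \<open>Hoelder with the weight \<open>N y\<close> and Tonelli; unlike the usual duality proof this needs no a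
  priori finiteness of the left-hand side.\<close>

lemma Minkowski_integral_bound:
  fixes F :: "'a \<Rightarrow> 'b \<Rightarrow> 'c::{banach, second_countable_topology}"
  assumes p: "p > 1" and "sigma_finite_measure M1" "sigma_finite_measure M2"
    and [measurable]: "(\<lambda>(x,y). F x y) \<in> borel_measurable (M1 \<Otimes>\<^sub>M M2)" "N \<in> borel_measurable M2"
    and N: "\<And>y. N y \<ge> 0" "\<And>x y. N y = 0 \<Longrightarrow> F x y = 0"
    and A: "A \<ge> 0" "(\<integral>\<^sup>+y. ennreal (N y) \<partial>M2) \<le> ennreal A"
    and bd: "\<And>y. y \<in> space M2 \<Longrightarrow> (\<integral>\<^sup>+x. ennreal (norm (F x y) powr p) \<partial>M1) \<le> ennreal (N y powr p)"
  shows "(\<integral>\<^sup>+x. ennreal (norm (\<integral>y. F x y \<partial>M2) powr p) \<partial>M1) \<le> ennreal (A powr p)"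
proof (cases "A = 0")
  case True
  then have "(\<integral>\<^sup>+y. ennreal (N y) \<partial>M2) = 0" using A(2) by simp
  then have "AE y in M2. ennreal (N y) = 0" by (subst (asm) nn_integral_0_iff_AE) auto
  then have ae: "AE y in M2. F x y = 0" for x
    by eventually_elim (use N in \<open>auto simp: ennreal_eq_0_iff intro: antisym\<close>)
  then have "(\<integral>y. F x y \<partial>M2) = 0" for x by (rule integral_eq_zero_AE)
  then show ?thesis by simp
next
  case False
  then have A: "A > 0" "(\<integral>\<^sup>+y. ennreal (N y) \<partial>M2) \<le> ennreal A" using A by auto
  interpret M1: sigma_finite_measure M1 by fact
  interpret M2: sigma_finite_measure M2 by fact
  interpret pair_sigma_finite M1 M2 ..
  have "(\<integral>\<^sup>+x. ennreal (norm (\<integral>y. F x y \<partial>M2) powr p) \<partial>M1) \<le>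
      (\<integral>\<^sup>+x. ennreal (A powr (p-1)) * (\<integral>\<^sup>+y. ennreal (norm (F x y) powr p * N y powr (1-p)) \<partial>M2) \<partial>M1)"
    by (intro nn_integral_mono norm_integral_powr_le[OF p]) (use N A in auto)
  also have "\<dots> = ennreal (A powr (p-1)) * (\<integral>\<^sup>+x. \<integral>\<^sup>+y. ennreal (norm (F x y) powr p * N y powr (1-p)) \<partial>M2 \<partial>M1)"
    by (rule nn_integral_cmult) measurable
  also have "(\<integral>\<^sup>+x. \<integral>\<^sup>+y. ennreal (norm (F x y) powr p * N y powr (1-p)) \<partial>M2 \<partial>M1)
    = (\<integral>\<^sup>+y. \<integral>\<^sup>+x. ennreal (norm (F x y) powr p * N y powr (1-p)) \<partial>M1 \<partial>M2)"
    by (rule Fubini'[symmetric]) measurable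
  also have "\<dots> \<le> (\<integral>\<^sup>+y. ennreal (N y) \<partial>M2)"
  proof (rule nn_integral_mono)
    fix y assume y: "y \<in> space M2"
    have [measurable]: "(\<lambda>x. F x y) \<in> borel_measurable M1"
      using measurable_compose[OF measurable_Pair2'[OF y], of "\<lambda>(x,y). F x y" M1] assms(4) by simp
    have "(\<integral>\<^sup>+x. ennreal (norm (F x y) powr p * N y powr (1-p)) \<partial>M1)
      = (\<integral>\<^sup>+x. ennreal (norm (F x y) powr p) \<partial>M1) * ennreal (N y powr (1-p))"
      by (subst nn_integral_multc[symmetric]) (auto simp: ennreal_mult')
    also have "\<dots> \<le> ennreal (N y powr p) * ennreal (N y powr (1-p))"
      by (intro mult_right_mono bd y) auto
    also have "\<dots> = ennreal (N y)"
      using N(1)[of y] by (cases "N y = 0") (auto simp: ennreal_mult'[symmetric] powr_add[symmetric])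
    finally show "(\<integral>\<^sup>+x. ennreal (norm (F x y) powr p * N y powr (1-p)) \<partial>M1) \<le> ennreal (N y)" .
  qed
  also have "\<dots> \<le> ennreal A" by fact
  finally have "(\<integral>\<^sup>+x. ennreal (norm (\<integral>y. F x y \<partial>M2) powr p) \<partial>M1) \<le> ennreal (A powr (p-1)) * ennreal A"
    by (simp add: mult_left_mono)
  also have "\<dots> = ennreal (A powr p)" using A by (simp add: ennreal_mult'[symmetric] powr_diff)
  finally show ?thesis .
qed

text \<open>For \<open>x \<le> d\<close> the factor \<open>(d + x) powr (-\<nu>)\<close> is at most
  \<open>d powr (-\<nu>)\<close>, beyond that at most \<open>x powr (-\<nu>)\<close>. The two
  hypotheses are convergence at 0 and at infinity; together they make \<open>\<nu>\<close>
  positive.\<close>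

lemma nn_integral_powr_kernel:
  fixes \<mu> \<nu> :: real
  assumes "\<mu> > -1" "\<mu> - \<nu> < -1"
  obtains C where "C > 0" "\<And>d. d > 0 \<Longrightarrow> (\<integral>\<^sup>+x. ennreal (x powr \<mu> * (d + x) powr (-\<nu>)) * indicator {0<..} x \<partial>lborel) \<le> ennreal (C * d powr (\<mu> - \<nu> + 1))"
proof (rule that)
  let ?C = "1 / (\<mu>+1) + 1 / (\<nu>-\<mu>-1)"
  show "?C > 0" using assms by (intro add_pos_pos) auto
  fix d :: real assume d: "d > 0"
  have "(\<integral>\<^sup>+x. ennreal (x powr \<mu> * (d + x) powr (-\<nu>)) * indicator {0<..} x \<partial>lborel)
    \<le> (\<integral>\<^sup>+x. ennreal (d powr (-\<nu>)) * (indicator {0..d} x * ennreal (x powr \<mu>)) + indicator {d..} x * ennreal (x powr (\<mu>-\<nu>)) \<partial>lborel)"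
  proof (rule nn_integral_mono)
    fix x :: real
    have "x powr \<mu> * (d + x) powr (-\<nu>) \<le> d powr (-\<nu>) * x powr \<mu>" if "0 < x" 
      using that d assms by (simp add: mult.commute) (intro mult_right_mono powr_mono2', auto)
    moreover have "x powr \<mu> * (d + x) powr (-\<nu>) \<le> x powr (\<mu>-\<nu>)" if "0 < x"
    proof -
      have "x powr \<mu> * (d + x) powr (-\<nu>) \<le> x powr \<mu> * x powr (-\<nu>)"
        using that d assms by (intro mult_left_mono powr_mono2') auto
      then show ?thesis using that by (simp add: powr_add[symmetric])
    qed
    ultimately show "ennreal (x powr \<mu> * (d + x) powr (-\<nu>)) * indicator {0<..} x \<le> ennreal (d powr (-\<nu>)) * (indicator {0..d} x * ennreal (x powr \<mu>)) + indicator {d..} x * ennreal (x powr (\<mu>-\<nu>))"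
      using d by (cases "x \<le> d") (auto simp: indicator_def ennreal_mult'[symmetric] intro!: ennreal_leI add_increasing2)
  qed
  also have "\<dots> = ennreal (d powr (-\<nu>)) * (\<integral>\<^sup>+x. indicator {0..d} x * ennreal (x powr \<mu>) \<partial>lborel) + (\<integral>\<^sup>+x. indicator {d..} x * ennreal (x powr (\<mu>-\<nu>)) \<partial>lborel)"
    by (subst nn_integral_add) (auto simp: nn_integral_cmult)
  also have "(\<integral>\<^sup>+x. indicator {0..d} x * ennreal (x powr \<mu>) \<partial>lborel) = ennreal (d powr (\<mu>+1) / (\<mu>+1))"
    using nn_integral_has_integral_lebesgue[OF _ has_integral_powr_from_0[of \<mu> d]] assms d
    by (simp add: ennreal_mult' ennreal_indicator)
  also have "(\<integral>\<^sup>+x. indicator {d..} x * ennreal (x powr (\<mu>-\<nu>)) \<partial>lborel) = ennreal (- (d powr (\<mu>-\<nu>+1)) / (\<mu>-\<nu>+1))"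
    using nn_integral_has_integral_lebesgue[OF _ has_integral_powr_to_inf[of "\<mu>-\<nu>" d]] assms d
    by (simp add: ennreal_mult' ennreal_indicator)
  also have "ennreal (d powr (-\<nu>)) * ennreal (d powr (\<mu>+1) / (\<mu>+1)) + ennreal (- (d powr (\<mu>-\<nu>+1)) / (\<mu>-\<nu>+1)) 
     = ennreal (d powr (-\<nu>) * (d powr (\<mu>+1) / (\<mu>+1)) + - (d powr (\<mu>-\<nu>+1)) / (\<mu>-\<nu>+1))"
    using assms d by (subst ennreal_plus) (auto simp: ennreal_mult'[symmetric] divide_nonneg_neg zero_le_divide_iff)
  also have "d powr (-\<nu>) * (d powr (\<mu>+1) / (\<mu>+1)) + - (d powr (\<mu>-\<nu>+1)) / (\<mu>-\<nu>+1) = ?C * d powr (\<mu> - \<nu> + 1)"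
  proof -
    have "d powr (-\<nu>) * d powr (\<mu>+1) = d powr (\<mu> - \<nu> + 1)" by (simp add: powr_add[symmetric] algebra_simps)
    moreover have "- (d powr (\<mu>-\<nu>+1)) / (\<mu>-\<nu>+1) = d powr (\<mu>-\<nu>+1) / (\<nu>-\<mu>-1)"
      using assms by (simp add: divide_simps) (simp add: algebra_simps)
    ultimately show ?thesis by (simp add: distrib_right)
  qed
  finally show "(\<integral>\<^sup>+x. ennreal (x powr \<mu> * (d + x) powr (-\<nu>)) * indicator {0<..} x \<partial>lborel) \<le> ennreal (?C * d powr (\<mu> - \<nu> + 1))" .
qed

section \<open>Integral means of analytic functions\<close>

text \<open>Cutting off outside the disc makes compositions with an analytic function Borel measurable.\<close>

definition disc_ext :: "(complex \<Rightarrow> complex) \<Rightarrow> complex \<Rightarrow> complex" where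
  "disc_ext F z = (if z \<in> ball 0 1 then F z else 0)"

lemma disc_ext_measurable:
  assumes "F holomorphic_on ball 0 1"
  shows "disc_ext F \<in> borel_measurable borel"
proof -
  have "(\<lambda>z. indicator (ball 0 1) z *\<^sub>R F z) \<in> borel_measurable borel"
    by (intro borel_measurable_continuous_on_indicator holomorphic_on_imp_continuous_on assms) auto
  also have "(\<lambda>z. indicator (ball 0 1) z *\<^sub>R F z) = disc_ext F"
    by (auto simp: disc_ext_def fun_eq_iff)
  finally show ?thesis .
qed

lemma disc_ext_eq [simp]: "norm z < 1 \<Longrightarrow> disc_ext F z = F z"
  by (simp add: disc_ext_def)

lemma holomorphic_deriv_disc: "F holomorphic_on ball 0 1 \<Longrightarrow> deriv F holomorphic_on ball 0 1"
  by (rule holomorphic_deriv) auto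

text \<open>The p-th power of the integral mean. Without the root and with values in
  \<open>ennreal\<close> it fits Tonelli and Minkowski directly, and divergence is visible as
  infinity instead of being read as \<open>0\<close>.\<close>

definition pmean :: "real \<Rightarrow> (complex \<Rightarrow> complex) \<Rightarrow> real \<Rightarrow> ennreal" where
  "pmean p F r = (\<integral>\<^sup>+\<theta>. ennreal (norm (F (of_real r * cis \<theta>)) powr p) \<partial>circ)"

lemma cis_add_2pi [simp]: "cis (x + 2 * pi) = cis x"
  by (simp add: cis_mult[symmetric])

lemma circle_comp_measurable:
  assumes F: "F holomorphic_on ball 0 1" and w: "norm w < 1"
  shows "(\<lambda>\<theta>. F (cis \<theta> * w)) \<in> borel_measurable borel"
proof -
  note disc_ext_measurable[OF F, measurable]
  have "(\<lambda>\<theta>. disc_ext F (cis \<theta> * w)) \<in> borel_measurable borel" by measurable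
  then show ?thesis using w by (simp add: norm_mult)
qed

lemma circle_measurable:
  assumes F: "F holomorphic_on ball 0 1" and r: "\<bar>r\<bar> < 1"
  shows "(\<lambda>\<theta>. F (of_real r * cis \<theta>)) \<in> borel_measurable borel"
  using circle_comp_measurable[OF F, of "of_real r"] r by (simp add: mult.commute)

lemma pmean_rotate:
  assumes F: "F holomorphic_on ball 0 1" and w: "norm w < 1"
  shows "(\<integral>\<^sup>+\<theta>. ennreal (norm (F (cis \<theta> * w)) powr p) \<partial>circ) = pmean p F (norm w)"
proof -
  note circle_measurable[OF F, of "norm w", measurable]
  have "cis \<theta> * w = of_real (norm w) * cis (\<theta> + Arg w)" for \<theta>
    by (metis cis_mult mult.assoc mult.commute rcis_cmod_Arg rcis_def)
  then have "(\<integral>\<^sup>+\<theta>. ennreal (norm (F (cis \<theta> * w)) powr p) \<partial>circ)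
     = (\<integral>\<^sup>+\<theta>. ennreal (norm (F (of_real (norm w) * cis (\<theta> + Arg w))) powr p) \<partial>circ)" by simp
  also have "\<dots> = pmean p F (norm w)" unfolding pmean_def
    using w by (intro nn_integral_circ_rotate[of "\<lambda>\<theta>. ennreal (norm (F (of_real (norm w) * cis \<theta>)) powr p)"]) auto
  finally show ?thesis .
qed

lemma pmean_disc_measurable:
  assumes F: "F holomorphic_on ball 0 1"
  shows "pmean p (disc_ext F) \<in> borel_measurable borel"
proof -
  note disc_ext_measurable[OF F, measurable]
  show ?thesis unfolding pmean_def[abs_def] by measurable
qed

lemma pmean_disc_ext: "\<bar>r\<bar> < 1 \<Longrightarrow> pmean p (disc_ext F) r = pmean p F r"
  by (simp add: pmean_def norm_mult)

text \<open>Cauchy's formula for \<open>F w (R\<^sup>2 - \<bar>z\<bar>\<^sup>2) / (R\<^sup>2 - cnj z w)\<close>, whose value at \<open>z\<close> is \<open>F z\<close>.\<close>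

lemma Poisson_formula:
  assumes contf: "continuous_on (cball 0 R) F" and holf: "F holomorphic_on ball 0 R" and z: "norm z < R"
  shows "(LINT t|circ. F (of_real R * cis t) * of_real ((R\<^sup>2 - (norm z)\<^sup>2) / (norm (of_real R * cis t - z))\<^sup>2)) = F z"
proof -
  have R: "R > 0" using z by (meson le_less_trans norm_ge_zero)
  define h where "h w = F w * of_real (R\<^sup>2 - (norm z)\<^sup>2) / (of_real (R\<^sup>2) - cnj z * w)" for w
  have nz: "of_real (R\<^sup>2) - cnj z * w \<noteq> 0" if "norm w \<le> R" for w
  proof
    assume "of_real (R\<^sup>2) - cnj z * w = 0"
    then have "norm (cnj z * w) = norm (of_real (R\<^sup>2) :: complex)" by simp
    then have "norm z * norm w = R\<^sup>2" by (simp add: norm_mult norm_power)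
    moreover have "norm z * norm w \<le> norm z * R" using that by (intro mult_left_mono) auto
    moreover have "norm z * R < R * R" using z R by simp
    ultimately show False by (simp add: power2_eq_square)
  qed
  have "(LINT t|circ. h (0 + of_real R * cis t) * (of_real R * cis t) / (0 + of_real R * cis t - z) ^ Suc 0) = (deriv ^^ 0) h z / fact 0"
    unfolding h_def
    by (intro circ_Cauchy_formula continuous_intros holomorphic_intros contf holf) (use nz z in auto)
  also have "(deriv ^^ 0) h z / fact 0 = F z"
  proof -
    have "of_real (R\<^sup>2) - cnj z * z = of_real (R\<^sup>2 - (norm z)\<^sup>2)"
      by (simp only: of_real_diff complex_norm_square) (simp add: mult.commute)
    then show ?thesis using nz[of z] z by (simp add: h_def)
  qed
  finally have I: "(LINT t|circ. h (0 + of_real R * cis t) * (of_real R * cis t) / (0 + of_real R * cis t - z) ^ Suc 0) = F z" .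
  have eq: "h (0 + of_real R * cis t) * (of_real R * cis t) / (0 + of_real R * cis t - z) ^ Suc 0
      = F (of_real R * cis t) * of_real ((R\<^sup>2 - (norm z)\<^sup>2) / (norm (of_real R * cis t - z))\<^sup>2)" for t
  proof -
    define w where "w = of_real R * cis t"
    have w: "norm w = R" using R by (simp add: w_def norm_mult)
    have w0: "w \<noteq> 0" using w R by auto
    have wz: "w - z \<noteq> 0" using w z by auto
    have "of_real (R\<^sup>2) = w * cnj w" using complex_norm_square[of w] w by simp
    \<comment> \<open>On the circle \<open>w * cnj w\<close> is the squared radius, so the auxiliary
      denominator factors; together with \<open>w - z\<close> from Cauchy's formula it completes to
      the squared distance of the Poisson kernel.\<close>
    then have e1: "of_real (R\<^sup>2) - cnj z * w = w * cnj (w - z)" by (simp add: algebra_simps)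
    have e2: "of_real ((norm (w - z))\<^sup>2) = (w - z) * cnj (w - z)" by (simp only: complex_norm_square)
    have "h w * w / (w - z) = F w * of_real (R\<^sup>2 - (norm z)\<^sup>2) / ((w - z) * cnj (w - z))"
    proof -
      have "A / (w * c) * w / d = A / (d * c)" for A c d using w0 by simp
      then show ?thesis unfolding h_def e1 .
    qed
    also have "\<dots> = F w * of_real ((R\<^sup>2 - (norm z)\<^sup>2) / (norm (w - z))\<^sup>2)"
      unfolding of_real_divide e2 by simp
    finally show ?thesis by (simp add: w_def)
  qed
  show ?thesis using I unfolding eq .
qed

text \<open>The representation formula for the constant \<open>1\<close>. The kernel is bounded,
  hence integrable, which allows the passage from the Bochner to the nonnegative integral.\<close>

lemma Poisson_kernel_integral:
  assumes r: "norm z < R"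
  shows "(\<integral>\<^sup>+t. ennreal ((R\<^sup>2 - (norm z)\<^sup>2) / (norm (of_real R * cis t - z))\<^sup>2) \<partial>circ) = 1"
proof -
  have R: "R > 0" using r by (meson le_less_trans norm_ge_zero)
  define K where "K t = (R\<^sup>2 - (norm z)\<^sup>2) / (norm (of_real R * cis t - z))\<^sup>2" for t
  have nz: "of_real R * cis t - z \<noteq> 0" for t
    using r R by (metis abs_of_pos eq_iff_diff_eq_0 less_irrefl mult.right_neutral norm_cis norm_mult norm_of_real)
  have Kc: "continuous_on UNIV K" unfolding K_def
    by (intro continuous_intros) (use nz in auto)
  then have [measurable]: "K \<in> borel_measurable borel" by (rule borel_measurable_continuous_onI)
  have K0: "K t \<ge> 0" for t
    unfolding K_def using r R by (intro divide_nonneg_nonneg) (auto intro!: power_mono)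
  have "K t \<le> (R\<^sup>2 - (norm z)\<^sup>2) / (R - norm z)\<^sup>2" for t
  proof -
    have "R - norm z \<le> norm (of_real R * cis t - z)"
      using norm_triangle_ineq2[of "of_real R * cis t" z] R by (simp add: norm_mult)
    then have "(R - norm z)\<^sup>2 \<le> (norm (of_real R * cis t - z))\<^sup>2" using r by (intro power_mono) auto
    then show ?thesis unfolding K_def using r R by (intro divide_left_mono mult_pos_pos zero_less_power) (auto intro!: power_mono simp: nz)
  qed
  then have int: "integrable circ K"
    by (intro circ.integrable_const_bound[where B="(R\<^sup>2 - (norm z)\<^sup>2) / (R - norm z)\<^sup>2"]) (auto simp: K0)
  have "of_real (LINT t|circ. K t) = (1::complex)"
    using Poisson_formula[of R "\<lambda>_. 1" z] r unfolding K_def[symmetric] by simp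
  then have "(LINT t|circ. K t) = 1" by (metis of_real_eq_1_iff)
  then show ?thesis using nn_integral_eq_integral[OF int] K0 unfolding K_def[symmetric] by simp
qed

text \<open>Subharmonicity of the p-th power of the modulus: weighted Hoelder in the representation
  formula, with the Poisson kernel as weight, whose mass is \<open>1\<close>.\<close>

lemma norm_powr_le_Poisson:
  assumes p: "p > 1" and F: "F holomorphic_on ball 0 1" and zR: "norm z < R" "R < 1"
  shows "ennreal (norm (F z) powr p) \<le> (\<integral>\<^sup>+t. ennreal (norm (F (of_real R * cis t)) powr p * ((R\<^sup>2 - (norm z)\<^sup>2) / (norm (of_real R * cis t - z))\<^sup>2)) \<partial>circ)"
proof -
  have R: "R > 0" using zR by (meson le_less_trans norm_ge_zero)
  define K where "K t = (R\<^sup>2 - (norm z)\<^sup>2) / (norm (of_real R * cis t - z))\<^sup>2" for t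
  have nz: "of_real R * cis t - z \<noteq> 0" for t
    using zR R by (metis abs_of_pos eq_iff_diff_eq_0 less_irrefl mult.right_neutral norm_cis norm_mult norm_of_real)
  have K0: "K t > 0" for t
    unfolding K_def using zR R nz[of t] by (intro divide_pos_pos) (auto intro!: power_strict_mono)
  have [measurable]: "K \<in> borel_measurable borel" unfolding K_def by measurable
  note circle_measurable[OF F, of R, measurable]
  have cont: "continuous_on (cball 0 R) F" "F holomorphic_on ball 0 R"
    using F zR by (auto intro!: holomorphic_on_imp_continuous_on elim: holomorphic_on_subset)
  have eq: "norm (F (of_real R * cis t) * of_real (K t)) powr p * K t powr (1-p) = norm (F (of_real R * cis t)) powr p * K t" for t
    using K0[of t] by (simp add: norm_mult powr_mult powr_diff)
  have "ennreal (norm (LINT t|circ. F (of_real R * cis t) * of_real (K t)) powr p)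
     \<le> ennreal (1 powr (p-1)) * (\<integral>\<^sup>+t. ennreal (norm (F (of_real R * cis t) * of_real (K t)) powr p * K t powr (1-p)) \<partial>circ)"
    using Poisson_kernel_integral[OF zR(1)] zR R
    by (intro norm_integral_powr_le[OF p]) (auto simp: K_def[symmetric] less_imp_le[OF K0] )
  also have "(LINT t|circ. F (of_real R * cis t) * of_real (K t)) = F z"
    unfolding K_def by (rule Poisson_formula[OF cont zR(1)])
  finally show ?thesis using eq by (simp add: K_def)
qed

text \<open>The Poisson estimate is averaged over the angle. After the rotation the kernel depends
  on the angular difference only, so Tonelli separates the mean at \<open>R\<close> from a kernel of
  mass \<open>1\<close>.\<close>

lemma pmean_mono:
  assumes p: "p > 1" and F: "F holomorphic_on ball 0 1" and r: "0 \<le> r" "r < R" "R < 1"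
  shows "pmean p F r \<le> pmean p F R"
proof -
  interpret pair_sigma_finite circ circ ..
  define K where "K t = (R\<^sup>2 - r\<^sup>2) / (norm (of_real R * cis t - of_real r))\<^sup>2" for t
  have [measurable]: "K \<in> borel_measurable borel" unfolding K_def by measurable
  note circle_measurable[OF F, of R, measurable] disc_ext_measurable[OF F, measurable]
  have K0: "K t \<ge> 0" for t
    unfolding K_def using r by (intro divide_nonneg_nonneg) (auto intro!: power_mono)
  have rot: "norm (of_real R * cis (t + \<theta>) - of_real r * cis \<theta>) = norm (of_real R * cis t - of_real r)" for t \<theta>
  proof -
    have "of_real R * cis (t + \<theta>) - of_real r * cis \<theta> = cis \<theta> * (of_real R * cis t - of_real r)"
      by (simp add: cis_mult[symmetric] algebra_simps)
    then show ?thesis by (simp add: norm_mult)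
  qed
  have "pmean p F r \<le> (\<integral>\<^sup>+\<theta>. \<integral>\<^sup>+t. ennreal (norm (disc_ext F (of_real R * cis (t + \<theta>))) powr p * K t) \<partial>circ \<partial>circ)"
    unfolding pmean_def
  proof (rule nn_integral_mono)
    fix \<theta>
    have "ennreal (norm (F (of_real r * cis \<theta>)) powr p) \<le> (\<integral>\<^sup>+t. ennreal (norm (F (of_real R * cis t)) powr p * ((R\<^sup>2 - r\<^sup>2) / (norm (of_real R * cis t - of_real r * cis \<theta>))\<^sup>2)) \<partial>circ)"
      using norm_powr_le_Poisson[OF p F, of "of_real r * cis \<theta>" R] r by (simp add: norm_mult)
    also have "\<dots> = (\<integral>\<^sup>+t. ennreal (norm (F (of_real R * cis (t + \<theta>))) powr p * ((R\<^sup>2 - r\<^sup>2) / (norm (of_real R * cis (t + \<theta>) - of_real r * cis \<theta>))\<^sup>2)) \<partial>circ)"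
      using r by (intro nn_integral_circ_rotate[of "\<lambda>t. ennreal (norm (F (of_real R * cis t)) powr p * ((R\<^sup>2 - r\<^sup>2) / (norm (of_real R * cis t - of_real r * cis \<theta>))\<^sup>2))", symmetric]) auto
    finally show "ennreal (norm (F (of_real r * cis \<theta>)) powr p) \<le> (\<integral>\<^sup>+t. ennreal (norm (disc_ext F (of_real R * cis (t + \<theta>))) powr p * K t) \<partial>circ)"
      using r unfolding rot K_def by (simp add: norm_mult)
  qed
  also have "\<dots> = (\<integral>\<^sup>+t. \<integral>\<^sup>+\<theta>. ennreal (norm (disc_ext F (of_real R * cis (t + \<theta>))) powr p * K t) \<partial>circ \<partial>circ)"
    by (rule Fubini'[symmetric]) measurable
  also have "\<dots> = (\<integral>\<^sup>+t. pmean p F R * ennreal (K t) \<partial>circ)"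
  proof (rule nn_integral_cong)
    fix t
    have "(\<integral>\<^sup>+\<theta>. ennreal (norm (disc_ext F (of_real R * cis (t + \<theta>))) powr p * K t) \<partial>circ)
       = (\<integral>\<^sup>+\<theta>. ennreal (norm (F (of_real R * cis (\<theta> + t))) powr p) \<partial>circ) * ennreal (K t)"
      using r K0 by (subst nn_integral_multc[symmetric]) (auto simp: ennreal_mult' norm_mult add.commute circle_measurable[OF F])
    also have "(\<integral>\<^sup>+\<theta>. ennreal (norm (F (of_real R * cis (\<theta> + t))) powr p) \<partial>circ) = pmean p F R"
      unfolding pmean_def using r by (intro nn_integral_circ_rotate[of "\<lambda>\<theta>. ennreal (norm (F (of_real R * cis \<theta>)) powr p)"]) auto
    finally show "(\<integral>\<^sup>+\<theta>. ennreal (norm (disc_ext F (of_real R * cis (t + \<theta>))) powr p * K t) \<partial>circ) = pmean p F R * ennreal (K t)" .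
  qed
  also have "\<dots> = pmean p F R * (\<integral>\<^sup>+t. ennreal (K t) \<partial>circ)"
    by (rule nn_integral_cmult) auto
  also have "(\<integral>\<^sup>+t. ennreal (K t) \<partial>circ) = 1"
    using Poisson_kernel_integral[of "of_real r" R] r by (simp add: K_def)
  finally show ?thesis by simp
qed

text \<open>Cauchy's formula on circles whose radius \<open>\<rho>\<close> is half the distance to
  the boundary, followed by Minkowski. On these circles the mean is at most that at distance
  \<open>\<rho>\<close>, and dividing by \<open>\<rho>\<close> costs one more power; the halving
  produces \<open>2 powr (\<gamma> + 1)\<close>.\<close>

lemma pmean_deriv_bound:
  assumes p: "p > 1" and F: "F holomorphic_on ball 0 1" and C: "C > 0" "\<gamma> \<ge> 0"
    and bd: "\<And>s. 0 \<le> s \<Longrightarrow> s < 1 \<Longrightarrow> pmean p F s \<le> ennreal ((C * (1 - s) powr (-\<gamma>)) powr p)"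
    and r: "0 \<le> r" "r < 1"
  shows "pmean p (deriv F) r \<le> ennreal ((C * 2 powr (\<gamma> + 1) * (1 - r) powr (-\<gamma>-1)) powr p)"
proof -
  define \<rho> where "\<rho> = (1 - r) / 2"
  have \<rho>: "\<rho> > 0" "r + \<rho> < 1" "1 - (r + \<rho>) = \<rho>" using r by (auto simp: \<rho>_def field_simps)
  define G where "G \<theta> t = disc_ext F (cis \<theta> * (of_real r + of_real \<rho> * cis t)) / (of_real \<rho> * cis (t + \<theta>))" for \<theta> t
  define N where "N = C * \<rho> powr (-\<gamma>) / \<rho>"
  note disc_ext_measurable[OF F, measurable]
  have N: "N > 0" using C \<rho> by (simp add: N_def)
  have nb: "norm (of_real r + of_real \<rho> * cis t) \<le> r + \<rho>" for t
    using norm_triangle_ineq[of "of_real r" "of_real \<rho> * cis t"] r \<rho> by (simp add: norm_mult)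
  have repr: "deriv F (of_real r * cis \<theta>) = (LINT t|circ. G \<theta> t)" for \<theta>
  proof -
    define c where "c = of_real r * cis \<theta>"
    have nc: "norm c = r" using r by (simp add: c_def norm_mult)
    have sub: "cball c \<rho> \<subseteq> ball 0 1"
    proof
      fix x assume "x \<in> cball c \<rho>"
      then have "norm x \<le> norm c + \<rho>" by (metis add.commute diff_le_eq dist_norm mem_cball norm_minus_commute norm_triangle_ineq2 order_trans)
      then show "x \<in> ball 0 1" using \<rho> nc by simp
    qed
    have holc: "continuous_on (cball c \<rho>) F" "F holomorphic_on ball c \<rho>"
      using F sub ball_subset_cball by (auto intro!: holomorphic_on_imp_continuous_on elim!: holomorphic_on_subset)
    have "deriv F c = (LINT t|circ. F (c + of_real \<rho> * cis t) * (of_real \<rho> * cis t) / (c + of_real \<rho> * cis t - c) ^ Suc 1)"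
      using circ_Cauchy_formula[OF holc, of c 1] \<rho> by simp
    also have "\<dots> = (LINT t|circ. disc_ext F (c + of_real \<rho> * cis t) / (of_real \<rho> * cis t))"
    proof (intro Bochner_Integration.integral_cong refl)
      fix t
      have "c + of_real \<rho> * cis t \<in> cball c \<rho>" using \<rho> by (simp add: dist_norm norm_mult)
      then have "c + of_real \<rho> * cis t \<in> ball 0 1" using sub by blast
      then show "F (c + of_real \<rho> * cis t) * (of_real \<rho> * cis t) / (c + of_real \<rho> * cis t - c) ^ Suc 1 = disc_ext F (c + of_real \<rho> * cis t) / (of_real \<rho> * cis t)"
        using \<rho> by (simp add: field_simps power2_eq_square)
    qed
    \<comment> \<open>The parameter is rotated along with the centre, so that for fixed
      \<open>t\<close> the evaluation points \<open>cis \<theta> * w\<close> run through a circle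
      about the origin, where \<open>pmean_rotate\<close> applies.\<close>
    also have "\<dots> = (LINT t|circ. disc_ext F (c + of_real \<rho> * cis (t + \<theta>)) / (of_real \<rho> * cis (t + \<theta>)))"
      by (rule integral_circ_rotate[symmetric, of "\<lambda>t. disc_ext F (c + of_real \<rho> * cis t) / (of_real \<rho> * cis t)"]) auto
    also have "\<dots> = (LINT t|circ. G \<theta> t)"
      by (intro Bochner_Integration.integral_cong refl) (simp add: G_def c_def cis_mult[symmetric] algebra_simps)
    finally show ?thesis by (simp add: c_def)
  qed
  have "(\<integral>\<^sup>+\<theta>. ennreal (norm (LINT t|circ. G \<theta> t) powr p) \<partial>circ) \<le> ennreal (N powr p)"
  proof (rule Minkowski_integral_bound[where N="\<lambda>_. N"])
    show "(\<lambda>(x, y). G x y) \<in> borel_measurable (circ \<Otimes>\<^sub>M circ)" unfolding G_def by measurable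
    show "(\<integral>\<^sup>+\<theta>. ennreal (norm (G \<theta> t) powr p) \<partial>circ) \<le> ennreal (N powr p)" for t
    proof -
      define w where "w = of_real r + of_real \<rho> * cis t"
      have w: "norm w \<le> r + \<rho>" "norm w < 1" using nb[of t] \<rho> by (auto simp: w_def)
      have "norm (G \<theta> t) powr p = (1/\<rho>) powr p * norm (F (cis \<theta> * w)) powr p" for \<theta>
        using w \<rho> by (simp add: G_def w_def[symmetric] norm_mult norm_divide powr_divide)
      then have "(\<integral>\<^sup>+\<theta>. ennreal (norm (G \<theta> t) powr p) \<partial>circ) = ennreal ((1/\<rho>) powr p) * (\<integral>\<^sup>+\<theta>. ennreal (norm (F (cis \<theta> * w)) powr p) \<partial>circ)"
        using w circle_comp_measurable[OF F, of w] by (simp add: ennreal_mult' nn_integral_cmult)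
      also have "\<dots> = ennreal ((1/\<rho>) powr p) * pmean p F (norm w)"
        by (simp add: pmean_rotate[OF F w(2)])
      also have "\<dots> \<le> ennreal ((1/\<rho>) powr p) * ennreal ((C * (1 - norm w) powr (-\<gamma>)) powr p)"
        using w by (intro mult_left_mono bd) auto
      also have "\<dots> \<le> ennreal ((1/\<rho>) powr p) * ennreal ((C * \<rho> powr (-\<gamma>)) powr p)"
        using w \<rho> C p by (intro mult_left_mono ennreal_leI powr_mono2 mult_nonneg_nonneg powr_mono2') auto
      also have "\<dots> = ennreal (N powr p)" using \<rho> C by (simp add: N_def ennreal_mult'[symmetric] powr_mult powr_divide)
      finally show ?thesis .
    qed
  qed (use N p in \<open>auto intro: circ.sigma_finite_measure_axioms\<close>)
  also have "N = C * 2 powr (\<gamma> + 1) * (1 - r) powr (-\<gamma>-1)"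
  proof -
    have "\<rho> powr (-\<gamma>-1) = 2 powr (\<gamma> + 1) * (1 - r) powr (-\<gamma>-1)"
      using r by (simp add: \<rho>_def powr_divide powr_minus_divide powr_diff powr_add field_simps)
    moreover have "N = C * \<rho> powr (-\<gamma>-1)" using \<rho> by (simp add: N_def powr_diff)
    ultimately show ?thesis by simp
  qed
  finally show ?thesis by (simp add: pmean_def repr)
qed

lemma radial_FTC:
  assumes G: "G holomorphic_on ball 0 1" and r: "0 \<le> r1" "r1 \<le> r2" "r2 < 1"
  shows "(LINT s|lborel. indicator {r1..r2} s *\<^sub>R (disc_ext (deriv G) (of_real s * cis \<theta>) * cis \<theta>)) = G (of_real r2 * cis \<theta>) - G (of_real r1 * cis \<theta>)"
proof -
  note hol = holomorphic_deriv_disc[OF G]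
    have "(LINT s|lborel. indicator {r1..r2} s *\<^sub>R (deriv G (of_real s * cis \<theta>) * cis \<theta>)) = G (of_real r2 * cis \<theta>) - G (of_real r1 * cis \<theta>)"
    proof (rule integral_FTC_Icc)
      show "((\<lambda>s. G (of_real s * cis \<theta>)) has_vector_derivative deriv G (of_real x * cis \<theta>) * cis \<theta>) (at x within {r1..r2})"
        if "r1 \<le> x" "x \<le> r2" for x
      proof -
        have "(G has_field_derivative deriv G (of_real x * cis \<theta>)) (at (of_real x * cis \<theta>))"
          using G that r by (intro holomorphic_derivI[of _ "ball 0 1"]) (auto simp: norm_mult)
        moreover have "((\<lambda>s. of_real s * cis \<theta>) has_vector_derivative cis \<theta>) (at x within {r1..r2})"
          by (auto intro!: derivative_eq_intros)
        ultimately show ?thesis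
          using field_vector_diff_chain_within[of "\<lambda>s. of_real s * cis \<theta>" "cis \<theta>" x "{r1..r2}" G "deriv G (of_real x * cis \<theta>)"]
          by (simp add: o_def has_field_derivative_at_within mult.commute[of "deriv G _"])
      qed
      show "continuous_on {r1..r2} (\<lambda>s. deriv G (of_real s * cis \<theta>) * cis \<theta>)"
        using r by (intro continuous_intros continuous_on_compose2[OF holomorphic_on_imp_continuous_on[OF hol]]) (auto simp: norm_mult)
    qed (use r in auto)
    also have "(LINT s|lborel. indicator {r1..r2} s *\<^sub>R (deriv G (of_real s * cis \<theta>) * cis \<theta>))
      = (LINT s|lborel. indicator {r1..r2} s *\<^sub>R (disc_ext (deriv G) (of_real s * cis \<theta>) * cis \<theta>))"
      using r by (intro Bochner_Integration.integral_cong refl) (auto simp: indicator_def norm_mult)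
    finally show ?thesis .
qed

text \<open>Minkowski for the integral of the derivative along the radial segment.\<close>

lemma pmean_radial_diff:
  assumes p: "p > 1" and G: "G holomorphic_on ball 0 1" and r: "0 \<le> r1" "r1 \<le> r2" "r2 < 1"
    and [measurable]: "N \<in> borel_measurable borel" and N: "\<And>s. s \<in> {r1..r2} \<Longrightarrow> N s > 0"
    and bd: "\<And>s. s \<in> {r1..r2} \<Longrightarrow> pmean p (deriv G) s \<le> ennreal (N s powr p)"
    and A: "A > 0" "(\<integral>\<^sup>+s. ennreal (N s) * indicator {r1..r2} s \<partial>lborel) \<le> ennreal A"
  shows "(\<integral>\<^sup>+\<theta>. ennreal (norm (G (of_real r2 * cis \<theta>) - G (of_real r1 * cis \<theta>)) powr p) \<partial>circ) \<le> ennreal (A powr p)"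
proof -
  note hol = holomorphic_deriv_disc[OF G]
  note disc_ext_measurable[OF hol, measurable]
  define H where "H \<theta> s = indicator {r1..r2} s *\<^sub>R (disc_ext (deriv G) (of_real s * cis \<theta>) * cis \<theta>)" for \<theta> s
  have repr: "G (of_real r2 * cis \<theta>) - G (of_real r1 * cis \<theta>) = (LINT s|lborel. H \<theta> s)" for \<theta>
    using radial_FTC[OF G r] by (simp add: H_def)
  have "(\<integral>\<^sup>+\<theta>. ennreal (norm (LINT s|lborel. H \<theta> s) powr p) \<partial>circ) \<le> ennreal (A powr p)"
  proof (rule Minkowski_integral_bound[where N="\<lambda>s. N s * indicator {r1..r2} s"])
    show "(\<lambda>(x, y). H x y) \<in> borel_measurable (circ \<Otimes>\<^sub>M lborel)" unfolding H_def by measurable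
    show "N s * indicator {r1..r2} s \<ge> 0" for s using N[of s] by (auto simp: indicator_def)
    show "H \<theta> s = 0" if "N s * indicator {r1..r2} s = 0" for \<theta> s
      using N[of s] that by (auto simp: H_def indicator_def split: if_splits)
    show "(\<integral>\<^sup>+s. ennreal (N s * indicator {r1..r2} s) \<partial>lborel) \<le> ennreal A"
      using A(2) by (simp add: ennreal_mult'' ennreal_indicator)
    show "(\<integral>\<^sup>+\<theta>. ennreal (norm (H \<theta> s) powr p) \<partial>circ) \<le> ennreal ((N s * indicator {r1..r2} s) powr p)" for s
    proof (cases "s \<in> {r1..r2}")
      case True
      then have "(\<integral>\<^sup>+\<theta>. ennreal (norm (H \<theta> s) powr p) \<partial>circ) = pmean p (deriv G) s"
        using r by (simp add: H_def pmean_def norm_mult)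
      then show ?thesis using bd[OF True] True by simp
    qed (simp add: H_def)
  qed (use p A in \<open>auto intro: circ.sigma_finite_measure_axioms lborel.sigma_finite_measure_axioms\<close>)
  then show ?thesis by (simp add: repr)
qed

text \<open>Minkowski for the integral of the derivative along an arc; rotation invariance makes the
  norm of the integrand independent of the position on the arc.\<close>

lemma pmean_arc_diff:
  assumes p: "p > 1" and G: "G holomorphic_on ball 0 1" and r: "0 \<le> r" "r < 1" and h: "h > 0"
    and N: "N > 0" and bd: "pmean p (deriv G) r \<le> ennreal (N powr p)"
  shows "(\<integral>\<^sup>+\<theta>. ennreal (norm (G (of_real r * cis (\<theta> + h)) - G (of_real r * cis \<theta>)) powr p) \<partial>circ) \<le> ennreal ((h * N) powr p)"
proof -
  note hol = holomorphic_deriv_disc[OF G]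
  note disc_ext_measurable[OF hol, measurable]
  define H where "H \<theta> s = indicator {0..h} s *\<^sub>R (disc_ext (deriv G) (of_real r * cis (\<theta> + s)) * (of_real r * \<i> * cis (\<theta> + s)))" for \<theta> s
  have repr: "G (of_real r * cis (\<theta> + h)) - G (of_real r * cis \<theta>) = (LINT s|lborel. H \<theta> s)" for \<theta>
  proof -
    have "(LINT s|lborel. indicator {0..h} s *\<^sub>R (deriv G (of_real r * cis (\<theta> + s)) * (of_real r * \<i> * cis (\<theta> + s)))) 
        = G (of_real r * cis (\<theta> + h)) - G (of_real r * cis (\<theta> + 0))"
    proof (rule integral_FTC_Icc)
      show "((\<lambda>s. G (of_real r * cis (\<theta> + s))) has_vector_derivative deriv G (of_real r * cis (\<theta> + x)) * (of_real r * \<i> * cis (\<theta> + x))) (at x within {0..h})"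
        if "0 \<le> x" "x \<le> h" for x
      proof -
        have "(G has_field_derivative deriv G (of_real r * cis (\<theta> + x))) (at (of_real r * cis (\<theta> + x)))"
          using G r by (intro holomorphic_derivI[of _ "ball 0 1"]) (auto simp: norm_mult)
        moreover have "((\<lambda>s. of_real r * cis (\<theta> + s)) has_vector_derivative (of_real r * \<i> * cis (\<theta> + x))) (at x within {0..h})"
        proof -
          show ?thesis unfolding has_vector_derivative_def
            by (auto intro!: derivative_eq_intros simp: scaleR_conv_of_real)
        qed
        ultimately show ?thesis
          using field_vector_diff_chain_within[of "\<lambda>s. of_real r * cis (\<theta> + s)" "of_real r * \<i> * cis (\<theta> + x)" x "{0..h}" G "deriv G (of_real r * cis (\<theta> + x))"]
          by (simp add: o_def has_field_derivative_at_within mult.commute[of "deriv G _"])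
      qed
      show "continuous_on {0..h} (\<lambda>s. deriv G (of_real r * cis (\<theta> + s)) * (of_real r * \<i> * cis (\<theta> + s)))"
        using r by (intro continuous_intros continuous_on_compose2[OF holomorphic_on_imp_continuous_on[OF hol]]) (auto simp: norm_mult)
    qed (use h in auto)
    then show ?thesis using r by (simp add: H_def norm_mult)
  qed
  have "(\<integral>\<^sup>+\<theta>. ennreal (norm (LINT s|lborel. H \<theta> s) powr p) \<partial>circ) \<le> ennreal ((h * N) powr p)"
  proof (rule Minkowski_integral_bound[where N="\<lambda>s. N * indicator {0..h} s"])
    show "(\<lambda>(x, y). H x y) \<in> borel_measurable (circ \<Otimes>\<^sub>M lborel)" unfolding H_def by measurable
    show "H \<theta> s = 0" if "N * indicator {0..h} s = 0" for \<theta> s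
      using N that by (auto simp: H_def indicator_def split: if_splits)
    show "(\<integral>\<^sup>+s. ennreal (N * indicator {0..h} s) \<partial>lborel) \<le> ennreal (h * N)"
      using h N by (simp add: ennreal_mult' ennreal_indicator nn_integral_cmult mult.commute)
    show "(\<integral>\<^sup>+\<theta>. ennreal (norm (H \<theta> s) powr p) \<partial>circ) \<le> ennreal ((N * indicator {0..h} s) powr p)" for s
    proof (cases "s \<in> {0..h}")
      case True
      then have "(\<integral>\<^sup>+\<theta>. ennreal (norm (H \<theta> s) powr p) \<partial>circ) \<le> (\<integral>\<^sup>+\<theta>. ennreal (norm (deriv G (of_real r * cis (\<theta> + s))) powr p) \<partial>circ)"
      proof (intro nn_integral_mono ennreal_leI powr_mono2)
        fix \<theta>
        show "norm (H \<theta> s) \<le> norm (deriv G (of_real r * cis (\<theta> + s)))"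
          using True r mult_left_mono[of r 1 "norm (deriv G (of_real r * cis (\<theta> + s)))"] by (simp add: H_def norm_mult)
      qed (use p in auto)
      also have "\<dots> = pmean p (deriv G) r" unfolding pmean_def
        using circle_measurable[OF hol, of r] r
        by (intro nn_integral_circ_rotate[of "\<lambda>\<theta>. ennreal (norm (deriv G (of_real r * cis \<theta>)) powr p)"]) auto
      finally show ?thesis using bd True by (simp add: order_trans)
    qed (simp add: H_def)
  qed (use p N h in \<open>auto intro: circ.sigma_finite_measure_axioms lborel.sigma_finite_measure_axioms\<close>)
  then show ?thesis by (simp add: repr)
qed

section \<open>Elementary inequalities, power integrals and periodic null sets\<close>

lemma powr_add_le:
  fixes a b p :: real
  assumes "a \<ge> 0" "b \<ge> 0" "p \<ge> 0"
  shows "(a + b) powr p \<le> 2 powr p * (a powr p + b powr p)"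
proof -
  have "(a + b) powr p \<le> (2 * max a b) powr p" using assms by (intro powr_mono2) auto
  also have "\<dots> = 2 powr p * max a b powr p" using assms by (simp add: powr_mult)
  also have "\<dots> \<le> 2 powr p * (a powr p + b powr p)" by (intro mult_left_mono) (auto simp: max_def)
  finally show ?thesis .
qed

lemma powr_add3_le:
  fixes a b c p :: real
  assumes "a \<ge> 0" "b \<ge> 0" "c \<ge> 0" "p \<ge> 0"
  shows "(a + b + c) powr p \<le> 3 powr p * (a powr p + b powr p + c powr p)"
proof -
  have "(a + b + c) powr p \<le> (3 * max a (max b c)) powr p" using assms by (intro powr_mono2) auto
  also have "\<dots> = 3 powr p * max a (max b c) powr p" using assms by (simp add: powr_mult)
  also have "\<dots> \<le> 3 powr p * (a powr p + b powr p + c powr p)" by (intro mult_left_mono) (auto simp: max_def)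
  finally show ?thesis .
qed

lemma nn_integral_reflect:
  fixes f :: "real \<Rightarrow> ennreal"
  assumes "f \<in> borel_measurable borel"
  shows "(\<integral>\<^sup>+x. f (c - x) \<partial>lborel) = (\<integral>\<^sup>+x. f x \<partial>lborel)"
  using nn_integral_real_affine[of f "-1" c] assms by simp

lemma nn_integral_powr_0:
  assumes "a > -1" "d \<ge> 0"
  shows "(\<integral>\<^sup>+x. ennreal (x powr a) * indicator {0..d} x \<partial>lborel) = ennreal (d powr (a+1) / (a+1))"
  using nn_integral_has_integral_lebesgue[OF _ has_integral_powr_from_0[of a d]] assms
  by (simp add: ennreal_mult' ennreal_indicator mult.commute)

lemma nn_integral_one_minus_powr:
  assumes "a > -1" "r \<le> 1"
  shows "(\<integral>\<^sup>+x. ennreal ((1 - x) powr a) * indicator {r..<1} x \<partial>lborel) \<le> ennreal ((1-r) powr (a+1) / (a+1))"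
proof -
  have "(\<integral>\<^sup>+x. ennreal ((1 - x) powr a) * indicator {r..<1} x \<partial>lborel) \<le> (\<integral>\<^sup>+x. ennreal ((1 - x) powr a) * indicator {0..1-r} (1 - x) \<partial>lborel)"
    by (intro nn_integral_mono) (auto simp: indicator_def)
  also have "\<dots> = ennreal ((1-r) powr (a+1) / (a+1))"
    using assms by (subst nn_integral_reflect[of "\<lambda>x. ennreal (x powr a) * indicator {0..1-r} x"]) (auto simp: nn_integral_powr_0)
  finally show ?thesis .
qed

lemma circ_mean_eq:
  fixes f :: "real \<Rightarrow> real"
  assumes [measurable]: "f \<in> borel_measurable borel" and "\<And>x. f x \<ge> 0"
  shows "1 / (2*pi) * (LINT \<theta>:{0..2*pi}|lborel. f \<theta>) = enn2real (\<integral>\<^sup>+\<theta>. ennreal (f \<theta>) \<partial>circ)"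
  using integral_circ[of f] integral_eq_nn_integral[of f circ] assms by simp

lemma AE_lborel_shift: 
  assumes "AE \<theta> in lborel. Q \<theta>" shows "AE \<theta> in lborel. Q (\<theta> + (c::real))"
proof -
  have "AE x in distr lborel borel ((+) c). Q x" unfolding lborel_distr_plus by (rule assms)
  then have "AE x in lborel. Q (c + x)" by (rule AE_distrD[rotated]) simp
  then show ?thesis by (simp add: add.commute)
qed

text \<open>The line is covered by the countably many translates of one period, and each translate
  of the exceptional set is null.\<close>

lemma AE_lborel_periodic:
  assumes AE: "AE \<theta> in circ. Q \<theta>" and per: "\<And>\<theta>. Q (\<theta> + 2*pi) = Q \<theta>"
  shows "AE \<theta> in lborel. Q \<theta>"
proof -
  have 0: "AE \<theta> in lborel. \<theta> \<in> {0..2*pi} \<longrightarrow> Q \<theta>"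
    using AE unfolding circ_def by (subst (asm) AE_uniform_measure) auto
  have "AE \<theta> in lborel. (\<theta> + c) \<in> {0..2*pi} \<longrightarrow> Q (\<theta> + c)" for c
    using AE_lborel_shift[OF 0, of c] .
  then have "AE \<theta> in lborel. \<forall>k::int. (\<theta> + 2*pi * of_int k) \<in> {0..2*pi} \<longrightarrow> Q (\<theta> + 2*pi * of_int k)"
    by (subst AE_all_countable) auto
  then show ?thesis
  proof eventually_elim
    case (elim \<theta>)
    have "angle_mod \<theta> \<in> {0..2*pi}" using angle_mod_bounds[of \<theta>] by auto
    with elim[rule_format, of "-\<lfloor>\<theta>/(2*pi)\<rfloor>"] have "Q (angle_mod \<theta>)" by (simp add: angle_mod_def)
    then show ?case using periodic_angle_mod[of Q, OF per] by simp
  qed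
qed

lemma AE_circ_of_lborel: "AE \<theta> in lborel. Q \<theta> \<Longrightarrow> AE \<theta> in circ. Q \<theta>"
  unfolding circ_def by (rule AE_uniform_measureI) auto

section \<open>Mean growth of the derivative and mean Lipschitz spaces\<close>

lemma integral_mean_eq:
  assumes [measurable]: "(\<lambda>\<theta>. F (of_real r * cis \<theta>)) \<in> borel_measurable borel"
  shows "integral_mean p r F = enn2real (pmean p F r) powr (1/p)"
  unfolding integral_mean_def pmean_def by (subst circ_mean_eq) auto

lemma integral_mean_le:
  assumes [measurable]: "(\<lambda>\<theta>. F (of_real r * cis \<theta>)) \<in> borel_measurable borel" 
    and "p > 0" "K \<ge> 0" "pmean p F r \<le> ennreal (K powr p)"
  shows "integral_mean p r F \<le> K"
proof -
  have "enn2real (pmean p F r) \<le> K powr p" using assms by (simp add: enn2real_leI)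
  then have "enn2real (pmean p F r) powr (1/p) \<le> (K powr p) powr (1/p)" using assms by (intro powr_mono2) auto
  then show ?thesis using assms by (simp add: integral_mean_eq powr_powr)
qed

lemma circ_L1_le_Lp:
  assumes p: "p > 1" and [measurable]: "f \<in> borel_measurable borel" and f: "\<And>x. f x \<ge> (0::real)" and K: "K \<ge> 0"
    and bd: "(\<integral>\<^sup>+\<theta>. ennreal (f \<theta> powr p) \<partial>circ) \<le> ennreal (K powr p)"
  shows "(\<integral>\<^sup>+\<theta>. ennreal (f \<theta>) \<partial>circ) \<le> ennreal K"
proof -
  have "(\<integral>\<^sup>+\<theta>. ennreal (f \<theta>) \<partial>circ) \<le> ennreal ((1 powr (p-1) * K powr p) powr (1/p))"
    by (rule nn_integral_Hoelder_weighted[OF p, where N="\<lambda>_. 1"]) (use assms in auto)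
  then show ?thesis using p K by (simp add: powr_powr)
qed

section \<open>From the growth of the derivative to the mean Lipschitz condition\<close>

locale growth =
  fixes p \<beta> C :: real and g :: "complex \<Rightarrow> complex"
  assumes p: "p > 1" and \<beta>: "0 < \<beta>" "\<beta> < 1" and C: "C > 0" and hol: "g holomorphic_on ball 0 1"
    and growth: "\<And>r. 0 \<le> r \<Longrightarrow> r < 1 \<Longrightarrow> pmean p (deriv g) r \<le> ennreal ((C * (1 - r) powr (\<beta>-1)) powr p)"
begin

lemma radial_bound:
  assumes r: "0 \<le> r1" "r1 \<le> r2" "r2 < 1"
  shows "(\<integral>\<^sup>+\<theta>. ennreal (norm (g (of_real r2 * cis \<theta>) - g (of_real r1 * cis \<theta>)) powr p) \<partial>circ)
     \<le> ennreal ((C / \<beta> * (1 - r1) powr \<beta>) powr p)"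
proof (rule pmean_radial_diff[OF p hol r, where N="\<lambda>s. C * (1 - s) powr (\<beta>-1)"])
  have "(\<integral>\<^sup>+s. ennreal (C * (1 - s) powr (\<beta>-1)) * indicator {r1..r2} s \<partial>lborel)
      \<le> (\<integral>\<^sup>+s. ennreal C * (ennreal ((1 - s) powr (\<beta>-1)) * indicator {r1..<1} s) \<partial>lborel)"
    using C r by (intro nn_integral_mono) (auto simp: indicator_def ennreal_mult')
  also have "\<dots> = ennreal C * (\<integral>\<^sup>+s. ennreal ((1 - s) powr (\<beta>-1)) * indicator {r1..<1} s \<partial>lborel)"
    by (rule nn_integral_cmult) measurable
  also have "\<dots> \<le> ennreal C * ennreal ((1-r1) powr (\<beta>-1+1) / (\<beta>-1+1))"
    using \<beta> r by (intro mult_left_mono nn_integral_one_minus_powr) auto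
  also have "\<dots> = ennreal (C / \<beta> * (1 - r1) powr \<beta>)" using C \<beta> by (simp add: ennreal_mult'[symmetric])
  finally show "(\<integral>\<^sup>+s. ennreal (C * (1 - s) powr (\<beta>-1)) * indicator {r1..r2} s \<partial>lborel) \<le> ennreal (C / \<beta> * (1 - r1) powr \<beta>)" .
qed (use C \<beta> r in \<open>auto intro!: growth\<close>)

lemma in_hardy_space: "g \<in> hardy_space p"
proof -
  define K where "K = 2 powr p * ((C / \<beta>) powr p + norm (g 0) powr p)"
  have K: "K \<ge> 0" by (simp add: K_def)
  have "integral_mean p r g \<le> K powr (1/p)" if r: "0 < r" "r < 1" for r
  proof (rule integral_mean_le)
    note circle_measurable[OF hol, of r, measurable]
    have "pmean p g r \<le> (\<integral>\<^sup>+\<theta>. ennreal (2 powr p) * (ennreal (norm (g (of_real r * cis \<theta>) - g (of_real 0 * cis \<theta>)) powr p) + ennreal (norm (g 0) powr p)) \<partial>circ)"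
      unfolding pmean_def
    proof (rule nn_integral_mono)
      fix \<theta>
      have "norm (g (of_real r * cis \<theta>)) powr p \<le> (norm (g (of_real r * cis \<theta>) - g 0) + norm (g 0)) powr p"
        using p norm_triangle_ineq[of "g (of_real r * cis \<theta>) - g 0" "g 0"] by (intro powr_mono2) auto
      also have "\<dots> \<le> 2 powr p * (norm (g (of_real r * cis \<theta>) - g 0) powr p + norm (g 0) powr p)"
        using p by (intro powr_add_le) auto
      finally show "ennreal (norm (g (of_real r * cis \<theta>)) powr p) \<le> ennreal (2 powr p) * (ennreal (norm (g (of_real r * cis \<theta>) - g (of_real 0 * cis \<theta>)) powr p) + ennreal (norm (g 0) powr p))"
        by (simp add: ennreal_plus[symmetric] ennreal_mult'[symmetric] ennreal_leI del: ennreal_plus)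
    qed
    also have "\<dots> = ennreal (2 powr p) * ((\<integral>\<^sup>+\<theta>. ennreal (norm (g (of_real r * cis \<theta>) - g (of_real 0 * cis \<theta>)) powr p) \<partial>circ) + ennreal (norm (g 0) powr p))"
      using r by (subst nn_integral_cmult, simp, subst nn_integral_add) auto
    also have "\<dots> \<le> ennreal (2 powr p) * (ennreal ((C / \<beta> * (1 - 0) powr \<beta>) powr p) + ennreal (norm (g 0) powr p))"
      using r by (intro mult_left_mono add_mono radial_bound) auto
    also have "\<dots> = ennreal K"
      by (simp add: K_def ennreal_plus[symmetric] ennreal_mult'[symmetric] del: ennreal_plus)
    finally show "pmean p g r \<le> ennreal ((K powr (1/p)) powr p)" using p K by (simp add: powr_powr)
  qed (use p circle_measurable[OF hol, of r] r in auto)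
  then have "bdd_above ((\<lambda>r. integral_mean p r g) ` {0<..<1})"
    by (intro bdd_aboveI2[where M="K powr (1/p)"]) simp
  then show ?thesis using hol by (simp add: hardy_space_def)
qed

text \<open>The boundary function is built by integrating \<open>g'\<close> along the radius, which
  makes its measurability in the angle automatic. Where the integral diverges it takes the default
  value \<open>g 0\<close>; this concerns a null set of angles only.\<close>

definition bdry :: "complex \<Rightarrow> complex" where
  "bdry z = g 0 + (LINT s:{0..<1}|lborel. disc_ext (deriv g) (of_real s * z) * z)"

lemma bdry_measurable: "(\<lambda>\<theta>. bdry (cis \<theta>)) \<in> borel_measurable borel"
proof -
  note disc_ext_measurable[OF holomorphic_deriv_disc[OF hol], measurable]
  show ?thesis unfolding bdry_def set_lebesgue_integral_def by measurable
qed

text \<open>By Tonelli and the embedding of Lp in L1 on the circle, the integral of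
  \<open>|g'|\<close> over all radii is at most that of
  \<open>C * (1 - s) powr (\<beta> - 1)\<close>, which is finite. So almost every radius has finite
  length under \<open>g\<close>, and there the radial limit exists.\<close>

lemma bdry_limit: "AE \<theta> in lborel. ((\<lambda>r. g (complex_of_real r * cis \<theta>)) \<longlongrightarrow> bdry (cis \<theta>)) (at_left 1)"
proof (rule AE_lborel_periodic)
  note hol' = holomorphic_deriv_disc[OF hol]
  note disc_ext_measurable[OF hol', measurable]
  interpret pair_sigma_finite circ "lborel :: real measure" ..
  define I where "I \<theta> = (\<integral>\<^sup>+s. ennreal (norm (disc_ext (deriv g) (of_real s * cis \<theta>))) * indicator {0..<1} s \<partial>lborel)" for \<theta>
  have [measurable]: "I \<in> borel_measurable borel" unfolding I_def[abs_def] by measurable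
  have "(\<integral>\<^sup>+\<theta>. I \<theta> \<partial>circ) = (\<integral>\<^sup>+s. \<integral>\<^sup>+\<theta>. ennreal (norm (disc_ext (deriv g) (of_real s * cis \<theta>))) * indicator {0..<1} s \<partial>circ \<partial>lborel)"
    unfolding I_def by (rule Fubini'[symmetric]) measurable
  also have "\<dots> \<le> (\<integral>\<^sup>+s. ennreal C * (ennreal ((1 - s) powr (\<beta>-1)) * indicator {0..<1} s) \<partial>lborel)"
  proof (rule nn_integral_mono)
    fix s :: real
    show "(\<integral>\<^sup>+\<theta>. ennreal (norm (disc_ext (deriv g) (of_real s * cis \<theta>))) * indicator {0..<1} s \<partial>circ) \<le> ennreal C * (ennreal ((1 - s) powr (\<beta>-1)) * indicator {0..<1} s)"
    proof (cases "s \<in> {0..<1}")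
      case True
      have "(\<integral>\<^sup>+\<theta>. ennreal (norm (deriv g (of_real s * cis \<theta>))) \<partial>circ) \<le> ennreal (C * (1 - s) powr (\<beta>-1))"
      proof (rule circ_L1_le_Lp[OF p])
        have "(\<lambda>\<theta>. deriv g (of_real s * cis \<theta>)) \<in> borel_measurable borel"
          using True by (intro circle_measurable[OF hol']) auto
        then show "(\<lambda>\<theta>. norm (deriv g (of_real s * cis \<theta>))) \<in> borel_measurable borel" by measurable
        show "(\<integral>\<^sup>+\<theta>. ennreal (norm (deriv g (of_real s * cis \<theta>)) powr p) \<partial>circ) \<le> ennreal ((C * (1 - s) powr (\<beta>-1)) powr p)"
          using growth[of s] True by (simp add: pmean_def)
      qed (use C in auto)
      then show ?thesis using True C by (simp add: norm_mult ennreal_mult')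
    qed simp
  qed
  also have "\<dots> = ennreal C * (\<integral>\<^sup>+s. ennreal ((1 - s) powr (\<beta>-1)) * indicator {0..<1} s \<partial>lborel)"
    by (rule nn_integral_cmult) measurable
  also have "\<dots> \<le> ennreal C * ennreal ((1-0) powr (\<beta>-1+1) / (\<beta>-1+1))"
    using \<beta> by (intro mult_left_mono nn_integral_one_minus_powr) auto
  also have "\<dots> < \<infinity>" by (simp add: ennreal_mult_less_top)
  finally have "AE \<theta> in circ. I \<theta> \<noteq> \<infinity>" by (intro nn_integral_PInf_AE) auto
  then show "AE \<theta> in circ. ((\<lambda>r. g (complex_of_real r * cis \<theta>)) \<longlongrightarrow> bdry (cis \<theta>)) (at_left 1)"
  proof eventually_elim
    case (elim \<theta>)
    let ?f = "\<lambda>s. disc_ext (deriv g) (of_real s * cis \<theta>) * cis \<theta>"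
    have int: "set_integrable lborel {0..<1} ?f"
      unfolding set_integrable_def
    proof (rule integrableI_bounded)
      have "(\<integral>\<^sup>+x. ennreal (norm (indicator {0..<1} x *\<^sub>R ?f x)) \<partial>lborel) = I \<theta>"
        unfolding I_def by (intro nn_integral_cong) (auto simp: indicator_def norm_mult)
      then show "(\<integral>\<^sup>+x. ennreal (norm (indicator {0..<1} x *\<^sub>R ?f x)) \<partial>lborel) < \<infinity>" using elim by (simp add: top.not_eq_extremum)
    qed measurable
    have "((\<lambda>r. g 0 + set_lebesgue_integral lborel {0..r} ?f) \<longlongrightarrow> bdry (cis \<theta>)) (at_left 1)"
      unfolding bdry_def by (intro tendsto_add tendsto_const tendsto_set_lebesgue_integral_at_left int) auto
    moreover have "\<forall>\<^sub>F r in at_left 1. g 0 + set_lebesgue_integral lborel {0..r} ?f = g (complex_of_real r * cis \<theta>)"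
    proof -
      have "g 0 + set_lebesgue_integral lborel {0..r} ?f = g (complex_of_real r * cis \<theta>)" if r: "0 < r" "r < 1" for r
        by (simp only: set_lebesgue_integral_def radial_FTC[OF hol order_refl less_imp_le[OF r(1)] r(2)]) simp
      then show ?thesis using eventually_at_left_real[of 0 "1::real"] by (auto elim!: eventually_mono)
    qed
    ultimately show ?case by (rule Lim_transform_eventually)
  qed
qed simp

text \<open>The classical detour: from the boundary radially inwards to radius \<open>1 - h\<close>,
  along an arc of angle \<open>h\<close>, and back out. At depth \<open>h\<close> each of the three
  pieces has order \<open>h powr \<beta>\<close>. This is carried out at radii \<open>R n\<close>
  below 1, uniformly in \<open>n\<close>, and Fatou's lemma gives the boundary statement.\<close>

lemma bdry_modulus:
  assumes h: "0 < h" "h < 1"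
  shows "(\<integral>\<^sup>+\<theta>. ennreal (norm (bdry (cis (\<theta> + h)) - bdry (cis \<theta>)) powr p) \<partial>circ) \<le> ennreal (((3 powr p * (2 * (C/\<beta>) powr p + C powr p)) powr (1/p) * h powr \<beta>) powr p)"
proof -
  define K where "K = 3 powr p * (2 * (C/\<beta>) powr p + C powr p)"
  have K: "K \<ge> 0" by (simp add: K_def)
  \<comment> \<open>The sequence starts at \<open>1 - h\<close>, so that every \<open>R n\<close>
    lies outside the circle of the arc, as the radial bound requires.\<close>
  define R where "R n = 1 - h / (real n + 1)" for n
  have R: "1 - h \<le> R n" "R n < 1" "0 \<le> R n" "0 < R n" for n
  proof -
    have "h / (real n + 1) \<le> h / 1" using h by (intro divide_left_mono) auto
    then show "1 - h \<le> R n" by (simp add: R_def)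
    with h show "0 \<le> R n" "0 < R n" by auto
    show "R n < 1" using h by (simp add: R_def)
  qed
  have Rlim: "filterlim R (at_left 1) sequentially"
  proof (rule filterlim_at_withinI)
    have "(\<lambda>n. 1 - h / real (Suc n)) \<longlonglongrightarrow> 1 - 0"
      by (intro tendsto_diff tendsto_const LIMSEQ_Suc[OF lim_const_over_n])
    then show "R \<longlonglongrightarrow> 1" unfolding R_def by (simp add: add.commute)
  qed (use R in \<open>auto intro: eventuallyI\<close>)
  have bd: "(\<integral>\<^sup>+\<theta>. ennreal (norm (g (of_real (R n) * cis (\<theta> + h)) - g (of_real (R n) * cis \<theta>)) powr p) \<partial>circ) \<le> ennreal (K * h powr (\<beta> * p))" for n
  proof -
    define \<rho> where "\<rho> = 1 - h"
    have \<rho>: "\<bar>R n\<bar> < 1" "\<bar>\<rho>\<bar> < 1" using R[of n] h by (auto simp: \<rho>_def)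
    note circle_measurable[OF hol \<rho>(1), measurable] circle_measurable[OF hol \<rho>(2), measurable]
    let ?D = "\<lambda>\<theta>. g (of_real (R n) * cis \<theta>) - g (of_real \<rho> * cis \<theta>)"
    let ?E = "\<lambda>\<theta>. g (of_real \<rho> * cis (\<theta> + h)) - g (of_real \<rho> * cis \<theta>)"
    have D: "(\<integral>\<^sup>+\<theta>. ennreal (norm (?D \<theta>) powr p) \<partial>circ) \<le> ennreal ((C / \<beta> * h powr \<beta>) powr p)"
      using radial_bound[of \<rho> "R n"] R[of n] h by (simp add: \<rho>_def)
    have D': "(\<integral>\<^sup>+\<theta>. ennreal (norm (?D (\<theta> + h)) powr p) \<partial>circ) = (\<integral>\<^sup>+\<theta>. ennreal (norm (?D \<theta>) powr p) \<partial>circ)"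
      by (rule nn_integral_circ_rotate[of "\<lambda>\<theta>. ennreal (norm (?D \<theta>) powr p)"]) auto
    have E: "(\<integral>\<^sup>+\<theta>. ennreal (norm (?E \<theta>) powr p) \<partial>circ) \<le> ennreal ((h * (C * h powr (\<beta>-1))) powr p)"
      using growth[of \<rho>] h C by (intro pmean_arc_diff[OF p hol]) (auto simp: \<rho>_def)
    have "(\<integral>\<^sup>+\<theta>. ennreal (norm (g (of_real (R n) * cis (\<theta> + h)) - g (of_real (R n) * cis \<theta>)) powr p) \<partial>circ)
      \<le> (\<integral>\<^sup>+\<theta>. ennreal (3 powr p) * (ennreal (norm (?D (\<theta> + h)) powr p) + ennreal (norm (?E \<theta>) powr p) + ennreal (norm (?D \<theta>) powr p)) \<partial>circ)"
    proof (rule nn_integral_mono)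
      fix \<theta>
      have "norm (g (of_real (R n) * cis (\<theta> + h)) - g (of_real (R n) * cis \<theta>)) = norm (?D (\<theta> + h) + ?E \<theta> - ?D \<theta>)"
        by simp
      also have "\<dots> \<le> norm (?D (\<theta> + h)) + norm (?E \<theta>) + norm (?D \<theta>)"
        by (intro order_trans[OF norm_triangle_ineq4] add_mono norm_triangle_ineq order_refl)
      finally have "norm (g (of_real (R n) * cis (\<theta> + h)) - g (of_real (R n) * cis \<theta>)) powr p \<le> (norm (?D (\<theta> + h)) + norm (?E \<theta>) + norm (?D \<theta>)) powr p"
        using p by (intro powr_mono2) auto
      also have "\<dots> \<le> 3 powr p * (norm (?D (\<theta> + h)) powr p + norm (?E \<theta>) powr p + norm (?D \<theta>) powr p)"
        using p by (intro powr_add3_le) auto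
      finally show "ennreal (norm (g (of_real (R n) * cis (\<theta> + h)) - g (of_real (R n) * cis \<theta>)) powr p) \<le> ennreal (3 powr p) * (ennreal (norm (?D (\<theta> + h)) powr p) + ennreal (norm (?E \<theta>) powr p) + ennreal (norm (?D \<theta>) powr p))"
        by (simp add: ennreal_plus[symmetric] ennreal_mult'[symmetric] ennreal_leI del: ennreal_plus)
    qed
    also have "\<dots> = ennreal (3 powr p) * ((\<integral>\<^sup>+\<theta>. ennreal (norm (?D (\<theta> + h)) powr p) \<partial>circ) + (\<integral>\<^sup>+\<theta>. ennreal (norm (?E \<theta>) powr p) \<partial>circ) + (\<integral>\<^sup>+\<theta>. ennreal (norm (?D \<theta>) powr p) \<partial>circ))"
    proof -
      have [measurable]: "(\<lambda>\<theta>. g (of_real (R n) * cis (\<theta> + h))) \<in> borel_measurable borel" "(\<lambda>\<theta>. g (of_real \<rho> * cis (\<theta> + h))) \<in> borel_measurable borel"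
        using measurable_compose[OF _ circle_measurable[OF hol \<rho>(1)], of "\<lambda>\<theta>. \<theta> + h" borel]
          measurable_compose[OF _ circle_measurable[OF hol \<rho>(2)], of "\<lambda>\<theta>. \<theta> + h" borel] by auto
      show ?thesis by (simp add: nn_integral_cmult nn_integral_add)
    qed
    also have "\<dots> \<le> ennreal (3 powr p) * (ennreal ((C / \<beta> * h powr \<beta>) powr p) + ennreal ((h * (C * h powr (\<beta>-1))) powr p) + ennreal ((C / \<beta> * h powr \<beta>) powr p))"
      unfolding D' by (intro mult_left_mono add_mono D E) auto
    also have "\<dots> = ennreal (3 powr p * ((C / \<beta> * h powr \<beta>) powr p + (h * (C * h powr (\<beta>-1))) powr p + (C / \<beta> * h powr \<beta>) powr p))"
      by (simp add: ennreal_plus[symmetric] ennreal_mult'[symmetric] del: ennreal_plus)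
    also have "3 powr p * ((C / \<beta> * h powr \<beta>) powr p + (h * (C * h powr (\<beta>-1))) powr p + (C / \<beta> * h powr \<beta>) powr p) = K * h powr (\<beta> * p)"
    proof -
      have "h * (C * h powr (\<beta>-1)) = C * h powr \<beta>" using h by (simp add: powr_diff)
      moreover have "(C / \<beta> * h powr \<beta>) powr p = (C/\<beta>) powr p * h powr (\<beta> * p)" "(C * h powr \<beta>) powr p = C powr p * h powr (\<beta> * p)"
        using C \<beta> h by (simp_all only: powr_mult powr_powr) 
      ultimately show ?thesis by (simp only: K_def) (simp add: algebra_simps)
    qed
    finally show ?thesis .
  qed
  have "AE \<theta> in circ. ((\<lambda>n. ennreal (norm (g (of_real (R n) * cis (\<theta> + h)) - g (of_real (R n) * cis \<theta>)) powr p)) \<longlonglongrightarrow> ennreal (norm (bdry (cis (\<theta> + h)) - bdry (cis \<theta>)) powr p))"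
    using AE_circ_of_lborel[OF bdry_limit] AE_circ_of_lborel[OF AE_lborel_shift[OF bdry_limit, of h]]
  proof eventually_elim
    case (elim \<theta>)
    have "(\<lambda>n. norm (g (of_real (R n) * cis (\<theta> + h)) - g (of_real (R n) * cis \<theta>)) powr p) \<longlonglongrightarrow> norm (bdry (cis (\<theta> + h)) - bdry (cis \<theta>)) powr p"
      using p by (intro tendsto_powr2 tendsto_const tendsto_norm tendsto_diff filterlim_compose[OF elim(1) Rlim] filterlim_compose[OF elim(2) Rlim]) auto
    then show ?case by (intro tendsto_ennrealI)
  qed
  then have "(\<integral>\<^sup>+\<theta>. ennreal (norm (bdry (cis (\<theta> + h)) - bdry (cis \<theta>)) powr p) \<partial>circ) = (\<integral>\<^sup>+\<theta>. liminf (\<lambda>n. ennreal (norm (g (of_real (R n) * cis (\<theta> + h)) - g (of_real (R n) * cis \<theta>)) powr p)) \<partial>circ)"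
    by (intro nn_integral_cong_AE, elim eventually_mono) (rule sym, rule lim_imp_Liminf[OF sequentially_bot])
  also have "\<dots> \<le> liminf (\<lambda>n. \<integral>\<^sup>+\<theta>. ennreal (norm (g (of_real (R n) * cis (\<theta> + h)) - g (of_real (R n) * cis \<theta>)) powr p) \<partial>circ)"
  proof (rule nn_integral_liminf)
    fix n
    have "(\<lambda>\<theta>. g (of_real (R n) * cis \<theta>)) \<in> borel_measurable borel" "(\<lambda>\<theta>. g (of_real (R n) * cis (\<theta> + h))) \<in> borel_measurable borel"
      using circle_measurable[OF hol, of "R n"] measurable_compose[OF _ circle_measurable[OF hol, of "R n"], of "\<lambda>\<theta>. \<theta> + h" borel] R[of n] by auto
    then show "(\<lambda>\<theta>. ennreal (norm (g (of_real (R n) * cis (\<theta> + h)) - g (of_real (R n) * cis \<theta>)) powr p)) \<in> borel_measurable circ" by measurable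
  qed
  also have "\<dots> \<le> ennreal (K * h powr (\<beta> * p))"
    using bd by (intro Liminf_le) (auto intro: always_eventually)
  also have "K * h powr (\<beta> * p) = (K powr (1/p) * h powr \<beta>) powr p"
    using K p by (simp add: powr_mult powr_powr)
  finally show ?thesis by (simp add: K_def)
qed

lemma in_mean_lipschitz: "g \<in> mean_lipschitz p \<beta>"
proof -
  define K where "K = (3 powr p * (2 * (C/\<beta>) powr p + C powr p)) powr (1/p)"
  have K: "K \<ge> 0" by (simp add: K_def)
  note bdry_measurable[measurable]
  define M where "M h = (1 / (2 * pi) * (LINT \<theta>:{0..2 * pi}|lborel. norm (bdry (cis (\<theta> + h)) - bdry (cis \<theta>)) powr p)) powr (1 / p)" for h
  have M: "M h \<le> K * h powr \<beta>" if h: "0 < h" "h < 1" for h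
  proof -
    have [measurable]: "(\<lambda>\<theta>. bdry (cis (\<theta> + h))) \<in> borel_measurable borel"
      using measurable_compose[OF _ bdry_measurable, of "\<lambda>\<theta>. \<theta> + h" borel] by simp
    have "M h = enn2real (\<integral>\<^sup>+\<theta>. ennreal (norm (bdry (cis (\<theta> + h)) - bdry (cis \<theta>)) powr p) \<partial>circ) powr (1/p)"
      unfolding M_def by (subst circ_mean_eq) auto
    also have "\<dots> \<le> ((K * h powr \<beta>) powr p) powr (1/p)"
      using bdry_modulus[OF h] p by (intro powr_mono2 enn2real_leI) (auto simp: K_def)
    also have "\<dots> = K * h powr \<beta>" using p K by (simp add: powr_powr)
    finally show ?thesis .
  qed
  have *: "norm (Lp_modulus p bdry t) \<le> K * norm (t powr \<beta>)" if t: "0 < t" "t < 1" for t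
  proof -
    have le: "M h \<le> K * t powr \<beta>" if "h \<in> {0<..t}" for h
      using M[of h] that t K \<beta> by (auto intro!: order_trans[OF M] mult_left_mono powr_mono2)
    have eq: "Lp_modulus p bdry t = (SUP h\<in>{0<..t}. M h)" by (simp add: Lp_modulus_def M_def)
    \<comment> \<open>The Landau bound is about absolute values, so the supremum also needs a sign:
      it dominates the nonnegative \<open>M t\<close>.\<close>
    have "0 \<le> M t" by (simp add: M_def)
    also have "M t \<le> (SUP h\<in>{0<..t}. M h)"
      using t le by (intro cSUP_upper bdd_aboveI[of _ "K * t powr \<beta>"]) auto
    finally have 0: "Lp_modulus p bdry t \<ge> 0" by (simp add: eq)
    have "(SUP h\<in>{0<..t}. M h) \<le> K * t powr \<beta>"
      using t le by (intro cSUP_least) auto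
    with 0 show ?thesis by (simp add: eq)
  qed
  have "\<forall>\<^sub>F t in at_right 0. t \<in> {0<..<1::real}"
    by (rule eventually_at_right_real) simp
  then have "\<forall>\<^sub>F t in at_right 0. norm (Lp_modulus p bdry t) \<le> K * norm (t powr \<beta>)"
    by (rule eventually_mono) (rule *, auto)
  then have "Lp_modulus p bdry \<in> O[at_right 0](\<lambda>t. t powr \<beta>)"
    by (rule bigoI)
  moreover have "is_boundary_function g bdry"
    unfolding is_boundary_function_def using bdry_limit bdry_measurable by simp
  ultimately have "is_boundary_function g bdry \<and> Lp_modulus p bdry \<in> O[at_right 0](\<lambda>t. t powr \<beta>)"
    by (intro conjI)
  with in_hardy_space show ?thesis unfolding mean_lipschitz_def by (simp only: mem_Collect_eq simp_thms) (rule exI)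
qed
end

section \<open>From the mean Lipschitz condition to the growth of the derivative\<close>

text \<open>Jordan's inequality: the sine is concave on this interval and lies above the chord
  through its endpoints.\<close>

lemma sin_ge_linear:
  assumes "0 \<le> x" "x \<le> pi/2"
  shows "sin x \<ge> 2 * x / pi"
proof -
  have conc: "concave_on {0..pi/2} sin"
  proof (rule f''_le0_imp_concave)
    show "(sin has_real_derivative cos x) (at x)" for x :: real by (auto intro!: derivative_eq_intros)
    show "(cos has_real_derivative - sin x) (at x)" for x :: real by (auto intro!: derivative_eq_intros)
    show "- sin x \<le> 0" if "x \<in> {0..pi/2}" for x :: real using that sin_ge_zero[of x] by auto
  qed simp
  have u: "0 \<le> 2 * x / pi" "2 * x / pi \<le> 1" using assms by (auto simp: field_simps)
  have "sin ((1 - 2 * x / pi) *\<^sub>R 0 + (2 * x / pi) *\<^sub>R (pi/2)) \<ge> (1 - 2 * x / pi) * sin 0 + (2 * x / pi) * sin (pi/2)"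
    by (rule concave_onD[OF conc]) (use u in auto)
  then show ?thesis by simp
qed

text \<open>The distance dominates \<open>1 - r\<close> trivially. Jordan's inequality and the
  triangle inequality through the point 1 show that \<open>pi\<close> times the distance dominates
  the angular distance \<open>m\<close> to 0; adding both gives the constant
  \<open>1 + pi\<close>.\<close>

lemma norm_cis_minus_ge:
  assumes t: "0 < t" "t < 2*pi" and r: "0 \<le> r" "r < 1"
  shows "norm (cis t - of_real r) \<ge> (1 - r + min t (2*pi - t)) / (1 + pi)"
proof -
  define m where "m = min t (2*pi - t)"
  define X where "X = norm (cis t - of_real r)"
  have m: "0 < m" "m \<le> pi" using t by (auto simp: m_def min_def)
  have "sin (t/2) = sin (m/2)"
    using sin_pi_minus[of "t/2"] by (auto simp: m_def min_def diff_divide_distrib)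
  moreover have "sin (m/2) \<ge> m/pi" using sin_ge_linear[of "m/2"] m by simp
  moreover have "m / pi > 0" using m by simp
  ultimately have "2 * (m/pi) \<le> norm (cis t - 1)"
    using dist_exp_i_1[of t] by (simp add: cis_conv_exp)
  also have "\<dots> \<le> X + norm (of_real r - 1 :: complex)"
    using norm_triangle_ineq[of "cis t - of_real r" "of_real r - 1"] by (simp add: X_def)
  also have "norm (of_real r - 1 :: complex) = 1 - r"
    using r by (metis abs_minus_commute abs_of_nonneg diff_ge_0_iff_ge less_imp_le norm_of_real of_real_1 of_real_diff)
  also have r1: "1 - r \<le> X"
    using norm_triangle_ineq2[of "cis t" "of_real r"] r by (simp add: X_def)
  finally have "m \<le> pi * X" by (simp add: field_simps)
  with r1 have "1 - r + m \<le> X * (1 + pi)" by (simp add: algebra_simps)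
  then show ?thesis using pi_gt_zero by (simp add: X_def m_def divide_le_eq add_pos_pos)
qed

text \<open>Boundedness in Lp with \<open>p > 1\<close> supplies uniform integrability: above a
  level \<open>K\<close> one has \<open>d \<le> K powr (1-p) * d powr p\<close>. The part truncated
  at \<open>K\<close> is handled by dominated convergence on a finite measure space, and then
  \<open>K\<close> tends to infinity.\<close>

lemma Vitali_Lp_L1:
  fixes d :: "nat \<Rightarrow> 'a \<Rightarrow> real"
  assumes p: "p > 1" and fin: "emeasure M (space M) < \<infinity>" and [measurable]: "\<And>n. d n \<in> borel_measurable M"
    and d: "\<And>n x. d n x \<ge> 0" and lim: "AE x in M. (\<lambda>n. d n x) \<longlonglongrightarrow> 0"
    and B: "\<And>n. (\<integral>\<^sup>+x. ennreal (d n x powr p) \<partial>M) \<le> ennreal B"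
  shows "(\<lambda>n. \<integral>\<^sup>+x. ennreal (d n x) \<partial>M) \<longlonglongrightarrow> 0"
proof (rule tendsto_0_if_Limsup_eq_0_ennreal)
  have bound: "limsup (\<lambda>n. \<integral>\<^sup>+x. ennreal (d n x) \<partial>M) \<le> ennreal (K powr (1-p) * max 0 B)" if K: "K > 0" for K
  proof -
    have "(\<lambda>n. \<integral>\<^sup>+x. ennreal (min (d n x) K) \<partial>M) \<longlonglongrightarrow> (\<integral>\<^sup>+x. 0 \<partial>M)"
    proof (rule nn_integral_dominated_convergence[where w="\<lambda>_. ennreal K"])
      show "(\<integral>\<^sup>+x. ennreal K \<partial>M) < \<infinity>" using fin by (simp add: ennreal_mult_less_top)
      show "AE x in M. (\<lambda>n. ennreal (min (d n x) K)) \<longlonglongrightarrow> 0"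
        using lim
      proof eventually_elim
        case (elim x)
        then have "(\<lambda>n. min (d n x) K) \<longlonglongrightarrow> min 0 K" by (intro tendsto_min tendsto_const)
        then have "(\<lambda>n. ennreal (min (d n x) K)) \<longlonglongrightarrow> ennreal (min 0 K)" by (rule tendsto_ennrealI)
        then show ?case using K by simp
      qed
    qed (auto intro!: ennreal_leI)
    then have l0: "(\<lambda>n. (\<integral>\<^sup>+x. ennreal (min (d n x) K) \<partial>M) + ennreal (K powr (1-p) * max 0 B)) \<longlonglongrightarrow> 0 + ennreal (K powr (1-p) * max 0 B)"
      by (intro tendsto_add tendsto_const) simp
    have le: "(\<integral>\<^sup>+x. ennreal (d n x) \<partial>M) \<le> (\<integral>\<^sup>+x. ennreal (min (d n x) K) \<partial>M) + ennreal (K powr (1-p) * max 0 B)" for n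
    proof -
      have "d n x \<le> min (d n x) K + K powr (1-p) * d n x powr p" for x
      proof (cases "d n x \<le> K")
        case False
        then have dK: "d n x > K" by simp
        have "d n x = d n x powr (1-p) * d n x powr p" using dK K by (simp add: powr_add[symmetric])
        also have "\<dots> \<le> K powr (1-p) * d n x powr p"
          using dK K p by (intro mult_right_mono powr_mono2') auto
        finally show ?thesis using K by (simp add: min_def)
      qed (use d in auto)
      then have "(\<integral>\<^sup>+x. ennreal (d n x) \<partial>M) \<le> (\<integral>\<^sup>+x. ennreal (min (d n x) K) + ennreal (K powr (1-p)) * ennreal (d n x powr p) \<partial>M)"
        using d K by (intro nn_integral_mono) (auto simp: ennreal_plus[symmetric] ennreal_mult'[symmetric] intro!: ennreal_leI simp del: ennreal_plus)
      also have "\<dots> = (\<integral>\<^sup>+x. ennreal (min (d n x) K) \<partial>M) + ennreal (K powr (1-p)) * (\<integral>\<^sup>+x. ennreal (d n x powr p) \<partial>M)"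
        by (subst nn_integral_add) (auto simp: nn_integral_cmult)
      also have "\<dots> \<le> (\<integral>\<^sup>+x. ennreal (min (d n x) K) \<partial>M) + ennreal (K powr (1-p)) * ennreal (max 0 B)"
        by (intro add_mono mult_left_mono order_refl order_trans[OF B]) (auto intro: ennreal_leI)
      finally show ?thesis by (simp add: ennreal_mult'[symmetric])
    qed
    have "limsup (\<lambda>n. \<integral>\<^sup>+x. ennreal (d n x) \<partial>M) \<le> limsup (\<lambda>n. (\<integral>\<^sup>+x. ennreal (min (d n x) K) \<partial>M) + ennreal (K powr (1-p) * max 0 B))"
      by (intro Limsup_mono always_eventually allI le)
    also have "\<dots> = 0 + ennreal (K powr (1-p) * max 0 B)" by (rule lim_imp_Limsup[OF sequentially_bot l0])
    finally show ?thesis by simp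
  qed
  show "limsup (\<lambda>n. \<integral>\<^sup>+x. ennreal (d n x) \<partial>M) = 0"
  proof (rule antisym)
    have "((\<lambda>K. K powr (1-p) * max 0 B) \<longlongrightarrow> 0 * max 0 B) at_top"
      using p by (intro tendsto_mult tendsto_const tendsto_neg_powr filterlim_ident) auto
    then have "((\<lambda>K. ennreal (K powr (1-p) * max 0 B)) \<longlongrightarrow> ennreal 0) at_top"
      by (intro tendsto_ennrealI) simp
    then have "limsup (\<lambda>n. \<integral>\<^sup>+x. ennreal (d n x) \<partial>M) \<le> ennreal 0"
      by (rule tendsto_lowerbound) (use bound in \<open>auto intro: eventually_mono[OF eventually_gt_at_top[of 0]]\<close>)
    then show "limsup (\<lambda>n. \<integral>\<^sup>+x. ennreal (d n x) \<partial>M) \<le> 0" by simp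
  qed simp
qed

lemma nn_integral_Fatou_real:
  fixes f :: "nat \<Rightarrow> 'a \<Rightarrow> real"
  assumes [measurable]: "\<And>n. f n \<in> borel_measurable M" and lim: "AE x in M. (\<lambda>n. f n x) \<longlonglongrightarrow> l x"
    and B: "\<And>n. (\<integral>\<^sup>+x. ennreal (f n x) \<partial>M) \<le> B"
  shows "(\<integral>\<^sup>+x. ennreal (l x) \<partial>M) \<le> B"
proof -
  have "(\<integral>\<^sup>+x. ennreal (l x) \<partial>M) = (\<integral>\<^sup>+x. liminf (\<lambda>n. ennreal (f n x)) \<partial>M)"
  proof (rule nn_integral_cong_AE)
    show "AE x in M. ennreal (l x) = liminf (\<lambda>n. ennreal (f n x))"
      using lim by eventually_elim (rule sym, rule lim_imp_Liminf[OF sequentially_bot], rule tendsto_ennrealI)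
  qed
  also have "\<dots> \<le> liminf (\<lambda>n. \<integral>\<^sup>+x. ennreal (f n x) \<partial>M)"
    by (rule nn_integral_liminf) measurable
  also have "\<dots> \<le> B" using B by (intro Liminf_le) (auto intro: always_eventually)
  finally show ?thesis .
qed

lemma nn_integral_circ_bounded:
  assumes "\<And>\<theta>. f \<theta> \<le> (B::ennreal)" shows "(\<integral>\<^sup>+\<theta>. f \<theta> \<partial>circ) \<le> B"
proof -
  have "(\<integral>\<^sup>+\<theta>. f \<theta> \<partial>circ) \<le> (\<integral>\<^sup>+\<theta>. B \<partial>circ)" using assms by (intro nn_integral_mono)
  then show ?thesis by simp
qed

lemma pmean_finite:
  assumes F: "F holomorphic_on ball 0 1" and r: "0 \<le> r" "r < 1" and p: "p \<ge> 0"
  shows "pmean p F r < \<infinity>"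
proof -
  have "compact (F ` cball 0 r)"
    using r by (intro compact_continuous_image holomorphic_on_imp_continuous_on holomorphic_on_subset[OF F]) auto
  then obtain B where B: "\<And>z. z \<in> cball 0 r \<Longrightarrow> norm (F z) \<le> B"
    by (meson bounded_iff compact_imp_bounded imageI)
  have "pmean p F r \<le> ennreal (B powr p)"
    unfolding pmean_def using r p B by (intro nn_integral_circ_bounded ennreal_leI powr_mono2) (auto simp: norm_mult)
  then show ?thesis by (auto intro: le_less_trans)
qed

text \<open>The real-valued \<open>integral_mean\<close> would read an infinite integral as
  \<open>0\<close>. For a fixed radius \<open>pmean_finite\<close> excludes this, so the Hardy bound
  carries over to \<open>pmean\<close>; the maximum with 1 only makes the constant positive.\<close>

lemma hardy_pmean_bound:
  assumes "F \<in> hardy_space p" and p: "p > 0"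
  obtains K where "K > 0" "\<And>r. 0 < r \<Longrightarrow> r < 1 \<Longrightarrow> pmean p F r \<le> ennreal (K powr p)"
proof -
  have hol: "F holomorphic_on ball 0 1" and bdd: "bdd_above ((\<lambda>r. integral_mean p r F) ` {0<..<1})"
    using assms by (auto simp: hardy_space_def)
  obtain M where "\<forall>x\<in>(\<lambda>r. integral_mean p r F) ` {0<..<1}. x \<le> M"
    using bdd unfolding bdd_above_def by blast
  then have M: "integral_mean p r F \<le> M" if "r \<in> {0<..<1}" for r using that by blast
  show thesis
  proof (rule that)
    show "max M 1 > 0" by simp
    fix r :: real assume r: "0 < r" "r < 1"
    have "enn2real (pmean p F r) powr (1/p) \<le> max M 1"
      using M[of r] r integral_mean_eq[OF circle_measurable[OF hol], of r p] by auto
    then have "(enn2real (pmean p F r) powr (1/p)) powr p \<le> max M 1 powr p" using p by (intro powr_mono2) auto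
    then have "enn2real (pmean p F r) \<le> max M 1 powr p" using p by (simp add: powr_powr)
    then have "ennreal (enn2real (pmean p F r)) \<le> ennreal (max M 1 powr p)" by (rule ennreal_leI)
    then show "pmean p F r \<le> ennreal (max M 1 powr p)"
      using pmean_finite[OF hol, of r p] r p by simp
  qed
qed

lemma integrable_mult_bounded:
  fixes f k :: "'a \<Rightarrow> complex"
  assumes "integrable M f" and [measurable]: "k \<in> borel_measurable M" and "\<And>x. norm (k x) \<le> B"
  shows "integrable M (\<lambda>x. f x * k x)"
proof (rule Bochner_Integration.integrable_bound[where f="\<lambda>x. f x * of_real B"])
  note borel_measurable_integrable[OF assms(1), measurable]
  show "(\<lambda>x. f x * k x) \<in> borel_measurable M" by measurable
  show "AE x in M. norm (f x * k x) \<le> norm (f x * of_real B)"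
  proof (rule AE_I2)
    fix x
    have "norm (k x) \<le> \<bar>B\<bar>" using assms(3)[of x] by linarith
    then show "norm (f x * k x) \<le> norm (f x * of_real B)" by (simp add: norm_mult mult_left_mono)
  qed
qed (use assms in simp)

locale boundary =
  fixes p :: real and g \<phi> :: "complex \<Rightarrow> complex" and K :: real
  assumes p: "p > 1" and hol: "g holomorphic_on ball 0 1"
    and bf: "is_boundary_function g \<phi>" 
    and K: "K > 0" "\<And>r. 0 < r \<Longrightarrow> r < 1 \<Longrightarrow> pmean p g r \<le> ennreal (K powr p)"
begin

text \<open>The double \<open>Suc\<close> makes the first radius \<open>1/2\<close>, since the bound
  by \<open>K\<close> is assumed for positive radii.\<close>

definition R :: "nat \<Rightarrow> real" where "R n = 1 - 1 / real (Suc (Suc n))"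

lemma R_bounds: "0 < R n" "R n < 1" "\<bar>R n\<bar> < 1"
  by (auto simp: R_def field_simps)

lemma R_lim: "R \<longlonglongrightarrow> 1"
proof -
  have "(\<lambda>n. 1 - 1 / real (Suc (Suc n))) \<longlonglongrightarrow> 1 - 0"
    by (intro tendsto_diff tendsto_const LIMSEQ_Suc[OF LIMSEQ_Suc[OF lim_const_over_n]])
  then show ?thesis unfolding R_def by simp
qed

lemma R_at_left: "filterlim R (at_left 1) sequentially"
  by (rule filterlim_at_withinI) (use R_bounds R_lim in \<open>auto intro: eventuallyI\<close>)

definition u :: "real \<Rightarrow> complex" where "u \<theta> = \<phi> (cis \<theta>)"

lemma u_measurable [measurable]: "u \<in> borel_measurable borel"
  using bf by (simp add: is_boundary_function_def u_def[abs_def])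

lemma u_per [simp]: "u (\<theta> + 2*pi) = u \<theta>"
  by (simp add: u_def)

lemma gR_measurable [measurable]: "(\<lambda>\<theta>. g (of_real (R n) * cis \<theta>)) \<in> borel_measurable borel"
  by (rule circle_measurable[OF hol R_bounds(3)])

lemma gR_lim: "AE \<theta> in circ. (\<lambda>n. g (of_real (R n) * cis \<theta>)) \<longlonglongrightarrow> u \<theta>"
proof -
  have "AE \<theta> in lborel. ((\<lambda>r. g (complex_of_real r * cis \<theta>)) \<longlongrightarrow> u \<theta>) (at_left 1)"
    using bf by (simp add: is_boundary_function_def u_def)
  then have "AE \<theta> in lborel. (\<lambda>n. g (of_real (R n) * cis \<theta>)) \<longlonglongrightarrow> u \<theta>"
    by eventually_elim (rule filterlim_compose[OF _ R_at_left])
  then show ?thesis by (rule AE_circ_of_lborel)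
qed

lemma u_Lp: "(\<integral>\<^sup>+\<theta>. ennreal (norm (u \<theta>) powr p) \<partial>circ) \<le> ennreal (K powr p)"
proof (rule nn_integral_Fatou_real[where f="\<lambda>n \<theta>. norm (g (of_real (R n) * cis \<theta>)) powr p"])
  show "AE \<theta> in circ. (\<lambda>n. norm (g (of_real (R n) * cis \<theta>)) powr p) \<longlonglongrightarrow> norm (u \<theta>) powr p"
    using gR_lim
  proof eventually_elim
    case (elim \<theta>)
    then show ?case using p by (intro tendsto_powr2 tendsto_norm tendsto_const) auto
  qed
  show "(\<integral>\<^sup>+\<theta>. ennreal (norm (g (of_real (R n) * cis \<theta>)) powr p) \<partial>circ) \<le> ennreal (K powr p)" for n
    using K(2)[OF R_bounds(1,2), of n] by (simp add: pmean_def)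
qed measurable

lemma u_integrable: "integrable circ u"
proof (rule integrableI_bounded)
  have "(\<integral>\<^sup>+\<theta>. ennreal (norm (u \<theta>)) \<partial>circ) \<le> ennreal K"
    by (rule circ_L1_le_Lp[OF p _ norm_ge_zero less_imp_le[OF K(1)] u_Lp]) measurable
  then show "(\<integral>\<^sup>+\<theta>. ennreal (norm (u \<theta>)) \<partial>circ) < \<infinity>" by (auto intro: le_less_trans)
qed measurable

lemma diff_Lp:
  assumes [measurable]: "a \<in> borel_measurable borel" "b \<in> borel_measurable borel"
    and ab: "(\<integral>\<^sup>+\<theta>. ennreal (norm (a \<theta> :: complex) powr p) \<partial>circ) \<le> ennreal (K powr p)"
       "(\<integral>\<^sup>+\<theta>. ennreal (norm (b \<theta> :: complex) powr p) \<partial>circ) \<le> ennreal (K powr p)"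
  shows "(\<integral>\<^sup>+\<theta>. ennreal (norm (a \<theta> - b \<theta>) powr p) \<partial>circ) \<le> ennreal (2 powr p * (2 * K powr p))"
proof -
  have pt: "norm (a \<theta> - b \<theta>) powr p \<le> 2 powr p * (norm (a \<theta>) powr p + norm (b \<theta>) powr p)" for \<theta>
  proof -
    have "norm (a \<theta> - b \<theta>) powr p \<le> (norm (a \<theta>) + norm (b \<theta>)) powr p"
      using p by (intro powr_mono2 norm_triangle_ineq4) auto
    also have "\<dots> \<le> 2 powr p * (norm (a \<theta>) powr p + norm (b \<theta>) powr p)"
      using p by (intro powr_add_le) auto
    finally show ?thesis .
  qed
  have "(\<integral>\<^sup>+\<theta>. ennreal (norm (a \<theta> - b \<theta>) powr p) \<partial>circ) \<le> (\<integral>\<^sup>+\<theta>. ennreal (2 powr p) * (ennreal (norm (a \<theta>) powr p) + ennreal (norm (b \<theta>) powr p)) \<partial>circ)"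
    by (intro nn_integral_mono) (use pt in \<open>auto simp: ennreal_plus[symmetric] ennreal_mult'[symmetric] simp del: ennreal_plus intro!: ennreal_leI\<close>)
  also have "\<dots> = ennreal (2 powr p) * ((\<integral>\<^sup>+\<theta>. ennreal (norm (a \<theta>) powr p) \<partial>circ) + (\<integral>\<^sup>+\<theta>. ennreal (norm (b \<theta>) powr p) \<partial>circ))"
    by (simp add: nn_integral_cmult nn_integral_add)
  also have "\<dots> \<le> ennreal (2 powr p) * (ennreal (K powr p) + ennreal (K powr p))"
    by (intro mult_left_mono add_mono ab) auto
  also have "\<dots> = ennreal (2 powr p * (2 * K powr p))"
    by (simp add: ennreal_plus[symmetric] ennreal_mult'[symmetric] del: ennreal_plus)
  finally show ?thesis .
qed

text \<open>Cauchy's formula for \<open>g'\<close> with boundary values: it is true for the dilates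
  of \<open>g\<close>, and for fixed \<open>z\<close> the kernel is bounded, so L1 convergence of
  the dilates to \<open>u\<close> suffices. \<open>Vitali_Lp_L1\<close> provides it from the Lp
  bound and the radial limits.\<close>

lemma Cauchy_boundary:
  assumes z: "norm z < 1"
  shows "(LINT t|circ. u t * cis t / (cis t - z)\<^sup>2) = deriv g z"
proof -
  define k where "k t = cis t / (cis t - z)\<^sup>2" for t
  have nz: "cis t - z \<noteq> 0" for t using z by (metis eq_iff_diff_eq_0 less_irrefl norm_cis)
  have kc: "continuous_on UNIV k" unfolding k_def by (intro continuous_intros) (use nz in auto)
  then have [measurable]: "k \<in> borel_measurable borel" by (rule borel_measurable_continuous_onI)
  define B where "B = 1 / (1 - norm z)\<^sup>2"
  have B0: "B > 0" using z by (simp add: B_def)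
  have kB: "norm (k t) \<le> B" for t
  proof -
    have "1 - norm z \<le> norm (cis t - z)" using norm_triangle_ineq2[of "cis t" z] by simp
    then have "(1 - norm z)\<^sup>2 \<le> (norm (cis t - z))\<^sup>2" using z by (intro power_mono) auto
    then show ?thesis using z nz[of t] by (simp add: k_def B_def norm_divide norm_power frac_le)
  qed
  have eqn: "(LINT t|circ. g (of_real (R n) * cis t) * k t) = of_real (R n) * deriv g (of_real (R n) * z)" for n
  proof -
    have maps: "of_real (R n) * w \<in> ball 0 1" if "norm w \<le> 1" for w :: complex
    proof -
      have "R n * norm w \<le> R n * 1" using that R_bounds[of n] by (intro mult_left_mono) auto
      also have "\<dots> < 1" using R_bounds[of n] by simp
      finally show ?thesis using R_bounds[of n] by (simp add: norm_mult)
    qed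
    \<comment> \<open>The dilate is analytic across the unit circle, so Cauchy's formula may be used
      on the unit circle itself.\<close>
    define G where "G w = g (of_real (R n) * w)" for w
    have Gd: "(G has_field_derivative of_real (R n) * deriv g (of_real (R n) * w)) (at w)" if "norm w \<le> 1" for w :: complex
    proof -
      have "(g has_field_derivative deriv g (of_real (R n) * w)) (at (of_real (R n) * w))"
        by (rule holomorphic_derivI[OF hol open_ball maps[OF that]])
      moreover have "((\<lambda>w. of_real (R n) * w) has_field_derivative of_real (R n)) (at w)"
        by (auto intro!: derivative_eq_intros)
      ultimately have "((\<lambda>w. g (of_real (R n) * w)) has_field_derivative deriv g (of_real (R n) * w) * of_real (R n)) (at w)"
        by (rule DERIV_chain2)
      then show ?thesis by (simp add: G_def[abs_def] mult.commute)
    qed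
    have "(LINT t|circ. G (0 + of_real 1 * cis t) * (of_real 1 * cis t) / (0 + of_real 1 * cis t - z) ^ Suc 1) = (deriv ^^ 1) G z / fact 1"
    proof (rule circ_Cauchy_formula)
      show "continuous_on (cball 0 1) G" 
        using Gd by (intro continuous_at_imp_continuous_on ballI DERIV_isCont) auto
      show "G holomorphic_on ball 0 1" 
      proof (rule holomorphic_onI)
        fix x :: complex assume "x \<in> ball 0 1"
        then have "(G has_field_derivative of_real (R n) * deriv g (of_real (R n) * x)) (at x)" by (intro Gd) simp
        then show "G field_differentiable at x within ball 0 1"
          unfolding field_differentiable_def by (blast intro: has_field_derivative_at_within)
      qed
    qed (use z in auto)
    moreover have "deriv G z = of_real (R n) * deriv g (of_real (R n) * z)"
      using Gd[of z] z by (intro DERIV_imp_deriv) auto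
    ultimately show ?thesis by (simp add: G_def k_def power2_eq_square)
  qed
  have gi: "integrable circ (\<lambda>t. g (of_real (R n) * cis t))" for n
  proof (rule integrableI_bounded)
    have "(\<integral>\<^sup>+\<theta>. ennreal (norm (g (of_real (R n) * cis \<theta>))) \<partial>circ) \<le> ennreal K"
      by (rule circ_L1_le_Lp[OF p _ norm_ge_zero less_imp_le[OF K(1)] K(2)[OF R_bounds(1,2), of n, unfolded pmean_def]]) measurable
    then show "(\<integral>\<^sup>+\<theta>. ennreal (norm (g (of_real (R n) * cis \<theta>))) \<partial>circ) < \<infinity>" by (auto intro: le_less_trans)
  qed measurable
  have ki: "integrable circ (\<lambda>t. f t * k t)" if "integrable circ f" for f
    using that kB by (intro integrable_mult_bounded) auto
  have "(\<lambda>n. (LINT t|circ. g (of_real (R n) * cis t) * k t)) \<longlonglongrightarrow> (LINT t|circ. u t * k t)"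
  proof (rule LIM_zero_cancel, rule Lim_null_comparison[OF always_eventually])
    have "(\<lambda>n. \<integral>\<^sup>+t. ennreal (norm (g (of_real (R n) * cis t) - u t)) \<partial>circ) \<longlonglongrightarrow> 0"
    proof (rule Vitali_Lp_L1[OF p])
      show "AE t in circ. (\<lambda>n. norm (g (of_real (R n) * cis t) - u t)) \<longlonglongrightarrow> 0"
        using gR_lim by eventually_elim (intro tendsto_norm_zero LIM_zero)
      show "(\<integral>\<^sup>+t. ennreal (norm (g (of_real (R n) * cis t) - u t) powr p) \<partial>circ) \<le> ennreal (2 powr p * (2 * K powr p))" for n
        by (rule diff_Lp[OF gR_measurable u_measurable K(2)[OF R_bounds(1,2), of n, unfolded pmean_def] u_Lp])
    qed auto
    then have "(\<lambda>n. enn2real (\<integral>\<^sup>+t. ennreal (norm (g (of_real (R n) * cis t) - u t)) \<partial>circ)) \<longlonglongrightarrow> enn2real 0"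
      by (intro tendsto_enn2real) auto
    then have "(\<lambda>n. B * (LINT t|circ. norm (g (of_real (R n) * cis t) - u t))) \<longlonglongrightarrow> B * 0"
      by (intro tendsto_mult tendsto_const) (simp add: integral_eq_nn_integral)
    then show "(\<lambda>n. B * (LINT t|circ. norm (g (of_real (R n) * cis t) - u t))) \<longlonglongrightarrow> 0" by simp
    show "\<forall>n. norm ((LINT t|circ. g (of_real (R n) * cis t) * k t) - (LINT t|circ. u t * k t)) \<le> B * (LINT t|circ. norm (g (of_real (R n) * cis t) - u t))"
    proof
      fix n
      have "(LINT t|circ. g (of_real (R n) * cis t) * k t) - (LINT t|circ. u t * k t) = (LINT t|circ. g (of_real (R n) * cis t) * k t - u t * k t)"
        using gi u_integrable ki by (intro Bochner_Integration.integral_diff[symmetric]) auto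
      also have "norm \<dots> \<le> (LINT t|circ. norm (g (of_real (R n) * cis t) * k t - u t * k t))"
        by (rule integral_norm_bound)
      also have "\<dots> \<le> (LINT t|circ. B * norm (g (of_real (R n) * cis t) - u t))"
      proof (rule integral_mono)
        show "integrable circ (\<lambda>t. norm (g (of_real (R n) * cis t) * k t - u t * k t))"
          using gi u_integrable ki by (intro integrable_norm Bochner_Integration.integrable_diff) auto
        show "integrable circ (\<lambda>t. B * norm (g (of_real (R n) * cis t) - u t))"
          using gi u_integrable by (intro integrable_mult_right integrable_norm Bochner_Integration.integrable_diff) auto
        show "norm (g (of_real (R n) * cis t) * k t - u t * k t) \<le> B * norm (g (of_real (R n) * cis t) - u t)" for t
          using mult_right_mono[OF kB[of t], of "norm (g (of_real (R n) * cis t) - u t)"]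
          by (simp only: left_diff_distrib[symmetric] norm_mult) (simp add: mult.commute)
      qed
      finally show "norm ((LINT t|circ. g (of_real (R n) * cis t) * k t) - (LINT t|circ. u t * k t)) \<le> B * (LINT t|circ. norm (g (of_real (R n) * cis t) - u t))"
        by simp
    qed
  qed
  moreover have "(\<lambda>n. of_real (R n) * deriv g (of_real (R n) * z)) \<longlonglongrightarrow> of_real 1 * deriv g (of_real 1 * z)"
  proof (intro tendsto_intros R_lim)
    have "isCont (deriv g) (of_real 1 * z)"
      using z holomorphic_on_imp_continuous_on[OF holomorphic_deriv_disc[OF hol]] by (simp add: continuous_on_eq_continuous_at)
    then show "(\<lambda>n. deriv g (of_real (R n) * z)) \<longlonglongrightarrow> deriv g (of_real 1 * z)"
      by (rule isCont_tendsto_compose) (intro tendsto_intros R_lim)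
  qed
  ultimately have "(LINT t|circ. u t * k t) = deriv g z" unfolding eqn using LIMSEQ_unique by fastforce
  then show ?thesis by (simp add: k_def)
qed

text \<open>The kernel has mean zero, being the one that differentiates, and the constant
  \<open>1\<close> has derivative 0. Hence \<open>u \<theta>\<close> may be subtracted, and this is
  how differences of boundary values enter.\<close>

lemma Cauchy_boundary_diff:
  assumes r: "0 \<le> r" "r < 1"
  shows "deriv g (of_real r * cis \<theta>) = (LINT t|circ. (u (\<theta> + t) - u \<theta>) * (cis t / (cis t - of_real r)\<^sup>2)) / cis \<theta>"
proof -
  define k where "k t = cis t / (cis t - of_real r)\<^sup>2" for t
  have nz: "cis t - of_real r \<noteq> 0" for t
    using r by (metis abs_of_nonneg eq_iff_diff_eq_0 less_irrefl norm_cis norm_of_real)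
  have kc: "continuous_on UNIV k" unfolding k_def by (intro continuous_intros) (use nz in auto)
  then have [measurable]: "k \<in> borel_measurable borel" by (rule borel_measurable_continuous_onI)
  define B where "B = 1 / (1 - r)\<^sup>2"
  have kB: "norm (k t) \<le> B" for t
  proof -
    have "1 - r \<le> norm (cis t - of_real r)" using norm_triangle_ineq2[of "cis t" "of_real r"] r by simp
    then have "(1 - r)\<^sup>2 \<le> (norm (cis t - of_real r))\<^sup>2" using r by (intro power_mono) auto
    then show ?thesis using r nz[of t] by (simp add: k_def B_def norm_divide norm_power frac_le)
  qed
  have k0: "(LINT t|circ. k t) = 0"
  proof -
    have "(LINT t|circ. (\<lambda>_. 1) (0 + of_real 1 * cis t) * (of_real 1 * cis t) / (0 + of_real 1 * cis t - of_real r) ^ Suc 1) = (deriv ^^ 1) (\<lambda>_. 1) (of_real r :: complex) / fact 1"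
      using r by (intro circ_Cauchy_formula) auto
    then show ?thesis by (simp add: k_def power2_eq_square)
  qed
  have ui: "integrable circ (\<lambda>t. u (\<theta> + t))"
  proof (rule integrableI_bounded)
    have "(\<integral>\<^sup>+t. ennreal (norm (u (t + \<theta>))) \<partial>circ) = (\<integral>\<^sup>+t. ennreal (norm (u t)) \<partial>circ)"
      by (rule nn_integral_circ_rotate[of "\<lambda>t. ennreal (norm (u t))"]) auto
    also have "\<dots> < \<infinity>" using u_integrable by (simp add: integrable_iff_bounded)
    finally show "(\<integral>\<^sup>+t. ennreal (norm (u (\<theta> + t))) \<partial>circ) < \<infinity>" by (simp add: add.commute)
  qed measurable
  have ki: "integrable circ k"
    using kB by (intro circ.integrable_const_bound[of _ B]) auto
  have "deriv g (of_real r * cis \<theta>) = (LINT t|circ. u t * cis t / (cis t - of_real r * cis \<theta>)\<^sup>2)"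
    using r by (intro Cauchy_boundary[symmetric]) (simp add: norm_mult)
  also have "\<dots> = (LINT t|circ. u (t + \<theta>) * cis (t + \<theta>) / (cis (t + \<theta>) - of_real r * cis \<theta>)\<^sup>2)"
    by (rule integral_circ_rotate[symmetric, of "\<lambda>t. u t * cis t / (cis t - of_real r * cis \<theta>)\<^sup>2"]) auto
  also have "\<dots> = (LINT t|circ. u (\<theta> + t) * k t / cis \<theta>)"
  proof (intro Bochner_Integration.integral_cong refl)
    fix t
    have "cis (t + \<theta>) - of_real r * cis \<theta> = cis \<theta> * (cis t - of_real r)" by (simp add: cis_mult[symmetric] algebra_simps)
    then show "u (t + \<theta>) * cis (t + \<theta>) / (cis (t + \<theta>) - of_real r * cis \<theta>)\<^sup>2 = u (\<theta> + t) * k t / cis \<theta>"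
      by (simp add: k_def power_mult_distrib cis_mult[symmetric] add.commute power2_eq_square)
  qed
  also have "\<dots> = (LINT t|circ. u (\<theta> + t) * k t) / cis \<theta>" by simp
  also have "(LINT t|circ. u (\<theta> + t) * k t) = (LINT t|circ. u (\<theta> + t) * k t) - (LINT t|circ. u \<theta> * k t)"
    by (simp add: k0)
  also have "\<dots> = (LINT t|circ. u (\<theta> + t) * k t - u \<theta> * k t)"
    using ui ki kB by (intro Bochner_Integration.integral_diff[symmetric] integrable_mult_bounded) auto
  finally show ?thesis by (simp only: k_def left_diff_distrib)
qed
definition D :: "real \<Rightarrow> ennreal" where
  "D h = (\<integral>\<^sup>+\<theta>. ennreal (norm (u (\<theta> + h) - u \<theta>) powr p) \<partial>circ)"

lemma D_bounded: "D h \<le> ennreal (2 powr p * (2 * K powr p))"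
  unfolding D_def
proof (rule diff_Lp)
  have "(\<integral>\<^sup>+\<theta>. ennreal (norm (u (\<theta> + h)) powr p) \<partial>circ) = (\<integral>\<^sup>+\<theta>. ennreal (norm (u \<theta>) powr p) \<partial>circ)"
    by (rule nn_integral_circ_rotate[of "\<lambda>\<theta>. ennreal (norm (u \<theta>) powr p)"]) auto
  then show "(\<integral>\<^sup>+\<theta>. ennreal (norm (u (\<theta> + h)) powr p) \<partial>circ) \<le> ennreal (K powr p)" using u_Lp by simp
qed (use u_Lp in \<open>measurable\<close>)

text \<open>Translation by \<open>-h\<close> differs from translation by \<open>h\<close> by a
  rotation of the integrand. Angles close to \<open>2*pi\<close> therefore count as small.\<close>

lemma D_reflect: "D (2*pi - h) = D h"
proof -
  have "u (\<theta> + (2*pi - h)) = u (\<theta> - h)" for \<theta> using u_per[of "\<theta> - h"] by (simp add: algebra_simps)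
  then have "D (2*pi - h) = (\<integral>\<^sup>+\<theta>. ennreal (norm (u (\<theta> - h) - u \<theta>) powr p) \<partial>circ)" by (simp add: D_def)
  also have "\<dots> = (\<integral>\<^sup>+\<theta>. ennreal (norm (u ((\<theta> + h) - h) - u (\<theta> + h)) powr p) \<partial>circ)"
  proof (rule nn_integral_circ_rotate[symmetric, of "\<lambda>\<theta>. ennreal (norm (u (\<theta> - h) - u \<theta>) powr p)"])
    fix \<theta> show "ennreal (norm (u (\<theta> + 2*pi - h) - u (\<theta> + 2*pi)) powr p) = ennreal (norm (u (\<theta> - h) - u \<theta>) powr p)"
      using u_per[of "\<theta> - h"] u_per[of \<theta>] by (simp add: algebra_simps del: u_per)
  qed measurable
  finally show ?thesis by (simp add: D_def norm_minus_commute)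
qed

text \<open>The Landau hypothesis speaks about small \<open>h\<close> only. For
  \<open>h \<ge> d\<close> the trivial bound on \<open>D\<close> is enough, once the constant is
  enlarged by \<open>L powr (1/p) * d powr (-\<beta>)\<close>. The same trivial bound makes the real
  supremum in \<open>Lp_modulus\<close> a true upper bound.\<close>

lemma D_growth:
  assumes \<beta>: "\<beta> > 0" and O: "Lp_modulus p \<phi> \<in> O[at_right 0](\<lambda>t. t powr \<beta>)"
  obtains c where "c > 0" "\<And>h. h > 0 \<Longrightarrow> D h \<le> ennreal ((c * h powr \<beta>) powr p)"
proof -
  define L where "L = 2 powr p * (2 * K powr p)"
  have L: "L > 0" using K(1) by (simp add: L_def)
  obtain c where c: "c > 0" and ev: "\<forall>\<^sub>F t in at_right 0. norm (Lp_modulus p \<phi> t) \<le> c * norm (t powr \<beta>)"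
    using landau_o.bigE[OF O] by blast
  obtain d where d: "d > 0" and cd: "\<And>t. 0 < t \<Longrightarrow> t < d \<Longrightarrow> norm (Lp_modulus p \<phi> t) \<le> c * norm (t powr \<beta>)"
    using ev unfolding eventually_at_right_field by blast
  define M where "M h = (1 / (2 * pi) * (LINT \<theta>:{0..2 * pi}|lborel. norm (\<phi> (cis (\<theta> + h)) - \<phi> (cis \<theta>)) powr p)) powr (1 / p)" for h
  have M: "M h = enn2real (D h) powr (1/p)" for h
  proof -
    have "1 / (2 * pi) * (LINT \<theta>:{0..2 * pi}|lborel. norm (u (\<theta> + h) - u \<theta>) powr p) = enn2real (D h)"
      unfolding D_def by (rule circ_mean_eq) auto
    then show ?thesis by (simp add: M_def u_def)
  qed
  have Dfin: "D h = ennreal (enn2real (D h))" for h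
    using D_bounded[of h] by (auto simp: top_unique intro!: ennreal_enn2real[symmetric] intro: le_less_trans)
  have MP: "D h = ennreal (M h powr p)" for h
    using p by (subst Dfin) (simp add: M powr_powr)
  have Mle: "M h \<le> L powr (1/p)" for h
  proof -
    have "enn2real (D h) \<le> L" using D_bounded[of h] L by (intro enn2real_leI) (auto simp: L_def)
    then show ?thesis unfolding M using p by (intro powr_mono2) auto
  qed
  show thesis
  proof (rule that)
    show c0: "max c (L powr (1/p) * d powr (-\<beta>)) > 0" using c by simp
    fix h :: real assume h: "h > 0"
    have "M h \<le> max c (L powr (1/p) * d powr (-\<beta>)) * h powr \<beta>"
    proof (cases "h < d")
      case True
      have "M h \<le> (SUP h\<in>{0<..h}. M h)"
        using h Mle by (intro cSUP_upper bdd_aboveI[of _ "L powr (1/p)"]) auto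
      also have "\<dots> = Lp_modulus p \<phi> h" by (simp add: Lp_modulus_def M_def)
      also have "\<dots> \<le> c * h powr \<beta>" using cd[OF h True] by simp
      also have "\<dots> \<le> max c (L powr (1/p) * d powr (-\<beta>)) * h powr \<beta>" by (intro mult_right_mono) auto
      finally show ?thesis .
    next
      case False
      have "1 \<le> d powr (-\<beta>) * h powr \<beta>"
      proof -
        have "d powr \<beta> \<le> h powr \<beta>" using False d \<beta> by (intro powr_mono2) auto
        then show ?thesis using d by (simp add: powr_minus field_simps)
      qed
      then have "L powr (1/p) * 1 \<le> L powr (1/p) * (d powr (-\<beta>) * h powr \<beta>)" by (intro mult_left_mono) auto
      also have "\<dots> \<le> max c (L powr (1/p) * d powr (-\<beta>)) * h powr \<beta>"
        unfolding mult.assoc[symmetric] by (intro mult_right_mono) auto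
      finally show ?thesis using Mle[of h] by simp
    qed
    then have "M h powr p \<le> (max c (L powr (1/p) * d powr (-\<beta>)) * h powr \<beta>) powr p"
      using p by (intro powr_mono2) (auto simp: M)
    then show "D h \<le> ennreal ((max c (L powr (1/p) * d powr (-\<beta>)) * h powr \<beta>) powr p)"
      unfolding MP by (rule ennreal_leI)
  qed
qed

text \<open>Minkowski over the translation \<open>t\<close> in \<open>Cauchy_boundary_diff\<close>:
  with \<open>m\<close> the angular distance of \<open>t\<close> to 0, the difference has size
  \<open>m powr \<beta>\<close> and the kernel size \<open>(1 - r + m) powr (-2)\<close>. The power
  kernel estimate with exponents \<open>\<beta>\<close> and 2 leaves
  \<open>(1 - r) powr (\<beta> - 1)\<close>; it converges because
  \<open>\<beta> < 1\<close>.\<close>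

lemma deriv_growth:
  assumes \<beta>: "0 < \<beta>" "\<beta> < 1" and O: "Lp_modulus p \<phi> \<in> O[at_right 0](\<lambda>t. t powr \<beta>)"
  obtains C where "C > 0" "\<And>r. 0 \<le> r \<Longrightarrow> r < 1 \<Longrightarrow> pmean p (deriv g) r \<le> ennreal ((C * (1 - r) powr (\<beta>-1)) powr p)"
proof -
  obtain c where c: "c > 0" and cD: "\<And>h. h > 0 \<Longrightarrow> D h \<le> ennreal ((c * h powr \<beta>) powr p)"
    using D_growth[OF \<beta>(1) O] by blast
  obtain S where S: "S > 0" and SI: "\<And>d. d > 0 \<Longrightarrow> (\<integral>\<^sup>+x. ennreal (x powr \<beta> * (d + x) powr (-2)) * indicator {0<..} x \<partial>lborel) \<le> ennreal (S * d powr (\<beta> - 2 + 1))"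
    using nn_integral_powr_kernel[of \<beta> 2] \<beta> by auto
  define E where "E = c * (1 + pi)\<^sup>2"
  have E: "E > 0" using c unfolding E_def by (intro mult_pos_pos zero_less_power add_pos_pos) auto
  define m where "m t = min t (2*pi - t)" for t
  have [measurable]: "m \<in> borel_measurable borel" unfolding m_def by measurable
  show thesis
  proof (rule that)
    show "2 * E * S > 0" using E S by simp
    fix r :: real assume r: "0 \<le> r" "r < 1"
    \<comment> \<open>Minkowski's bound is demanded for every real \<open>t\<close>, while
      \<open>m t\<close> is a positive distance only inside the open period; the cut-off changes the
      integral on a null set of \<open>circ\<close>.\<close>
    define H where "H \<theta> t = indicator {0<..<2*pi} t *\<^sub>R ((u (\<theta> + t) - u \<theta>) * (cis t / (cis t - of_real r)\<^sup>2))" for \<theta> t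
    define N where "N t = indicator {0<..<2*pi} t * (E * (m t powr \<beta> * (1 - r + m t) powr (-2)))" for t
    have AEt: "AE t in circ. t \<in> {0<..<2*pi}"
    proof -
      have "AE t in lborel. t \<in> {0..2*pi} \<longrightarrow> t \<in> {0<..<2*pi}"
        using AE_lborel_singleton[of 0] AE_lborel_singleton[of "2*pi"] by eventually_elim auto
      then show ?thesis unfolding circ_def by (intro AE_uniform_measureI) auto
    qed
    have m0: "m t > 0" if "t \<in> {0<..<2*pi}" for t using that by (auto simp: m_def)
    have HM [measurable]: "(\<lambda>(\<theta>, t). H \<theta> t) \<in> borel_measurable (circ \<Otimes>\<^sub>M circ)" unfolding H_def by measurable
    have repr: "norm (deriv g (of_real r * cis \<theta>)) = norm (LINT t|circ. H \<theta> t)" for \<theta>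
    proof -
      have "(LINT t|circ. (u (\<theta> + t) - u \<theta>) * (cis t / (cis t - of_real r)\<^sup>2)) = (LINT t|circ. H \<theta> t)"
        by (rule integral_cong_AE) (use AEt in \<open>auto simp: H_def elim: eventually_mono\<close>)
      then show ?thesis using Cauchy_boundary_diff[OF r, of \<theta>] by (simp add: norm_divide)
    qed
    have "(\<integral>\<^sup>+\<theta>. ennreal (norm (LINT t|circ. H \<theta> t) powr p) \<partial>circ) \<le> ennreal ((2 * E * S * (1 - r) powr (\<beta>-1)) powr p)"
    proof (rule Minkowski_integral_bound[where N=N])
      show "N \<in> borel_measurable circ" unfolding N_def[abs_def] by measurable
      show "N t \<ge> 0" for t using E by (simp add: N_def)
      show "H \<theta> t = 0" if "N t = 0" for \<theta> t
        using that E m0[of t] r by (auto simp: N_def H_def indicator_def split: if_splits)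
      show "(\<integral>\<^sup>+t. ennreal (N t) \<partial>circ) \<le> ennreal (2 * E * S * (1 - r) powr (\<beta>-1))"
      proof -
        define k where "k t = ennreal (t powr \<beta> * (1 - r + t) powr (-2)) * indicator {0<..} t" for t
        have [measurable]: "k \<in> borel_measurable borel" unfolding k_def by measurable
        have kI: "(\<integral>\<^sup>+t. k t \<partial>lborel) \<le> ennreal (S * (1 - r) powr (\<beta>-1))"
          unfolding k_def using SI[of "1 - r"] r by simp
        have "(\<integral>\<^sup>+t. ennreal (N t) \<partial>circ) = ennreal (1/(2*pi)) * (\<integral>\<^sup>+t. ennreal (N t) * indicator {0..2*pi} t \<partial>lborel)"
          by (rule nn_integral_circ) (simp add: N_def)
        \<comment> \<open>The normalising factor is bounded by 1. Since \<open>m t\<close> is one of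
          \<open>t\<close> and \<open>2*pi - t\<close>, the kernel is at most the sum of two
          one-sided kernels, each extended to the half-line.\<close>
        also have "\<dots> \<le> 1 * (\<integral>\<^sup>+t. ennreal E * (k t + k (2*pi - t)) \<partial>lborel)"
        proof (rule mult_mono[OF _ nn_integral_mono])
          have "1/(2*pi) \<le> 1" using pi_gt3 by simp
          then show "ennreal (1/(2*pi)) \<le> 1" using ennreal_leI by fastforce
          fix t :: real
          show "ennreal (N t) * indicator {0..2*pi} t \<le> ennreal E * (k t + k (2*pi - t))"
          proof (cases "t \<in> {0<..<2*pi}")
            case True
            then have "ennreal (N t) = ennreal E * k (m t)"
              using E m0[OF True] by (simp add: N_def k_def ennreal_mult')
            also have "\<dots> \<le> ennreal E * (k t + k (2*pi - t))"
              by (intro mult_left_mono) (auto simp: m_def min_def)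
            finally show ?thesis using True by simp
          qed (simp add: N_def)
        qed auto
        also have "\<dots> = ennreal E * ((\<integral>\<^sup>+t. k t \<partial>lborel) + (\<integral>\<^sup>+t. k (2*pi - t) \<partial>lborel))"
          by (simp add: nn_integral_cmult nn_integral_add)
        also have "(\<integral>\<^sup>+t. k (2*pi - t) \<partial>lborel) = (\<integral>\<^sup>+t. k t \<partial>lborel)" by (rule nn_integral_reflect) measurable
        also have "ennreal E * ((\<integral>\<^sup>+t. k t \<partial>lborel) + (\<integral>\<^sup>+t. k t \<partial>lborel)) \<le> ennreal E * (ennreal (S * (1 - r) powr (\<beta>-1)) + ennreal (S * (1 - r) powr (\<beta>-1)))"
          by (intro mult_left_mono add_mono kI) auto
        also have "\<dots> = ennreal (2 * E * S * (1 - r) powr (\<beta>-1))"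
          using E S by (simp add: ennreal_plus[symmetric] ennreal_mult'[symmetric] del: ennreal_plus)
        finally show ?thesis .
      qed
      show "(\<integral>\<^sup>+\<theta>. ennreal (norm (H \<theta> t) powr p) \<partial>circ) \<le> ennreal (N t powr p)" for t
      proof (cases "t \<in> {0<..<2*pi}")
        case True
        define b where "b = norm (cis t / (cis t - of_real r)\<^sup>2)"
        have Dm: "D t = D (m t)" using D_reflect[of t] by (simp add: m_def min_def)
        have b: "b \<le> (1 + pi)\<^sup>2 * (1 - r + m t) powr (-2)"
        proof -
          have pos: "0 < (1 - r + m t) / (1 + pi)" using r m0[OF True] pi_gt_zero by (intro divide_pos_pos add_pos_pos) auto
          have "((1 - r + m t) / (1 + pi))\<^sup>2 \<le> (norm (cis t - of_real r))\<^sup>2"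
            using norm_cis_minus_ge[of t r] True r pos by (intro power_mono) (auto simp: m_def)
          moreover have "0 < ((1 - r + m t) / (1 + pi))\<^sup>2" using pos by (rule zero_less_power)
          ultimately have "b \<le> 1 / ((1 - r + m t) / (1 + pi))\<^sup>2"
            unfolding b_def norm_divide norm_power norm_cis by (intro frac_le) auto
          also have "\<dots> = (1 + pi)\<^sup>2 * (1 - r + m t) powr (-2)"
            using r m0[OF True] by (simp add: power_divide powr_minus powr_numeral field_simps)
          finally show ?thesis .
        qed
        have "norm (H \<theta> t) powr p = b powr p * norm (u (\<theta> + t) - u \<theta>) powr p" for \<theta>
          using True by (simp add: H_def b_def norm_mult norm_divide powr_mult mult.commute powr_divide)
        then have "(\<integral>\<^sup>+\<theta>. ennreal (norm (H \<theta> t) powr p) \<partial>circ) = ennreal (b powr p) * D t"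
          by (simp add: D_def ennreal_mult' nn_integral_cmult)
        also have "\<dots> \<le> ennreal (((1 + pi)\<^sup>2 * (1 - r + m t) powr (-2)) powr p) * ennreal ((c * m t powr \<beta>) powr p)"
          unfolding Dm using p b m0[OF True] by (intro mult_mono cD ennreal_leI powr_mono2) (auto simp: b_def)
        also have "\<dots> = ennreal (((1 + pi)\<^sup>2 * (1 - r + m t) powr (-2) * (c * m t powr \<beta>)) powr p)"
          using c by (simp add: ennreal_mult'[symmetric] powr_mult[symmetric])
        also have "(1 + pi)\<^sup>2 * (1 - r + m t) powr (-2) * (c * m t powr \<beta>) = N t"
          using True by (simp add: N_def E_def mult_ac)
        finally show ?thesis .
      qed (simp add: H_def)
    qed (use E S r p circ.sigma_finite_measure_axioms in auto)
    then show "pmean p (deriv g) r \<le> ennreal ((2 * E * S * (1 - r) powr (\<beta>-1)) powr p)"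
      by (simp add: pmean_def repr)
  qed
qed
end

lemma mean_lipschitz_deriv_growth:
  assumes p: "p > 1" and \<beta>: "0 < \<beta>" "\<beta> < 1" and g: "g \<in> mean_lipschitz p \<beta>"
  obtains C where "C > 0" "\<And>r. 0 \<le> r \<Longrightarrow> r < 1 \<Longrightarrow> pmean p (deriv g) r \<le> ennreal ((C * (1 - r) powr (\<beta>-1)) powr p)"
proof -
  have gh: "g \<in> hardy_space p" and "\<exists>\<phi>. is_boundary_function g \<phi> \<and> Lp_modulus p \<phi> \<in> O[at_right 0](\<lambda>t. t powr \<beta>)"
    using g by (auto simp: mean_lipschitz_def)
  then obtain \<phi> where \<phi>: "is_boundary_function g \<phi>" "Lp_modulus p \<phi> \<in> O[at_right 0](\<lambda>t. t powr \<beta>)" by blast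
  obtain K where K: "K > 0" "\<And>r. 0 < r \<Longrightarrow> r < 1 \<Longrightarrow> pmean p g r \<le> ennreal (K powr p)"
    by (rule hardy_pmean_bound[OF gh]) (use p in auto)
  interpret boundary p g \<phi> K
    by standard (use p gh \<phi> K in \<open>auto simp: hardy_space_def\<close>)
  show thesis using deriv_growth[OF \<beta> \<phi>(2)] that by blast
qed

section \<open>The generalized Hilbert operator\<close>

lemma gen_hilbert_eq:
  assumes z: "norm z < 1"
  shows "gen_hilbert g f z = (LINT t|lborel. (indicator {0..<1} t *\<^sub>R f (of_real t)) * (indicator {0..<1} t *\<^sub>R disc_ext (deriv g) (of_real t * z)))"
proof -
  have "norm (of_real t * z) < 1" if "t \<in> {0..<1}" for t
  proof -
    have "t * norm z \<le> 1 * norm z" using that by (intro mult_right_mono) auto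
    then show ?thesis using that z by (simp add: norm_mult)
  qed
  then show ?thesis unfolding gen_hilbert_def set_lebesgue_integral_def
    by (intro Bochner_Integration.integral_cong refl) (auto simp: indicator_def)
qed

text \<open>Dominated convergence along sequences of difference quotients. A radius
  \<open>\<rho>\<close> between \<open>|z|\<close> and 1 keeps all points \<open>t * w\<close> in
  one compact disc, where \<open>g''\<close> is bounded by \<open>B2\<close>; then
  \<open>|f| * B2\<close> dominates.\<close>

lemma gen_hilbert_has_derivative:
  assumes g: "g holomorphic_on ball 0 1" and f: "set_integrable lborel {0..<1} (\<lambda>t. f (complex_of_real t))"
    and z: "norm z < 1"
  shows "(gen_hilbert g f has_field_derivative (LINT t:{0..<1}|lborel. f (of_real t) * (of_real t * deriv (deriv g) (of_real t * z)))) (at z)"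
proof -
  note hol1 = holomorphic_deriv_disc[OF g]
  note hol2 = holomorphic_deriv_disc[OF hol1]
  note disc_ext_measurable[OF hol1, measurable] disc_ext_measurable[OF hol2, measurable]
  define I :: "real \<Rightarrow> real" where "I = indicator {0..<1}"
  define fe where "fe t = I t *\<^sub>R f (of_real t)" for t
  have fe: "integrable lborel fe" using f by (simp add: set_integrable_def fe_def[abs_def] I_def)
  note borel_measurable_integrable[OF fe, measurable]
  have [measurable]: "I \<in> borel_measurable borel" by (simp add: I_def)
  define h where "h w t = I t *\<^sub>R disc_ext (deriv g) (of_real t * w)" for w t
  obtain \<rho> where \<rho>: "norm z < \<rho>" "\<rho> < 1" using dense[OF z] by blast
  have sc: "of_real t * w \<in> cball 0 \<rho>" if "I t \<noteq> 0" "w \<in> ball 0 \<rho>" for t and w :: complex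
  proof -
    have t: "0 \<le> t" "t < 1" using that by (auto simp: I_def indicator_def split: if_splits)
    then have "t * norm w \<le> 1 * norm w" by (intro mult_right_mono) auto
    then show ?thesis using t that by (simp add: norm_mult)
  qed
  have sub: "cball 0 \<rho> \<subseteq> ball (0::complex) 1" using \<rho> by auto
  have bdd: "\<exists>B. \<forall>w\<in>cball 0 \<rho>. norm (F w) \<le> B" if "F holomorphic_on ball 0 1" for F :: "complex \<Rightarrow> complex"
  proof -
    have "compact (F ` cball 0 \<rho>)"
      by (intro compact_continuous_image holomorphic_on_imp_continuous_on holomorphic_on_subset[OF that sub]) auto
    then show ?thesis by (meson bounded_iff compact_imp_bounded imageI)
  qed
  obtain B1 where B1: "\<And>w. w \<in> cball 0 \<rho> \<Longrightarrow> norm (deriv g w) \<le> B1" using bdd[OF hol1] by blast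
  obtain B2 where B2: "\<And>w. w \<in> cball 0 \<rho> \<Longrightarrow> norm (deriv (deriv g) w) \<le> B2" using bdd[OF hol2] by blast
  have r0: "(0::complex) \<in> cball 0 \<rho>" using order_trans[OF norm_ge_zero less_imp_le[OF \<rho>(1)]] by simp
  note B10 = order_trans[OF norm_ge_zero B1[OF r0]] and B20 = order_trans[OF norm_ge_zero B2[OF r0]]
  have hb: "norm (h w t) \<le> B1" if "w \<in> ball 0 \<rho>" for w t
  proof (cases "I t = 0")
    case False
    then have "I t = 1" by (auto simp: I_def indicator_def)
    then show ?thesis using B1[OF sc[OF False that]] sc[OF False that] \<rho> by (simp add: h_def)
  qed (simp add: h_def B10)
  have hm [measurable]: "h w \<in> borel_measurable borel" for w unfolding h_def by measurable
  have int: "integrable lborel (\<lambda>t. fe t * h w t)" if "w \<in> ball 0 \<rho>" for w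
    using hb[OF that] by (intro integrable_mult_bounded[OF fe]) auto
  have Geq: "gen_hilbert g f w = (LINT t|lborel. fe t * h w t)" if "w \<in> ball 0 \<rho>" for w
    using that \<rho> by (subst gen_hilbert_eq) (auto simp: fe_def h_def I_def)
  define D where "D = (LINT t|lborel. fe t * (I t *\<^sub>R (of_real t * disc_ext (deriv (deriv g)) (of_real t * z))))"
  have "((\<lambda>y. (gen_hilbert g f y - gen_hilbert g f z) / (y - z)) \<longlongrightarrow> D) (at z within ball 0 \<rho>)"
    unfolding tendsto_at_iff_sequentially
  proof (intro allI impI)
    fix X :: "nat \<Rightarrow> complex" assume X: "\<forall>i. X i \<in> ball 0 \<rho> - {z}" and Xz: "X \<longlonglongrightarrow> z"
    have X1: "X i \<in> ball 0 \<rho>" "X i - z \<noteq> 0" for i using X by auto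
    have z1: "z \<in> ball 0 \<rho>" using \<rho> by simp
    have q: "(gen_hilbert g f (X i) - gen_hilbert g f z) / (X i - z) = (LINT t|lborel. fe t * ((h (X i) t - h z t) / (X i - z)))" for i
    proof -
      have "gen_hilbert g f (X i) - gen_hilbert g f z = (LINT t|lborel. fe t * h (X i) t - fe t * h z t)"
        unfolding Geq[OF X1(1)] Geq[OF z1] by (rule Bochner_Integration.integral_diff[symmetric, OF int[OF X1(1)] int[OF z1]])
      then have "(gen_hilbert g f (X i) - gen_hilbert g f z) / (X i - z) = (LINT t|lborel. (fe t * h (X i) t - fe t * h z t) / (X i - z))" by simp
      then show ?thesis by (simp only: right_diff_distrib[symmetric] times_divide_eq_right)
    qed
    have "(\<lambda>i. LINT t|lborel. fe t * ((h (X i) t - h z t) / (X i - z))) \<longlonglongrightarrow> D"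
      unfolding D_def
    proof (rule integral_dominated_convergence[where w="\<lambda>t. norm (fe t) * B2"])
      show "integrable lborel (\<lambda>t. norm (fe t) * B2)" using fe by (intro integrable_mult_left integrable_norm)
      show "AE t in lborel. (\<lambda>i. fe t * ((h (X i) t - h z t) / (X i - z))) \<longlonglongrightarrow> fe t * (I t *\<^sub>R (of_real t * disc_ext (deriv (deriv g)) (of_real t * z)))"
      proof (rule AE_I2)
        fix t
        show "(\<lambda>i. fe t * ((h (X i) t - h z t) / (X i - z))) \<longlonglongrightarrow> fe t * (I t *\<^sub>R (of_real t * disc_ext (deriv (deriv g)) (of_real t * z)))"
        proof (cases "I t = 0")
          case False
          then have It: "I t = 1" by (auto simp: I_def indicator_def)
          have tz: "norm (of_real t * z) < 1" using sc[OF False z1] \<rho> by simp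
          have hX: "h w t = deriv g (of_real t * w)" if "w \<in> ball 0 \<rho>" for w
            using sc[OF False that] \<rho> It by (simp add: h_def)
          have "(deriv g has_field_derivative deriv (deriv g) (of_real t * z)) (at (of_real t * z))"
            using tz by (intro holomorphic_derivI[OF hol1 open_ball]) auto
          moreover have "((\<lambda>w. of_real t * w) has_field_derivative of_real t) (at z)"
            by (auto intro!: derivative_eq_intros)
          ultimately have "((\<lambda>w. deriv g (of_real t * w)) has_field_derivative deriv (deriv g) (of_real t * z) * of_real t) (at z)"
            by (rule DERIV_chain2)
          then have "((\<lambda>w. (deriv g (of_real t * w) - deriv g (of_real t * z)) / (w - z)) \<longlongrightarrow> deriv (deriv g) (of_real t * z) * of_real t) (at z within UNIV)"
            by (simp add: has_field_derivative_iff)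
          then have "(\<lambda>i. (deriv g (of_real t * X i) - deriv g (of_real t * z)) / (X i - z)) \<longlonglongrightarrow> deriv (deriv g) (of_real t * z) * of_real t"
            unfolding tendsto_at_iff_sequentially o_def using X Xz by blast
          then have "(\<lambda>i. (h (X i) t - h z t) / (X i - z)) \<longlonglongrightarrow> I t *\<^sub>R (of_real t * disc_ext (deriv (deriv g)) (of_real t * z))"
            using tz by (simp add: hX[OF X1(1)] hX[OF z1] It mult.commute)
          then show ?thesis by (intro tendsto_mult tendsto_const)
        qed (simp add: h_def)
      qed
      show "AE t in lborel. norm (fe t * ((h (X i) t - h z t) / (X i - z))) \<le> norm (fe t) * B2" for i
      proof (rule AE_I2)
        fix t
        have "norm (h (X i) t - h z t) \<le> B2 * norm (X i - z)"
        proof (cases "I t = 0")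
          case False
          then have It: "I t = 1" by (auto simp: I_def indicator_def)
          have t01: "0 \<le> t" "t < 1" using False by (auto simp: I_def indicator_def split: if_splits)
          have hX: "h w t = deriv g (of_real t * w)" if "w \<in> ball 0 \<rho>" for w
            using sc[OF False that] \<rho> It by (simp add: h_def)
          have "norm (deriv g (of_real t * X i) - deriv g (of_real t * z)) \<le> B2 * norm (of_real t * X i - of_real t * z)"
          proof (rule field_differentiable_bound[of "cball 0 \<rho>" "deriv g" "deriv (deriv g)"])
            show "(deriv g has_field_derivative deriv (deriv g) w) (at w within cball 0 \<rho>)" if "w \<in> cball 0 \<rho>" for w
              using that sub by (intro has_field_derivative_at_within[OF holomorphic_derivI[OF hol1 open_ball]]) auto
          qed (use B2 sc[OF False X1(1)] sc[OF False z1] in auto)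
          also have "norm (of_real t * X i - of_real t * z) = t * norm (X i - z)"
            using t01 by (simp add: right_diff_distrib[symmetric] norm_mult)
          also have "B2 * (t * norm (X i - z)) \<le> B2 * (1 * norm (X i - z))"
            using t01 B20 by (intro mult_left_mono mult_right_mono) auto
          finally show ?thesis by (simp add: hX[OF X1(1)] hX[OF z1])
        next
          case True
          then show ?thesis using B20 by (simp add: h_def)
        qed
        then have "norm ((h (X i) t - h z t) / (X i - z)) \<le> B2"
          using X1(2)[of i] by (simp add: norm_divide divide_le_eq)
        then show "norm (fe t * ((h (X i) t - h z t) / (X i - z))) \<le> norm (fe t) * B2"
          unfolding norm_mult by (intro mult_left_mono) auto
      qed
    qed measurable
    then show "((\<lambda>y. (gen_hilbert g f y - gen_hilbert g f z) / (y - z)) \<circ> X) \<longlonglongrightarrow> D"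
      by (simp add: o_def q)
  qed
  then have "(gen_hilbert g f has_field_derivative D) (at z within ball 0 \<rho>)" by (simp add: has_field_derivative_iff)
  then have "(gen_hilbert g f has_field_derivative D) (at z)" using \<rho> by (simp add: at_within_open[OF _ open_ball])
  also have "D = (LINT t:{0..<1}|lborel. f (of_real t) * (of_real t * deriv (deriv g) (of_real t * z)))"
    unfolding D_def set_lebesgue_integral_def
  proof (intro Bochner_Integration.integral_cong refl)
    fix t
    show "fe t * (I t *\<^sub>R (of_real t * disc_ext (deriv (deriv g)) (of_real t * z))) = indicat_real {0..<1} t *\<^sub>R (f (of_real t) * (of_real t * deriv (deriv g) (of_real t * z)))"
    proof (cases "I t = 0")
      case False
      then have "I t = 1" by (auto simp: I_def indicator_def)
      moreover have "norm (of_real t * z) < 1" using sc[OF False, of z] \<rho> by simp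
      ultimately show ?thesis by (simp add: fe_def I_def)
    qed (auto simp: I_def)
  qed
  finally show ?thesis .
qed

lemma gen_hilbert_holomorphic:
  assumes g: "g holomorphic_on ball 0 1" and f: "set_integrable lborel {0..<1} (\<lambda>t. f (complex_of_real t))"
  shows "gen_hilbert g f holomorphic_on ball 0 1"
proof (rule holomorphic_onI)
  fix z :: complex assume "z \<in> ball 0 1"
  then have "gen_hilbert g f field_differentiable at z"
    unfolding field_differentiable_def using gen_hilbert_has_derivative[OF g f, of z] by auto
  then show "gen_hilbert g f field_differentiable at z within ball 0 1" by (rule field_differentiable_at_within)
qed

lemma gen_hilbert_deriv:
  assumes "g holomorphic_on ball 0 1" and "set_integrable lborel {0..<1} (\<lambda>t. f (complex_of_real t))" and "norm z < 1"
  shows "deriv (gen_hilbert g f) z = (LINT t:{0..<1}|lborel. f (of_real t) * (of_real t * deriv (deriv g) (of_real t * z)))"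
  by (rule DERIV_imp_deriv[OF gen_hilbert_has_derivative[OF assms]])

lemma gen_hilbert_0: "gen_hilbert g f 0 = (LINT t:{0..<1}|lborel. f (of_real t)) * deriv g 0"
  by (simp add: gen_hilbert_def)

lemma set_integrable_half_open:
  fixes f :: "real \<Rightarrow> complex"
  assumes "continuous_on {0..1} f"
  shows "set_integrable lborel {0..<1} f"
  by (rule set_integrable_subset[OF borel_integrable_atLeastAtMost'[OF assms]]) auto

lemma set_integral_half_open:
  fixes f :: "real \<Rightarrow> complex"
  assumes f: "continuous_on {0..1} f"
  shows "(LINT t:{0..<1}|lborel. f t) = (LINT t:{0..1}|lborel. f t)"
  unfolding set_lebesgue_integral_def
proof (rule integral_cong_AE)
  show "(\<lambda>x. indicat_real {0..<1} x *\<^sub>R f x) \<in> borel_measurable lborel"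
    using borel_measurable_integrable[OF set_integrable_half_open[OF f, unfolded set_integrable_def]] .
  show "(\<lambda>x. indicat_real {0..1} x *\<^sub>R f x) \<in> borel_measurable lborel"
    using borel_measurable_integrable[OF borel_integrable_atLeastAtMost'[OF f, unfolded set_integrable_def]] .
  show "AE x in lborel. indicat_real {0..<1} x *\<^sub>R f x = indicat_real {0..1} x *\<^sub>R f x"
    using AE_lborel_singleton[of 1] by eventually_elim (auto simp: indicator_def)
qed

text \<open>The primitive is \<open>t * f t * deriv g (t * z)\<close>, which vanishes at 0 and is
  the left-hand side at 1. The boundary term is why \<open>f\<close> has to be analytic near the
  whole closed segment, including the point 1 on the circle.\<close>

lemma gen_hilbert_parts:
  assumes g: "g holomorphic_on ball 0 1" and f: "f holomorphic_on S" "open S" "\<And>t. t \<in> {0..1} \<Longrightarrow> complex_of_real t \<in> S"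
    and z: "norm z < 1"
  shows "f 1 * deriv g z = gen_hilbert g (\<lambda>w. f w + w * deriv f w) z + z * deriv (gen_hilbert g f) z"
proof -
  note hol1 = holomorphic_deriv_disc[OF g]
  note hol2 = holomorphic_deriv_disc[OF hol1]
  have f': "deriv f holomorphic_on S" using f by (intro holomorphic_deriv)
  have tz: "of_real t * z \<in> ball 0 1" if "t \<in> {0..1}" for t
  proof -
    have "t * norm z \<le> 1 * norm z" using that by (intro mult_right_mono) auto
    then show ?thesis using that z by (simp add: norm_mult)
  qed
  have c1: "continuous_on {0..1} (\<lambda>t. F (complex_of_real t))" if "F holomorphic_on S" for F
    using f by (intro continuous_on_compose2[OF holomorphic_on_imp_continuous_on[OF that]] continuous_intros) auto
  have c2: "continuous_on {0..1} (\<lambda>t. F (of_real t * z))" if "F holomorphic_on ball 0 1" for F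
    using tz by (intro continuous_on_compose2[OF holomorphic_on_imp_continuous_on[OF that]] continuous_intros) auto
  define a where "a t = (f (of_real t) + of_real t * deriv f (of_real t)) * deriv g (of_real t * z)" for t
  define b where "b t = f (of_real t) * (of_real t * deriv (deriv g) (of_real t * z))" for t
  have ca: "continuous_on {0..1} a" unfolding a_def by (intro continuous_intros c1 c2 f f' hol1)
  have cb: "continuous_on {0..1} b" unfolding b_def by (intro continuous_intros c1 c2 f f' hol2)
  have "(LINT t|lborel. indicator {0..1} t *\<^sub>R (a t + z * b t)) = of_real 1 * f (of_real 1) * deriv g (of_real 1 * z) - of_real 0 * f (of_real 0) * deriv g (of_real 0 * z)"
  proof (rule integral_FTC_Icc)
    fix x :: real assume x: "0 \<le> x" "x \<le> 1"
    have 3: "((\<lambda>t. of_real t) has_vector_derivative (1::complex)) (at x within {0..1})"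
      by (auto intro!: derivative_eq_intros)
    have "(f has_field_derivative deriv f (of_real x)) (at (of_real x))"
      using x f(3)[of x] by (intro holomorphic_derivI[OF f(1,2)]) auto
    from field_vector_diff_chain_within[OF 3 has_field_derivative_at_within[OF this]]
    have 1: "((\<lambda>t. f (of_real t)) has_vector_derivative 1 * deriv f (of_real x)) (at x within {0..1})"
      by (simp only: o_def)
    have "(deriv g has_field_derivative deriv (deriv g) (of_real x * z)) (at (of_real x * z))"
      using x tz[of x] by (intro holomorphic_derivI[OF hol1 open_ball]) auto
    moreover have "((\<lambda>t. of_real t * z) has_vector_derivative z) (at x within {0..1})"
      by (auto intro!: derivative_eq_intros)
    ultimately have 2: "((\<lambda>t. deriv g (of_real t * z)) has_vector_derivative z * deriv (deriv g) (of_real x * z)) (at x within {0..1})"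
      using field_vector_diff_chain_within[of "\<lambda>t. of_real t * z" z x "{0..1}" "deriv g", OF _ has_field_derivative_at_within]
      by (simp only: o_def)
    show "((\<lambda>t. of_real t * f (of_real t) * deriv g (of_real t * z)) has_vector_derivative (a x + z * b x)) (at x within {0..1})"
      by (rule has_vector_derivative_eq_rhs[OF has_vector_derivative_mult[OF has_vector_derivative_mult[OF 3 1] 2]])
         (simp add: a_def b_def algebra_simps)
  qed (use ca cb in \<open>auto intro!: continuous_intros\<close>)
  then have "f 1 * deriv g z = (LINT t:{0..1}|lborel. a t + z * b t)" by (simp add: set_lebesgue_integral_def)
  also have "\<dots> = (LINT t:{0..1}|lborel. a t) + (LINT t:{0..1}|lborel. z * b t)"
    by (intro set_integral_add borel_integrable_atLeastAtMost' continuous_intros ca cb)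
  also have "\<dots> = (LINT t:{0..<1}|lborel. a t) + z * (LINT t:{0..<1}|lborel. b t)"
    using ca cb by (simp add: set_integral_half_open)
  also have "(LINT t:{0..<1}|lborel. b t) = deriv (gen_hilbert g f) z"
    unfolding b_def using f by (intro gen_hilbert_deriv[symmetric] g set_integrable_half_open c1 z)
  finally show ?thesis by (simp add: a_def gen_hilbert_def)
qed

section \<open>Dirichlet type spaces\<close>

text \<open>The Bergman integral without the root and without the factor
  \<open>(\<alpha> + 1) / pi\<close>; membership in the Dirichlet space becomes finiteness.\<close>

definition energy :: "real \<Rightarrow> real \<Rightarrow> (complex \<Rightarrow> complex) \<Rightarrow> ennreal" where
  "energy p \<alpha> F = (\<integral>\<^sup>+z. ennreal (norm (disc_ext F z) powr p * (1 - (norm z)\<^sup>2) powr \<alpha>) * indicator (ball 0 1) z \<partial>lborel)"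

lemma dirichlet_integrand:
  "indicator (ball 0 1) z *\<^sub>R (norm (F z) powr p * (1 - (norm z)\<^sup>2) powr \<alpha>)
   = indicator (ball 0 1) z *\<^sub>R (norm (disc_ext F z) powr p * (1 - (norm z)\<^sup>2) powr \<alpha>)"
  by (auto simp: indicator_def)

lemma bergman_weighted_integrable_iff:
  assumes F: "F holomorphic_on ball 0 1"
  shows "bergman_weighted_integrable p \<alpha> F \<longleftrightarrow> energy p \<alpha> F < \<infinity>"
proof -
  note disc_ext_measurable[OF F, measurable]
  have "(\<integral>\<^sup>+z. ennreal (norm (indicator (ball 0 1) z *\<^sub>R (norm (disc_ext F z) powr p * (1 - (norm z)\<^sup>2) powr \<alpha>))) \<partial>lborel) = energy p \<alpha> F"
    unfolding energy_def by (intro nn_integral_cong) (auto simp: indicator_def)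
  then show ?thesis
    unfolding bergman_weighted_integrable_def set_integrable_def dirichlet_integrand[where F=F] integrable_iff_bounded by simp
qed

lemma dirichlet_space_iff:
  "f \<in> dirichlet_space p \<alpha> \<longleftrightarrow> f holomorphic_on ball 0 1 \<and> energy p \<alpha> (deriv f) < \<infinity>"
  unfolding dirichlet_space_def using bergman_weighted_integrable_iff holomorphic_deriv_disc by blast

lemma bergman_integral_eq:
  assumes F: "F holomorphic_on ball 0 1"
  shows "(LINT z:ball 0 1|lborel. norm (F z) powr p * (1 - (norm z)\<^sup>2) powr \<alpha>) = enn2real (energy p \<alpha> F)"
proof -
  note disc_ext_measurable[OF F, measurable]
  have "(LINT z:ball 0 1|lborel. norm (F z) powr p * (1 - (norm z)\<^sup>2) powr \<alpha>) 
     = enn2real (\<integral>\<^sup>+z. ennreal (indicator (ball 0 1) z *\<^sub>R (norm (disc_ext F z) powr p * (1 - (norm z)\<^sup>2) powr \<alpha>)) \<partial>lborel)"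
    unfolding set_lebesgue_integral_def dirichlet_integrand[where F=F] by (rule integral_eq_nn_integral) auto
  also have "(\<integral>\<^sup>+z. ennreal (indicator (ball 0 1) z *\<^sub>R (norm (disc_ext F z) powr p * (1 - (norm z)\<^sup>2) powr \<alpha>)) \<partial>lborel) = energy p \<alpha> F"
    unfolding energy_def by (intro nn_integral_cong) (auto simp: indicator_def)
  finally show ?thesis .
qed

lemma dirichlet_norm_powr:
  assumes f: "f holomorphic_on ball 0 1" and p: "p > 0" and \<alpha>: "\<alpha> > -1"
  shows "dirichlet_norm p \<alpha> f powr p = norm (f 0) powr p + (\<alpha> + 1) / pi * enn2real (energy p \<alpha> (deriv f))"
proof -
  have "bergman_norm p \<alpha> (deriv f) powr p = (\<alpha> + 1) / pi * enn2real (energy p \<alpha> (deriv f))"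
    unfolding bergman_norm_def bergman_integral_eq[OF holomorphic_deriv_disc[OF f]]
    using p \<alpha> by (simp add: powr_powr)
  then show ?thesis using p \<alpha> by (simp add: dirichlet_norm_def powr_powr)
qed

lemma dirichlet_norm_nonneg: "dirichlet_norm p \<alpha> f \<ge> 0"
  by (simp add: dirichlet_norm_def)

lemma energy_polar:
  assumes F: "F holomorphic_on ball 0 1"
  shows "energy p \<alpha> F = (\<integral>\<^sup>+s. pmean p (disc_ext F) s * ennreal ((1 - s\<^sup>2) powr \<alpha> * (2 * pi * s)) * indicator {0<..<1} s \<partial>lborel)"
proof -
  note disc_ext_measurable[OF F, measurable]
  have "energy p \<alpha> F = (\<integral>\<^sup>+s. (\<integral>\<^sup>+\<theta>. ennreal (norm (disc_ext F (of_real s * cis \<theta>)) powr p * (1 - (norm (of_real s * cis \<theta>))\<^sup>2) powr \<alpha>) \<partial>circ) * ennreal (2 * pi * s) * indicator {0<..<1} s \<partial>lborel)"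
    unfolding energy_def by (rule nn_integral_disc_polar) measurable
  also have "\<dots> = (\<integral>\<^sup>+s. pmean p (disc_ext F) s * ennreal ((1 - s\<^sup>2) powr \<alpha> * (2 * pi * s)) * indicator {0<..<1} s \<partial>lborel)"
  proof (rule nn_integral_cong)
    fix s :: real
    have "(\<integral>\<^sup>+\<theta>. ennreal (norm (disc_ext F (of_real s * cis \<theta>)) powr p * (1 - (norm (of_real s * cis \<theta>))\<^sup>2) powr \<alpha>) \<partial>circ)
       = pmean p (disc_ext F) s * ennreal ((1 - s\<^sup>2) powr \<alpha>)"
      unfolding pmean_def by (subst nn_integral_multc[symmetric]) (auto simp: ennreal_mult' norm_mult)
    then show "(\<integral>\<^sup>+\<theta>. ennreal (norm (disc_ext F (of_real s * cis \<theta>)) powr p * (1 - (norm (of_real s * cis \<theta>))\<^sup>2) powr \<alpha>) \<partial>circ) * ennreal (2 * pi * s) * indicator {0<..<1} s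
      = pmean p (disc_ext F) s * ennreal ((1 - s\<^sup>2) powr \<alpha> * (2 * pi * s)) * indicator {0<..<1} s"
      by (cases "s \<in> {0<..<1}") (auto simp: ennreal_mult' mult.assoc)
  qed
  finally show ?thesis .
qed

text \<open>The weights differ by the power \<alpha> of \<open>1 + s\<close>, which lies between 1
  and 2; the absolute value of \<alpha> treats both signs at once.\<close>

lemma weight_compare:
  fixes s \<alpha> :: real
  assumes s: "0 \<le> s" "s < 1"
  shows "(1 - s\<^sup>2) powr \<alpha> \<le> 2 powr \<bar>\<alpha>\<bar> * (1 - s) powr \<alpha>" and "(1 - s) powr \<alpha> \<le> 2 powr \<bar>\<alpha>\<bar> * (1 - s\<^sup>2) powr \<alpha>"
proof -
  have "1 - s\<^sup>2 = (1 - s) * (1 + s)" by (simp add: power2_eq_square algebra_simps)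
  then have e: "(1 - s\<^sup>2) powr \<alpha> = (1 - s) powr \<alpha> * (1 + s) powr \<alpha>"
    using s powr_mult[of "1 - s" "1 + s" \<alpha>] by simp
  have u: "(1 + s) powr \<alpha> \<le> 2 powr \<bar>\<alpha>\<bar>"
  proof -
    have "(1 + s) powr \<alpha> \<le> (1 + s) powr \<bar>\<alpha>\<bar>" using s by (intro powr_mono) auto
    also have "\<dots> \<le> 2 powr \<bar>\<alpha>\<bar>" using s by (intro powr_mono2) auto
    finally show ?thesis .
  qed
  have l: "1 \<le> 2 powr \<bar>\<alpha>\<bar> * (1 + s) powr \<alpha>"
  proof -
    have "(1 + s) powr (-\<alpha>) \<le> (1 + s) powr \<bar>\<alpha>\<bar>" using s by (intro powr_mono) auto
    also have "\<dots> \<le> 2 powr \<bar>\<alpha>\<bar>" using s by (intro powr_mono2) auto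
    finally have "(1 + s) powr (-\<alpha>) * (1 + s) powr \<alpha> \<le> 2 powr \<bar>\<alpha>\<bar> * (1 + s) powr \<alpha>" by (intro mult_right_mono) auto
    then show ?thesis using s by (simp add: powr_add[symmetric])
  qed
  show "(1 - s\<^sup>2) powr \<alpha> \<le> 2 powr \<bar>\<alpha>\<bar> * (1 - s) powr \<alpha>" unfolding e
    using mult_left_mono[OF u, of "(1 - s) powr \<alpha>"] by (simp add: mult.commute)
  show "(1 - s) powr \<alpha> \<le> 2 powr \<bar>\<alpha>\<bar> * (1 - s\<^sup>2) powr \<alpha>" unfolding e
    using mult_left_mono[OF l, of "(1 - s) powr \<alpha>"] by (simp add: mult_ac)
qed

lemma energy_le_pmean:
  assumes F: "F holomorphic_on ball 0 1"
  shows "energy p \<alpha> F \<le> ennreal (2 * pi * 2 powr \<bar>\<alpha>\<bar>) * (\<integral>\<^sup>+s. pmean p (disc_ext F) s * ennreal ((1 - s) powr \<alpha>) * indicator {0<..<1} s \<partial>lborel)"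
proof -
  note pmean_disc_measurable[OF F, measurable]
  have "energy p \<alpha> F \<le> (\<integral>\<^sup>+s. ennreal (2 * pi * 2 powr \<bar>\<alpha>\<bar>) * (pmean p (disc_ext F) s * ennreal ((1 - s) powr \<alpha>) * indicator {0<..<1} s) \<partial>lborel)"
    unfolding energy_polar[OF F]
  proof (rule nn_integral_mono)
    fix s :: real
    show "pmean p (disc_ext F) s * ennreal ((1 - s\<^sup>2) powr \<alpha> * (2 * pi * s)) * indicator {0<..<1} s \<le> ennreal (2 * pi * 2 powr \<bar>\<alpha>\<bar>) * (pmean p (disc_ext F) s * ennreal ((1 - s) powr \<alpha>) * indicator {0<..<1} s)"
    proof (cases "s \<in> {0<..<1}")
      case True
      have "(1 - s\<^sup>2) powr \<alpha> * (2 * pi * s) \<le> (2 powr \<bar>\<alpha>\<bar> * (1 - s) powr \<alpha>) * (2 * pi * 1)"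
        using True weight_compare(1)[of s \<alpha>] by (intro mult_mono) auto
      then have "ennreal ((1 - s\<^sup>2) powr \<alpha> * (2 * pi * s)) \<le> ennreal (2 * pi * 2 powr \<bar>\<alpha>\<bar>) * ennreal ((1 - s) powr \<alpha>)"
        by (simp add: ennreal_mult'[symmetric] mult_ac ennreal_leI)
      then have "pmean p (disc_ext F) s * ennreal ((1 - s\<^sup>2) powr \<alpha> * (2 * pi * s)) \<le> pmean p (disc_ext F) s * (ennreal (2 * pi * 2 powr \<bar>\<alpha>\<bar>) * ennreal ((1 - s) powr \<alpha>))"
        by (intro mult_left_mono) auto
      then show ?thesis using True by (simp add: mult_ac)
    qed simp
  qed
  also have "\<dots> = ennreal (2 * pi * 2 powr \<bar>\<alpha>\<bar>) * (\<integral>\<^sup>+s. pmean p (disc_ext F) s * ennreal ((1 - s) powr \<alpha>) * indicator {0<..<1} s \<partial>lborel)"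
    by (rule nn_integral_cmult) measurable
  finally show ?thesis .
qed

text \<open>Radii up to \<open>1/2\<close> are given up because the polar density
  \<open>2 * pi * s\<close> degenerates at the centre; beyond them it is at least 1.\<close>

lemma pmean_le_energy:
  assumes F: "F holomorphic_on ball 0 1"
  shows "(\<integral>\<^sup>+s. pmean p (disc_ext F) s * ennreal ((1 - s) powr \<alpha>) * indicator {1/2<..<1} s \<partial>lborel) \<le> ennreal (2 powr \<bar>\<alpha>\<bar>) * energy p \<alpha> F"
proof -
  note pmean_disc_measurable[OF F, measurable]
  have "(\<integral>\<^sup>+s. pmean p (disc_ext F) s * ennreal ((1 - s) powr \<alpha>) * indicator {1/2<..<1} s \<partial>lborel)
     \<le> (\<integral>\<^sup>+s. ennreal (2 powr \<bar>\<alpha>\<bar>) * (pmean p (disc_ext F) s * ennreal ((1 - s\<^sup>2) powr \<alpha> * (2 * pi * s)) * indicator {0<..<1} s) \<partial>lborel)"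
  proof (rule nn_integral_mono)
    fix s :: real
    show "pmean p (disc_ext F) s * ennreal ((1 - s) powr \<alpha>) * indicator {1/2<..<1} s \<le> ennreal (2 powr \<bar>\<alpha>\<bar>) * (pmean p (disc_ext F) s * ennreal ((1 - s\<^sup>2) powr \<alpha> * (2 * pi * s)) * indicator {0<..<1} s)"
    proof (cases "s \<in> {1/2<..<1}")
      case True
      have "1 * 1 \<le> pi * (2 * s)" using True pi_gt3 by (intro mult_mono) auto
      then have "(1 - s) powr \<alpha> * 1 \<le> (2 powr \<bar>\<alpha>\<bar> * (1 - s\<^sup>2) powr \<alpha>) * (2 * pi * s)"
        using True weight_compare(2)[of s \<alpha>] by (intro mult_mono) auto
      then have "ennreal ((1 - s) powr \<alpha>) \<le> ennreal (2 powr \<bar>\<alpha>\<bar>) * ennreal ((1 - s\<^sup>2) powr \<alpha> * (2 * pi * s))"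
        by (simp add: ennreal_mult'[symmetric] mult_ac ennreal_leI)
      then have "pmean p (disc_ext F) s * ennreal ((1 - s) powr \<alpha>) \<le> pmean p (disc_ext F) s * (ennreal (2 powr \<bar>\<alpha>\<bar>) * ennreal ((1 - s\<^sup>2) powr \<alpha> * (2 * pi * s)))"
        by (intro mult_left_mono) auto
      then show ?thesis using True by (simp add: mult_ac)
    qed simp
  qed
  also have "\<dots> = ennreal (2 powr \<bar>\<alpha>\<bar>) * energy p \<alpha> F"
    unfolding energy_polar[OF F] by (rule nn_integral_cmult) measurable
  finally show ?thesis .
qed

text \<open>Subharmonicity on the circle halfway to the boundary: there the Poisson kernel is at
  most \<open>(R + t) / (R - t)\<close>, hence at most \<open>4 / (1 - t)\<close>.\<close>

lemma norm_powr_radius_le_pmean: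
  assumes p: "p > 1" and F: "F holomorphic_on ball 0 1" and t: "0 \<le> t" "t < 1"
  shows "ennreal (norm (F (of_real t)) powr p) \<le> ennreal (4 / (1 - t)) * pmean p F ((1 + t) / 2)"
proof -
  define R where "R = (1 + t) / 2"
  have R: "0 < R" "t < R" "R < 1" "R - t = (1 - t) / 2" using t by (auto simp: R_def field_simps)
  note circle_measurable[OF F, of R, measurable]
  have "ennreal (norm (F (of_real t)) powr p) \<le> (\<integral>\<^sup>+\<theta>. ennreal (norm (F (of_real R * cis \<theta>)) powr p * ((R\<^sup>2 - t\<^sup>2) / (norm (of_real R * cis \<theta> - of_real t))\<^sup>2)) \<partial>circ)"
    using norm_powr_le_Poisson[OF p F, of "of_real t" R] R t by simp
  also have "\<dots> \<le> (\<integral>\<^sup>+\<theta>. ennreal (4 / (1 - t)) * ennreal (norm (F (of_real R * cis \<theta>)) powr p) \<partial>circ)"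
  proof (rule nn_integral_mono)
    fix \<theta>
    have "R - t \<le> norm (of_real R * cis \<theta> - of_real t)"
      using norm_triangle_ineq2[of "of_real R * cis \<theta>" "of_real t"] R t by (simp add: norm_mult)
    then have "(R - t)\<^sup>2 \<le> (norm (of_real R * cis \<theta> - of_real t))\<^sup>2" using R by (intro power_mono) auto
    then have "(R\<^sup>2 - t\<^sup>2) / (norm (of_real R * cis \<theta> - of_real t))\<^sup>2 \<le> (R\<^sup>2 - t\<^sup>2) / (R - t)\<^sup>2"
      using R t by (intro frac_le) (auto intro!: power_mono)
    also have "\<dots> = (R + t) / (R - t)" using R by (simp add: power2_eq_square square_diff_square_factored)
    also have "\<dots> \<le> 2 / (R - t)" using R t by (intro divide_right_mono) auto
    also have "\<dots> = 4 / (1 - t)" unfolding R(4) by simp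
    finally have "norm (F (of_real R * cis \<theta>)) powr p * ((R\<^sup>2 - t\<^sup>2) / (norm (of_real R * cis \<theta> - of_real t))\<^sup>2) \<le> norm (F (of_real R * cis \<theta>)) powr p * (4 / (1 - t))"
      by (intro mult_left_mono) auto
    then show "ennreal (norm (F (of_real R * cis \<theta>)) powr p * ((R\<^sup>2 - t\<^sup>2) / (norm (of_real R * cis \<theta> - of_real t))\<^sup>2)) \<le> ennreal (4 / (1 - t)) * ennreal (norm (F (of_real R * cis \<theta>)) powr p)"
      using t by (subst ennreal_mult'[symmetric]) (auto intro!: ennreal_leI simp: mult.commute)
  qed
  also have "\<dots> = ennreal (4 / (1 - t)) * pmean p F R"
    unfolding pmean_def using R by (intro nn_integral_cmult) auto
  finally show ?thesis by (simp add: R_def)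
qed

text \<open>A Carleson-type embedding for the radius: the point estimate loses
  \<open>1 / (1 - t)\<close>, which the extra power of the weight pays for. The substitution
  \<open>s = (1 + t) / 2\<close> maps the radius onto the range of \<open>pmean_le_energy\<close>;
  its Jacobian 2, the 4 of the point estimate and the rescaled weight give
  \<open>8 * 2 powr \<alpha>\<close>.\<close>

lemma radial_trace_bound:
  assumes p: "p > 1" and F: "F holomorphic_on ball 0 1"
  shows "(\<integral>\<^sup>+t. ennreal (norm (disc_ext F (of_real t)) powr p * (1 - t) powr (\<alpha> + 1)) * indicator {0<..<1} t \<partial>lborel) \<le> ennreal (8 * 2 powr \<alpha> * 2 powr \<bar>\<alpha>\<bar>) * energy p \<alpha> F"
proof -
  note pmean_disc_measurable[OF F, measurable]
  define k where "k t = ennreal (4 * (1 - t) powr \<alpha>) * pmean p (disc_ext F) ((1 + t) / 2) * indicator {0<..<1} t" for t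
  have [measurable]: "k \<in> borel_measurable borel" unfolding k_def by measurable
  have "(\<integral>\<^sup>+t. ennreal (norm (disc_ext F (of_real t)) powr p * (1 - t) powr (\<alpha> + 1)) * indicator {0<..<1} t \<partial>lborel) \<le> (\<integral>\<^sup>+t. k t \<partial>lborel)"
  proof (rule nn_integral_mono)
    fix t :: real
    show "ennreal (norm (disc_ext F (of_real t)) powr p * (1 - t) powr (\<alpha> + 1)) * indicator {0<..<1} t \<le> k t"
    proof (cases "t \<in> {0<..<1}")
      case True
      then have "ennreal (norm (F (of_real t)) powr p) * ennreal ((1 - t) powr (\<alpha> + 1)) \<le> (ennreal (4 / (1 - t)) * pmean p F ((1 + t) / 2)) * ennreal ((1 - t) powr (\<alpha> + 1))"
        by (intro mult_right_mono norm_powr_radius_le_pmean p F) auto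
      also have "\<dots> = (ennreal (4 / (1 - t)) * ennreal ((1 - t) powr (\<alpha> + 1))) * pmean p F ((1 + t) / 2)" by (simp add: mult_ac)
      also have "ennreal (4 / (1 - t)) * ennreal ((1 - t) powr (\<alpha> + 1)) = ennreal (4 * (1 - t) powr \<alpha>)"
        using True by (subst ennreal_mult'[symmetric]) (auto simp: powr_add)
      finally show ?thesis using True by (simp add: k_def ennreal_mult' pmean_disc_ext)
    qed simp
  qed
  also have "(\<integral>\<^sup>+t. k t \<partial>lborel) = ennreal 2 * (\<integral>\<^sup>+s. k (-1 + 2 * s) \<partial>lborel)"
    using nn_integral_real_affine[of k 2 "-1"] by simp
  also have "(\<integral>\<^sup>+s. k (-1 + 2 * s) \<partial>lborel) \<le> (\<integral>\<^sup>+s. ennreal (4 * 2 powr \<alpha>) * (pmean p (disc_ext F) s * ennreal ((1 - s) powr \<alpha>) * indicator {1/2<..<1} s) \<partial>lborel)"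
  proof (rule nn_integral_mono)
    fix s :: real
    show "k (-1 + 2 * s) \<le> ennreal (4 * 2 powr \<alpha>) * (pmean p (disc_ext F) s * ennreal ((1 - s) powr \<alpha>) * indicator {1/2<..<1} s)"
    proof (cases "s \<in> {1/2<..<1}")
      case True
      have "(2 - 2 * s) powr \<alpha> = 2 powr \<alpha> * (1 - s) powr \<alpha>"
        using True powr_mult[of 2 "1 - s" \<alpha>] by (simp add: algebra_simps)
      then show ?thesis using True by (simp add: k_def ennreal_mult' mult_ac)
    qed (auto simp: k_def indicator_def)
  qed
  also have "\<dots> = ennreal (4 * 2 powr \<alpha>) * (\<integral>\<^sup>+s. pmean p (disc_ext F) s * ennreal ((1 - s) powr \<alpha>) * indicator {1/2<..<1} s \<partial>lborel)"
    by (rule nn_integral_cmult) measurable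
  also have "\<dots> \<le> ennreal (4 * 2 powr \<alpha>) * (ennreal (2 powr \<bar>\<alpha>\<bar>) * energy p \<alpha> F)"
    by (intro mult_left_mono pmean_le_energy F) auto
  finally have "(\<integral>\<^sup>+t. ennreal (norm (disc_ext F (of_real t)) powr p * (1 - t) powr (\<alpha> + 1)) * indicator {0<..<1} t \<partial>lborel) \<le> ennreal 2 * (ennreal (4 * 2 powr \<alpha>) * (ennreal (2 powr \<bar>\<alpha>\<bar>) * energy p \<alpha> F))"
    by (simp add: mult_left_mono)
  also have "\<dots> = ennreal (8 * 2 powr \<alpha> * 2 powr \<bar>\<alpha>\<bar>) * energy p \<alpha> F"
    by (subst mult.assoc[symmetric], subst mult.assoc[symmetric], subst ennreal_mult'[symmetric], simp, subst ennreal_mult'[symmetric]) auto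
  finally show ?thesis .
qed

section \<open>Hilbert's inequality and integrals along the radius\<close>

text \<open>With \<open>u = 1 - s\<close>, the function \<open>u * \<phi> (1 - u)\<close> is
  integrated against the Hilbert kernel \<open>1 / (u + x)\<close>, and the claim is its boundedness
  on Lp with weight \<open>x powr e\<close>. Schur's test uses the kernel times
  \<open>u powr (-\<epsilon>)\<close> as Hoelder weight, and Tonelli then leaves one more integral
  of the kernel, in \<open>x\<close>.\<close>

lemma Schur_Hardy:
  fixes p e :: real
  assumes p: "p > 1" and e: "-1 < e" "e \<le> 0"
  obtains C where "C > 0" "\<And>\<phi>. \<lbrakk>\<phi> \<in> borel_measurable borel; \<And>s. \<phi> s \<ge> 0\<rbrakk> \<Longrightarrow>
     (\<integral>\<^sup>+x. ennreal (x powr e * (LINT s|lborel. indicator {0<..<1} s * \<phi> s * ((1 - s) / (1 - s + x))) powr p) * indicator {0<..<1} x \<partial>lborel)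
     \<le> ennreal C * (\<integral>\<^sup>+s. ennreal (\<phi> s powr p * (1 - s) powr (p + e)) * indicator {0<..<1} s \<partial>lborel)"
proof -
  \<comment> \<open>The test exponent needs \<open>0 < \<epsilon> < 1\<close> for the integral in
    \<open>s\<close> and \<open>e < \<epsilon> * (p - 1) < e + 1\<close> for the integral in
    \<open>x\<close>. The left inequality follows from \<open>e \<le> 0\<close>.\<close>
  define \<epsilon> where "\<epsilon> = min (1/2) ((e + 1) / (2 * (p - 1)))"
  have eps: "0 < \<epsilon>" "\<epsilon> < 1" using p e by (auto simp: \<epsilon>_def)
  have eps2: "\<epsilon> * (p - 1) < e + 1"
  proof -
    have "\<epsilon> * (p - 1) \<le> (e + 1) / (2 * (p - 1)) * (p - 1)" using p by (intro mult_right_mono) (auto simp: \<epsilon>_def)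
    also have "\<dots> = (e + 1) / 2" using p by (simp add: field_simps)
    finally show ?thesis using e by simp
  qed
  have eps3: "\<epsilon> * (p - 1) > 0" using eps p by simp
  obtain S1 where S1: "S1 > 0" "\<And>d. d > 0 \<Longrightarrow> (\<integral>\<^sup>+x. ennreal (x powr (-\<epsilon>) * (d + x) powr (-1)) * indicator {0<..} x \<partial>lborel) \<le> ennreal (S1 * d powr (-\<epsilon> - 1 + 1))"
    using nn_integral_powr_kernel[of "-\<epsilon>" 1] eps by auto
  obtain S2 where S2: "S2 > 0" "\<And>d. d > 0 \<Longrightarrow> (\<integral>\<^sup>+x. ennreal (x powr (e - \<epsilon> * (p-1)) * (d + x) powr (-1)) * indicator {0<..} x \<partial>lborel) \<le> ennreal (S2 * d powr ((e - \<epsilon> * (p-1)) - 1 + 1))"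
    using nn_integral_powr_kernel[of "e - \<epsilon> * (p-1)" 1] eps2 eps3 e by auto
  show thesis
  proof (rule that)
    show "S1 powr (p-1) * S2 > 0" using S1 S2 by simp
    fix \<phi> :: "real \<Rightarrow> real" assume [measurable]: "\<phi> \<in> borel_measurable borel" and \<phi>: "\<And>s. \<phi> s \<ge> 0"
    define J where "J x = (LINT s|lborel. indicator {0<..<1} s * \<phi> s * ((1 - s) / (1 - s + x)))" for x
    \<comment> \<open>What Hoelder leaves: the Schur weight to the power \<open>1 - p\<close> turns
      the kernel exponent \<open>-p\<close> into \<open>-1\<close> and adds
      \<open>\<epsilon> * (p - 1)\<close> to that of \<open>1 - s\<close>. The integral in
      \<open>x\<close> takes this surplus back.\<close>
    define Q where "Q x s = ennreal (\<phi> s powr p * (1 - s) powr (p + \<epsilon> * (p-1)) * (1 - s + x) powr (-1)) * indicator {0<..<1} s" for x s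
    have Qm [measurable]: "(\<lambda>(x,s). Q x s) \<in> borel_measurable (lborel \<Otimes>\<^sub>M lborel)" unfolding Q_def by measurable
    have J: "ennreal (J x powr p) \<le> ennreal ((S1 * x powr (-\<epsilon>)) powr (p-1)) * (\<integral>\<^sup>+s. Q x s \<partial>lborel)" if x: "0 < x" for x
    proof -
      define N where "N s = indicator {0<..<1} s * ((1 - s) powr (-\<epsilon>) * (x + (1 - s)) powr (-1))" for s
      have [measurable]: "N \<in> borel_measurable borel" unfolding N_def by measurable
      have NI: "(\<integral>\<^sup>+s. ennreal (N s) \<partial>lborel) \<le> ennreal (S1 * x powr (-\<epsilon>))"
      proof -
        have "(\<integral>\<^sup>+s. ennreal (N s) \<partial>lborel) \<le> (\<integral>\<^sup>+s. ennreal ((1 - s) powr (-\<epsilon>) * (x + (1 - s)) powr (-1)) * indicator {0<..} (1 - s) \<partial>lborel)"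
          by (intro nn_integral_mono) (auto simp: N_def indicator_def)
        also have "\<dots> = (\<integral>\<^sup>+s. ennreal (s powr (-\<epsilon>) * (x + s) powr (-1)) * indicator {0<..} s \<partial>lborel)"
          by (rule nn_integral_reflect[of "\<lambda>s. ennreal (s powr (-\<epsilon>) * (x + s) powr (-1)) * indicator {0<..} s"]) measurable
        also have "\<dots> \<le> ennreal (S1 * x powr (-\<epsilon>))" using S1(2)[OF x] by simp
        finally show ?thesis .
      qed
      have "ennreal (norm (J x) powr p) \<le> ennreal ((S1 * x powr (-\<epsilon>)) powr (p-1)) * (\<integral>\<^sup>+s. ennreal (norm (indicator {0<..<1} s * \<phi> s * ((1 - s) / (1 - s + x))) powr p * N s powr (1-p)) \<partial>lborel)"
        unfolding J_def
      proof (rule norm_integral_powr_le[OF p])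
        show "N s \<ge> 0" for s by (simp add: N_def)
        show "indicator {0<..<1} s * \<phi> s * ((1 - s) / (1 - s + x)) = 0" if "N s = 0" for s
          using that x by (auto simp: N_def indicator_def split: if_splits)
      qed (use NI S1 x in auto)
      also have "(\<integral>\<^sup>+s. ennreal (norm (indicator {0<..<1} s * \<phi> s * ((1 - s) / (1 - s + x))) powr p * N s powr (1-p)) \<partial>lborel) = (\<integral>\<^sup>+s. Q x s \<partial>lborel)"
      proof (rule nn_integral_cong)
        fix s :: real
        show "ennreal (norm (indicator {0<..<1} s * \<phi> s * ((1 - s) / (1 - s + x))) powr p * N s powr (1-p)) = Q x s"
        proof (cases "s \<in> {0<..<1}")
          case True
          define w where "w = 1 - s + x"
          have w: "w > 0" "1 - s > 0" using True x by (auto simp: w_def)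
          have "norm (indicator {0<..<1} s * \<phi> s * ((1 - s) / w)) powr p = \<phi> s powr p * ((1 - s) powr p * w powr (-p))"
            using True w \<phi>[of s] by (simp add: powr_mult powr_divide powr_minus_divide)
          moreover have "N s powr (1-p) = (1 - s) powr (\<epsilon> * (p-1)) * w powr (p - 1)"
          proof -
            have "N s = (1 - s) powr (-\<epsilon>) * w powr (-1)" using True by (simp add: N_def w_def add.commute)
            then show ?thesis using w by (simp only: powr_mult powr_powr) (simp add: algebra_simps)
          qed
          ultimately have "norm (indicator {0<..<1} s * \<phi> s * ((1 - s) / w)) powr p * N s powr (1-p)
             = \<phi> s powr p * ((1 - s) powr p * (1 - s) powr (\<epsilon> * (p-1))) * (w powr (-p) * w powr (p - 1))" by (simp only: mult_ac)
          also have "\<dots> = \<phi> s powr p * (1 - s) powr (p + \<epsilon> * (p-1)) * w powr (-1)"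
            using w by (simp add: powr_add[symmetric])
          finally show ?thesis using True by (simp add: Q_def w_def)
        qed (simp add: Q_def)
      qed
      also have "norm (J x) = J x"
      proof -
        have "J x \<ge> 0" unfolding J_def using x \<phi> by (intro Bochner_Integration.integral_nonneg) (auto simp: indicator_def)
        then show ?thesis by simp
      qed
      finally show ?thesis .
    qed
    show "(\<integral>\<^sup>+x. ennreal (x powr e * (LINT s|lborel. indicator {0<..<1} s * \<phi> s * ((1 - s) / (1 - s + x))) powr p) * indicator {0<..<1} x \<partial>lborel)
       \<le> ennreal (S1 powr (p-1) * S2) * (\<integral>\<^sup>+s. ennreal (\<phi> s powr p * (1 - s) powr (p + e)) * indicator {0<..<1} s \<partial>lborel)"
    proof -
      have "(\<integral>\<^sup>+x. ennreal (x powr e * J x powr p) * indicator {0<..<1} x \<partial>lborel)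
        \<le> (\<integral>\<^sup>+x. \<integral>\<^sup>+s. ennreal (S1 powr (p-1) * x powr (e - \<epsilon> * (p-1))) * Q x s * indicator {0<..} x \<partial>lborel \<partial>lborel)"
      proof (rule nn_integral_mono)
        fix x :: real
        show "ennreal (x powr e * J x powr p) * indicator {0<..<1} x \<le> (\<integral>\<^sup>+s. ennreal (S1 powr (p-1) * x powr (e - \<epsilon> * (p-1))) * Q x s * indicator {0<..} x \<partial>lborel)"
        proof (cases "x \<in> {0<..<1}")
          case True
          then have x: "x > 0" by simp
          have "ennreal (x powr e) * ennreal (J x powr p) \<le> ennreal (x powr e) * (ennreal ((S1 * x powr (-\<epsilon>)) powr (p-1)) * (\<integral>\<^sup>+s. Q x s \<partial>lborel))"
            by (intro mult_left_mono J x) auto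
          also have "\<dots> = ennreal (x powr e * (S1 * x powr (-\<epsilon>)) powr (p-1)) * (\<integral>\<^sup>+s. Q x s \<partial>lborel)"
            by (simp add: ennreal_mult' mult.assoc)
          also have "x powr e * (S1 * x powr (-\<epsilon>)) powr (p-1) = S1 powr (p-1) * x powr (e - \<epsilon> * (p-1))"
          proof -
            have "(S1 * x powr (-\<epsilon>)) powr (p-1) = S1 powr (p-1) * x powr (- \<epsilon> * (p-1))"
              using S1(1) by (simp add: powr_mult powr_powr)
            moreover have "x powr e * x powr (- \<epsilon> * (p-1)) = x powr (e - \<epsilon> * (p-1))" by (simp add: powr_add[symmetric])
            ultimately show ?thesis by (metis mult.left_commute)
          qed
          also have "ennreal (S1 powr (p-1) * x powr (e - \<epsilon> * (p-1))) * (\<integral>\<^sup>+s. Q x s \<partial>lborel) = (\<integral>\<^sup>+s. ennreal (S1 powr (p-1) * x powr (e - \<epsilon> * (p-1))) * Q x s \<partial>lborel)"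
            by (rule nn_integral_cmult[symmetric]) measurable
          finally show ?thesis using True by (simp add: ennreal_mult')
        qed simp
      qed
      also have "\<dots> = (\<integral>\<^sup>+s. \<integral>\<^sup>+x. ennreal (S1 powr (p-1) * x powr (e - \<epsilon> * (p-1))) * Q x s * indicator {0<..} x \<partial>lborel \<partial>lborel)"
        by (rule lborel_pair.Fubini'[symmetric]) measurable
      also have "\<dots> \<le> (\<integral>\<^sup>+s. ennreal (S1 powr (p-1) * S2) * (ennreal (\<phi> s powr p * (1 - s) powr (p + e)) * indicator {0<..<1} s) \<partial>lborel)"
      proof (rule nn_integral_mono)
        fix s :: real
        show "(\<integral>\<^sup>+x. ennreal (S1 powr (p-1) * x powr (e - \<epsilon> * (p-1))) * Q x s * indicator {0<..} x \<partial>lborel) \<le> ennreal (S1 powr (p-1) * S2) * (ennreal (\<phi> s powr p * (1 - s) powr (p + e)) * indicator {0<..<1} s)"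
        proof (cases "s \<in> {0<..<1}")
          case True
          define c where "c = S1 powr (p-1) * (\<phi> s powr p * (1 - s) powr (p + \<epsilon> * (p-1)))"
          have c: "c \<ge> 0" by (simp add: c_def)
          have "(\<integral>\<^sup>+x. ennreal (S1 powr (p-1) * x powr (e - \<epsilon> * (p-1))) * Q x s * indicator {0<..} x \<partial>lborel)
            = (\<integral>\<^sup>+x. ennreal c * (ennreal (x powr (e - \<epsilon> * (p-1)) * ((1 - s) + x) powr (-1)) * indicator {0<..} x) \<partial>lborel)"
          proof (rule nn_integral_cong)
            fix x
            have "ennreal (S1 powr (p-1) * y) * ennreal (\<phi> s powr p * (1 - s) powr (p + \<epsilon> * (p-1)) * w) = ennreal c * ennreal (y * w)"
              if "y \<ge> 0" for y w
            proof -
              have "ennreal (S1 powr (p-1) * y) * ennreal (\<phi> s powr p * (1 - s) powr (p + \<epsilon> * (p-1)) * w) = ennreal ((S1 powr (p-1) * y) * (\<phi> s powr p * (1 - s) powr (p + \<epsilon> * (p-1)) * w))"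
                using that by (intro ennreal_mult'[symmetric]) simp
              also have "(S1 powr (p-1) * y) * (\<phi> s powr p * (1 - s) powr (p + \<epsilon> * (p-1)) * w) = c * (y * w)"
                by (simp add: c_def mult_ac)
              also have "ennreal (c * (y * w)) = ennreal c * ennreal (y * w)" by (rule ennreal_mult'[OF c])
              finally show ?thesis .
            qed
            from this[of "x powr (e - \<epsilon> * (p-1))" "(1 - s + x) powr (-1)", OF powr_ge_zero]
            show "ennreal (S1 powr (p-1) * x powr (e - \<epsilon> * (p-1))) * Q x s * indicator {0<..} x = ennreal c * (ennreal (x powr (e - \<epsilon> * (p-1)) * ((1 - s) + x) powr (-1)) * indicator {0<..} x)"
              unfolding Q_def using True by (simp only: indicator_simps mult_1_right mult.assoc[symmetric]) 
          qed
          also have "\<dots> = ennreal c * (\<integral>\<^sup>+x. ennreal (x powr (e - \<epsilon> * (p-1)) * ((1 - s) + x) powr (-1)) * indicator {0<..} x \<partial>lborel)"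
            by (rule nn_integral_cmult) measurable
          also have "\<dots> \<le> ennreal c * ennreal (S2 * (1 - s) powr ((e - \<epsilon> * (p-1)) - 1 + 1))"
            using True by (intro mult_left_mono S2(2)) auto
          also have "\<dots> = ennreal (c * (S2 * (1 - s) powr (e - \<epsilon> * (p-1))))"
            using c by (simp add: ennreal_mult')
          also have "c * (S2 * (1 - s) powr (e - \<epsilon> * (p-1))) = (S1 powr (p-1) * S2) * (\<phi> s powr p * (1 - s) powr (p + e))"
          proof -
            have "(1 - s) powr (p + \<epsilon> * (p-1)) * (1 - s) powr (e - \<epsilon> * (p-1)) = (1 - s) powr (p + e)"
              by (simp add: powr_add[symmetric])
            then show ?thesis unfolding c_def by (simp only: mult_ac)
          qed
          finally show ?thesis using True S2(1) by (simp add: ennreal_mult')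
        qed (simp add: Q_def)
      qed
      also have "\<dots> = ennreal (S1 powr (p-1) * S2) * (\<integral>\<^sup>+s. ennreal (\<phi> s powr p * (1 - s) powr (p + e)) * indicator {0<..<1} s \<partial>lborel)"
        by (rule nn_integral_cmult) measurable
      finally show ?thesis by (simp add: J_def)
    qed
  qed
qed

lemma radial_value_le:
  assumes f: "f holomorphic_on ball 0 1" and t: "0 \<le> t" "t < 1"
  shows "ennreal (norm (f (of_real t))) \<le> ennreal (norm (f 0)) + (\<integral>\<^sup>+s. ennreal (norm (disc_ext (deriv f) (of_real s))) * indicator {0<..t} s \<partial>lborel)"
proof -
  have "f (of_real t) = f 0 + (LINT s|lborel. indicator {0..t} s *\<^sub>R (disc_ext (deriv f) (of_real s)))"
    using radial_FTC[OF f, of 0 t 0] t by simp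
  then have "norm (f (of_real t)) \<le> norm (f 0) + norm (LINT s|lborel. indicator {0..t} s *\<^sub>R (disc_ext (deriv f) (of_real s)))"
    by (metis norm_triangle_ineq)
  then have "ennreal (norm (f (of_real t))) \<le> ennreal (norm (f 0)) + ennreal (norm (LINT s|lborel. indicator {0..t} s *\<^sub>R (disc_ext (deriv f) (of_real s))))"
    by (simp add: ennreal_plus[symmetric] ennreal_leI del: ennreal_plus)
  also have "ennreal (norm (LINT s|lborel. indicator {0..t} s *\<^sub>R (disc_ext (deriv f) (of_real s)))) \<le> (\<integral>\<^sup>+s. ennreal (norm (indicator {0..t} s *\<^sub>R (disc_ext (deriv f) (of_real s)))) \<partial>lborel)"
    by (rule norm_integral_le_nn_integral)
  also have "\<dots> = (\<integral>\<^sup>+s. ennreal (norm (disc_ext (deriv f) (of_real s))) * indicator {0<..t} s \<partial>lborel)"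
  proof (rule nn_integral_cong_AE)
    show "AE s in lborel. ennreal (norm (indicator {0..t} s *\<^sub>R (disc_ext (deriv f) (of_real s)))) = ennreal (norm (disc_ext (deriv f) (of_real s))) * indicator {0<..t} s"
      using AE_lborel_singleton[of 0] by eventually_elim (auto simp: indicator_def)
  qed
  finally show ?thesis by (simp add: add_left_mono)
qed

text \<open>\<open>f\<close> on the radius is bounded through its value at 0 and the integral of its
  derivative; Tonelli then collects the tail of the weight beyond \<open>s\<close> as the new weight
  of \<open>f'\<close>.\<close>

lemma weighted_radial_integral_le:
  fixes w :: "real \<Rightarrow> ennreal"
  assumes f: "f holomorphic_on ball 0 1" and [measurable]: "w \<in> borel_measurable borel"
  shows "(\<integral>\<^sup>+t. ennreal (norm (disc_ext f (of_real t))) * w t * indicator {0..<1} t \<partial>lborel)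
    \<le> ennreal (norm (f 0)) * (\<integral>\<^sup>+t. w t * indicator {0..<1} t \<partial>lborel)
      + (\<integral>\<^sup>+s. ennreal (norm (disc_ext (deriv f) (of_real s))) * (\<integral>\<^sup>+t. w t * indicator {s..<1} t \<partial>lborel) * indicator {0<..<1} s \<partial>lborel)"
proof -
  note disc_ext_measurable[OF f, measurable] disc_ext_measurable[OF holomorphic_deriv_disc[OF f], measurable]
  define \<phi> where "\<phi> s = ennreal (norm (disc_ext (deriv f) (of_real s)))" for s :: real
  have [measurable]: "\<phi> \<in> borel_measurable borel" unfolding \<phi>_def by measurable
  have [measurable]: "Measurable.pred (lborel \<Otimes>\<^sub>M lborel) (\<lambda>x. snd x \<in> {0<..fst x :: real})"
    by (simp add: greaterThanAtMost_iff)
  have "(\<integral>\<^sup>+t. ennreal (norm (disc_ext f (of_real t))) * w t * indicator {0..<1} t \<partial>lborel)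
    \<le> (\<integral>\<^sup>+t. ennreal (norm (f 0)) * (w t * indicator {0..<1} t) + (\<integral>\<^sup>+s. \<phi> s * w t * indicator {0..<1} t * (if 0 < s \<and> s \<le> t then 1 else 0) \<partial>lborel) \<partial>lborel)"
  proof (rule nn_integral_mono)
    fix t :: real
    show "ennreal (norm (disc_ext f (of_real t))) * w t * indicator {0..<1} t \<le> ennreal (norm (f 0)) * (w t * indicator {0..<1} t) + (\<integral>\<^sup>+s. \<phi> s * w t * indicator {0..<1} t * (if 0 < s \<and> s \<le> t then 1 else 0) \<partial>lborel)"
    proof (cases "t \<in> {0..<1}")
      case True
      then have "ennreal (norm (f (of_real t))) * w t \<le> (ennreal (norm (f 0)) + (\<integral>\<^sup>+s. \<phi> s * indicator {0<..t} s \<partial>lborel)) * w t"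
        unfolding \<phi>_def by (intro mult_right_mono radial_value_le f) auto
      also have "\<dots> = ennreal (norm (f 0)) * w t + (\<integral>\<^sup>+s. \<phi> s * indicator {0<..t} s * w t \<partial>lborel)"
        by (simp add: distrib_right nn_integral_multc)
      also have "(\<integral>\<^sup>+s. \<phi> s * indicator {0<..t} s * w t \<partial>lborel) = (\<integral>\<^sup>+s. \<phi> s * w t * indicator {0..<1} t * (if 0 < s \<and> s \<le> t then 1 else 0) \<partial>lborel)"
        using True by (intro nn_integral_cong) (auto simp: indicator_def)
      finally show ?thesis using True by simp
    qed simp
  qed
  also have "\<dots> = ennreal (norm (f 0)) * (\<integral>\<^sup>+t. w t * indicator {0..<1} t \<partial>lborel) + (\<integral>\<^sup>+t. \<integral>\<^sup>+s. \<phi> s * w t * indicator {0..<1} t * (if 0 < s \<and> s \<le> t then 1 else 0) \<partial>lborel \<partial>lborel)"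
    by (subst nn_integral_add, measurable, subst nn_integral_cmult, measurable)
  also have "(\<integral>\<^sup>+t. \<integral>\<^sup>+s. \<phi> s * w t * indicator {0..<1} t * (if 0 < s \<and> s \<le> t then 1 else 0) \<partial>lborel \<partial>lborel)
     = (\<integral>\<^sup>+s. \<integral>\<^sup>+t. \<phi> s * w t * indicator {0..<1} t * (if 0 < s \<and> s \<le> t then 1 else 0) \<partial>lborel \<partial>lborel)"
    by (rule lborel_pair.Fubini'[symmetric]) measurable
  also have "\<dots> = (\<integral>\<^sup>+s. \<phi> s * (\<integral>\<^sup>+t. w t * indicator {s..<1} t \<partial>lborel) * indicator {0<..<1} s \<partial>lborel)"
  proof (rule nn_integral_cong)
    fix s :: real
    show "(\<integral>\<^sup>+t. \<phi> s * w t * indicator {0..<1} t * (if 0 < s \<and> s \<le> t then 1 else 0) \<partial>lborel) = \<phi> s * (\<integral>\<^sup>+t. w t * indicator {s..<1} t \<partial>lborel) * indicator {0<..<1} s"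
    proof (cases "s \<in> {0<..<1}")
      case True
      then have "(\<integral>\<^sup>+t. \<phi> s * w t * indicator {0..<1} t * (if 0 < s \<and> s \<le> t then 1 else 0) \<partial>lborel) = (\<integral>\<^sup>+t. \<phi> s * (w t * indicator {s..<1} t) \<partial>lborel)"
        by (intro nn_integral_cong) (auto simp: indicator_def)
      then show ?thesis using True by (simp add: nn_integral_cmult)
    next
      case False
      then have "\<phi> s * w t * indicator {0..<1} t * (if 0 < s \<and> s \<le> t then 1 else 0) = 0" for t
        by (auto simp: indicator_def)
      then have "(\<integral>\<^sup>+t. \<phi> s * w t * indicator {0..<1} t * (if 0 < s \<and> s \<le> t then 1 else 0) \<partial>lborel) = (\<integral>\<^sup>+t. 0 \<partial>(lborel :: real measure))"
        by (simp only:)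
      then show ?thesis using False by simp
    qed
  qed
  finally show ?thesis by (simp add: \<phi>_def)
qed

text \<open>Since \<open>t * r\<close> is at most \<open>r\<close> and at most \<open>t\<close>,
  \<open>1 - t * r\<close> is at least half of \<open>(1 - r) + (1 - t)\<close>. With
  \<open>x = 1 - r\<close> and \<open>u = 1 - s\<close>: if \<open>u \<le> x\<close>, the integrand
  is at most \<open>x powr (-\<nu>)\<close> on an interval of length \<open>u\<close>; if
  \<open>u > x\<close>, the integral over the half-line already has order
  \<open>x powr (1 - \<nu>)\<close>. The quotient \<open>u / (u + x)\<close> unites both cases up to
  a factor 2.\<close>

lemma kernel_tail_bound:
  assumes \<nu>: "\<nu> > 1"
  obtains c where "c > 0" "\<And>r s. \<lbrakk>0 \<le> r; r < 1; 0 \<le> s; s < 1\<rbrakk> \<Longrightarrow>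
    (\<integral>\<^sup>+t. ennreal ((1 - t * r) powr (-\<nu>)) * indicator {s..<1} t \<partial>lborel) \<le> ennreal (c * (1 - r) powr (1 - \<nu>) * ((1 - s) / (1 - s + (1 - r))))"
proof -
  obtain S where S: "S > 0" "\<And>d. d > 0 \<Longrightarrow> (\<integral>\<^sup>+x. ennreal (x powr 0 * (d + x) powr (-\<nu>)) * indicator {0<..} x \<partial>lborel) \<le> ennreal (S * d powr (0 - \<nu> + 1))"
    using nn_integral_powr_kernel[of 0 \<nu>] \<nu> by auto
  show thesis
  proof (rule that)
    define m where "m = max 1 S"
    show "2 powr \<nu> * (2 * max 1 S) > 0" by simp
    fix r s :: real assume r: "0 \<le> r" "r < 1" and s: "0 \<le> s" "s < 1"
    define x u where "x = 1 - r" and "u = 1 - s"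
    have x: "0 < x" "x \<le> 1" and u: "0 < u" "u \<le> 1" using r s by (auto simp: x_def u_def)
    define I where "I = (\<integral>\<^sup>+y. ennreal ((x + y) powr (-\<nu>)) * indicator {0<..u} y \<partial>lborel)"
    have "(\<integral>\<^sup>+t. ennreal ((1 - t * r) powr (-\<nu>)) * indicator {s..<1} t \<partial>lborel) \<le> (\<integral>\<^sup>+t. ennreal (2 powr \<nu>) * (ennreal ((x + (1 - t)) powr (-\<nu>)) * indicator {0<..u} (1 - t)) \<partial>lborel)"
    proof (rule nn_integral_mono)
      fix t :: real
      show "ennreal ((1 - t * r) powr (-\<nu>)) * indicator {s..<1} t \<le> ennreal (2 powr \<nu>) * (ennreal ((x + (1 - t)) powr (-\<nu>)) * indicator {0<..u} (1 - t))"
      proof (cases "t \<in> {s..<1}")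
        case True
        then have t: "0 \<le> t" "t < 1" using s by auto
        have "t * r \<le> r" using mult_right_mono[of t 1 r] t r by simp
        moreover have "t * r \<le> t" using mult_left_mono[of r 1 t] t r by simp
        moreover have "v \<le> r \<Longrightarrow> v \<le> t \<Longrightarrow> (x + (1 - t)) / 2 \<le> 1 - v" for v by (simp add: x_def)
        ultimately have h: "(x + (1 - t)) / 2 \<le> 1 - t * r" by blast
        have "(1 - t * r) powr (-\<nu>) \<le> ((x + (1 - t)) / 2) powr (-\<nu>)"
          using h x t \<nu> by (intro powr_mono2') auto
        also have "\<dots> = 2 powr \<nu> * (x + (1 - t)) powr (-\<nu>)"
          using x t by (simp add: powr_divide powr_minus field_simps)
        finally show ?thesis using True by (simp add: u_def ennreal_mult'[symmetric] ennreal_leI)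
      qed simp
    qed
    also have "\<dots> = (\<integral>\<^sup>+y. ennreal (2 powr \<nu>) * (ennreal ((x + y) powr (-\<nu>)) * indicator {0<..u} y) \<partial>lborel)"
      by (rule nn_integral_reflect[of "\<lambda>y. ennreal (2 powr \<nu>) * (ennreal ((x + y) powr (-\<nu>)) * indicator {0<..u} y)"]) measurable
    also have "\<dots> = ennreal (2 powr \<nu>) * I"
      unfolding I_def by (rule nn_integral_cmult) measurable
    also have "I \<le> ennreal (2 * m * x powr (1 - \<nu>) * (u / (u + x)))"
    proof (cases "u \<le> x")
      case True
      have "I \<le> (\<integral>\<^sup>+y. ennreal (x powr (-\<nu>)) * indicator {0<..u} y \<partial>lborel)"
        unfolding I_def using x \<nu> by (intro nn_integral_mono) (auto simp: indicator_def intro!: ennreal_leI powr_mono2')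
      also have "\<dots> = ennreal (x powr (-\<nu>) * u)"
        using u by (simp add: nn_integral_cmult ennreal_mult')
      also have "x powr (-\<nu>) * u = x powr (1 - \<nu>) * (u / x)" using x by (simp add: powr_diff powr_minus field_simps)
      also have "x powr (1 - \<nu>) * (u / x) \<le> x powr (1 - \<nu>) * (2 * m * (u / (u + x)))"
      proof (rule mult_left_mono)
        have "u / x = 2 * u / (x + x)" using x by simp
        also have "\<dots> \<le> 2 * u / (u + x)" using True x u by (intro divide_left_mono) auto
        also have "\<dots> = 2 * 1 * (u / (u + x))" by simp
        also have "\<dots> \<le> 2 * m * (u / (u + x))" using x u by (intro mult_right_mono mult_left_mono) (auto simp: m_def)
        finally show "u / x \<le> 2 * m * (u / (u + x))" .
      qed simp
      finally show ?thesis by (simp add: mult_ac ennreal_leI)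
    next
      case False
      have "I \<le> (\<integral>\<^sup>+y. ennreal (y powr 0 * (x + y) powr (-\<nu>)) * indicator {0<..} y \<partial>lborel)"
        unfolding I_def by (intro nn_integral_mono) (auto simp: indicator_def)
      also have "\<dots> \<le> ennreal (S * x powr (0 - \<nu> + 1))" by (rule S(2)[OF x(1)])
      also have "S * x powr (0 - \<nu> + 1) \<le> m * x powr (1 - \<nu>) * 1"
        by (simp add: m_def mult_right_mono)
      also have "\<dots> \<le> m * x powr (1 - \<nu>) * (2 * u / (u + x))"
      proof (rule mult_left_mono)
        show "1 \<le> 2 * u / (u + x)" using False x u by (simp add: field_simps)
      qed (simp add: m_def)
      finally show ?thesis by (simp add: mult_ac ennreal_leI)
    qed
    finally have "(\<integral>\<^sup>+t. ennreal ((1 - t * r) powr (-\<nu>)) * indicator {s..<1} t \<partial>lborel) \<le> ennreal (2 powr \<nu>) * ennreal (2 * m * x powr (1 - \<nu>) * (u / (u + x)))"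
      by (simp add: mult_left_mono)
    also have "\<dots> = ennreal (2 powr \<nu> * (2 * max 1 S) * (1 - r) powr (1 - \<nu>) * ((1 - s) / (1 - s + (1 - r))))"
      by (simp add: ennreal_mult'[symmetric] m_def x_def u_def mult_ac)
    finally show "(\<integral>\<^sup>+t. ennreal ((1 - t * r) powr (-\<nu>)) * indicator {s..<1} t \<partial>lborel) \<le> ennreal (2 powr \<nu> * (2 * max 1 S) * (1 - r) powr (1 - \<nu>) * ((1 - s) / (1 - s + (1 - r))))" .
  qed
qed

text \<open>This makes the defining integral of the operator converge. The first bound is Hoelder
  against a bounded weight; the second is the first with the constant weight 1, whose tail beyond
  \<open>s\<close> is \<open>1 - s\<close>.\<close>

lemma radial_L1_bound:
  assumes p: "p > 1" and \<alpha>: "\<alpha> \<le> p - 1" and f: "f holomorphic_on ball 0 1"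
    and T: "\<tau> \<ge> 0" "(\<integral>\<^sup>+t. ennreal (norm (disc_ext (deriv f) (of_real t)) powr p * (1 - t) powr (\<alpha> + 1)) * indicator {0<..<1} t \<partial>lborel) \<le> ennreal \<tau>"
  shows "(\<integral>\<^sup>+s. ennreal (norm (disc_ext (deriv f) (of_real s)) * (1 - s)) * indicator {0<..<1} s \<partial>lborel) \<le> ennreal (\<tau> powr (1/p))"
    and "(\<integral>\<^sup>+t. ennreal (norm (disc_ext f (of_real t))) * indicator {0..<1} t \<partial>lborel) \<le> ennreal (norm (f 0) + \<tau> powr (1/p))"
proof -
  note disc_ext_measurable[OF f, measurable] disc_ext_measurable[OF holomorphic_deriv_disc[OF f], measurable]
  define \<phi> where "\<phi> s = norm (disc_ext (deriv f) (of_real s))" for s :: real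
  have [measurable]: "\<phi> \<in> borel_measurable borel" unfolding \<phi>_def by measurable
  \<comment> \<open>The solution of \<open>p + \<kappa> * (1 - p) = \<alpha> + 1\<close>, so that
    Hoelder returns the weight of the trace integral. It is nonnegative because
    \<open>\<alpha> \<le> p - 1\<close>, and so the Hoelder weight \<open>N\<close> is at most
    1.\<close>
  define \<kappa> where "\<kappa> = (p - 1 - \<alpha>) / (p - 1)"
  have \<kappa>: "\<kappa> \<ge> 0" "\<kappa> * (1 - p) = \<alpha> + 1 - p" using p \<alpha> by (auto simp: \<kappa>_def field_simps)
  define N where "N s = indicator {0<..<1} s * (1 - s) powr \<kappa>" for s :: real
  have "(\<integral>\<^sup>+s. ennreal (indicator {0<..<1} s * (\<phi> s * (1 - s))) \<partial>lborel) \<le> ennreal ((1 powr (p-1) * \<tau>) powr (1/p))"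
  proof (rule nn_integral_Hoelder_weighted[OF p])
    show "N \<in> borel_measurable lborel" unfolding N_def by measurable
    show "(\<lambda>s. indicator {0<..<1} s * (\<phi> s * (1 - s))) \<in> borel_measurable lborel" by measurable
    show "0 \<le> indicator {0<..<1} s * (\<phi> s * (1 - s))" for s by (auto simp: indicator_def \<phi>_def)
    show "N s \<ge> 0" for s by (simp add: N_def)
    show "indicator {0<..<1} s * (\<phi> s * (1 - s)) = 0" if "N s = 0" for s
      using that by (auto simp: N_def indicator_def split: if_splits)
    have "(\<integral>\<^sup>+s. ennreal (N s) \<partial>lborel) \<le> (\<integral>\<^sup>+s. indicator {0<..<1::real} s \<partial>lborel)"
    proof (rule nn_integral_mono)
      fix s :: real
      have "N s \<le> indicator {0<..<1} s"
        using powr_mono2[of \<kappa> "1 - s" 1] \<kappa> by (auto simp: N_def indicator_def)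
      then show "ennreal (N s) \<le> indicator {0<..<1} s" by (metis ennreal_indicator ennreal_leI)
    qed
    then show "(\<integral>\<^sup>+s. ennreal (N s) \<partial>lborel) \<le> ennreal 1" by simp
    have "(\<integral>\<^sup>+s. ennreal ((indicator {0<..<1} s * (\<phi> s * (1 - s))) powr p * N s powr (1-p)) \<partial>lborel)
      = (\<integral>\<^sup>+t. ennreal (\<phi> t powr p * (1 - t) powr (\<alpha> + 1)) * indicator {0<..<1} t \<partial>lborel)"
    proof (rule nn_integral_cong)
      fix s :: real
      show "ennreal ((indicator {0<..<1} s * (\<phi> s * (1 - s))) powr p * N s powr (1-p)) = ennreal (\<phi> s powr p * (1 - s) powr (\<alpha> + 1)) * indicator {0<..<1} s"
      proof (cases "s \<in> {0<..<1}")
        case True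
        then have "(\<phi> s * (1 - s)) powr p * ((1 - s) powr \<kappa>) powr (1-p) = \<phi> s powr p * ((1 - s) powr p * (1 - s) powr (\<alpha> + 1 - p))"
          by (simp add: powr_mult powr_powr \<kappa> \<phi>_def)
        also have "(1 - s) powr p * (1 - s) powr (\<alpha> + 1 - p) = (1 - s) powr (\<alpha> + 1)"
          by (simp add: powr_add[symmetric])
        finally show ?thesis using True by (simp add: N_def)
      qed (simp add: N_def)
    qed
    then show "(\<integral>\<^sup>+s. ennreal ((indicator {0<..<1} s * (\<phi> s * (1 - s))) powr p * N s powr (1-p)) \<partial>lborel) \<le> ennreal \<tau>"
      using T(2) by (simp add: \<phi>_def)
  qed (use T in auto)
  moreover have "(\<integral>\<^sup>+s. ennreal (indicator {0<..<1} s * (\<phi> s * (1 - s))) \<partial>lborel) = (\<integral>\<^sup>+s. ennreal (\<phi> s * (1 - s)) * indicator {0<..<1} s \<partial>lborel)"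
    by (intro nn_integral_cong) (auto simp: indicator_def)
  ultimately show 1: "(\<integral>\<^sup>+s. ennreal (norm (disc_ext (deriv f) (of_real s)) * (1 - s)) * indicator {0<..<1} s \<partial>lborel) \<le> ennreal (\<tau> powr (1/p))"
    by (simp add: \<phi>_def)
  have "(\<integral>\<^sup>+t. ennreal (norm (disc_ext f (of_real t))) * 1 * indicator {0..<1} t \<partial>lborel)
    \<le> ennreal (norm (f 0)) * (\<integral>\<^sup>+t. 1 * indicator {0..<1::real} t \<partial>lborel)
      + (\<integral>\<^sup>+s. ennreal (norm (disc_ext (deriv f) (of_real s))) * (\<integral>\<^sup>+t. 1 * indicator {s..<1} t \<partial>lborel) * indicator {0<..<1} s \<partial>lborel)"
    by (rule weighted_radial_integral_le[OF f]) simp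
  also have "(\<integral>\<^sup>+s. ennreal (norm (disc_ext (deriv f) (of_real s))) * (\<integral>\<^sup>+t. 1 * indicator {s..<1} t \<partial>lborel) * indicator {0<..<1} s \<partial>lborel)
     = (\<integral>\<^sup>+s. ennreal (norm (disc_ext (deriv f) (of_real s)) * (1 - s)) * indicator {0<..<1} s \<partial>lborel)"
  proof (rule nn_integral_cong)
    fix s :: real
    have "s < 1 \<Longrightarrow> (\<integral>\<^sup>+t. 1 * indicator {s..<1} t \<partial>lborel) = ennreal (1 - s)" by simp
    then show "ennreal (norm (disc_ext (deriv f) (of_real s))) * (\<integral>\<^sup>+t. 1 * indicator {s..<1} t \<partial>lborel) * indicator {0<..<1} s
      = ennreal (norm (disc_ext (deriv f) (of_real s)) * (1 - s)) * indicator {0<..<1} s"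
      by (cases "s \<in> {0<..<1}") (simp_all add: ennreal_mult')
  qed
  also have "\<dots> \<le> ennreal (\<tau> powr (1/p))" by (rule 1)
  finally show "(\<integral>\<^sup>+t. ennreal (norm (disc_ext f (of_real t))) * indicator {0..<1} t \<partial>lborel) \<le> ennreal (norm (f 0) + \<tau> powr (1/p))"
    by (simp add: add_left_mono order_trans)
qed

section \<open>Sufficiency\<close>

definition radial_avg :: "(complex \<Rightarrow> complex) \<Rightarrow> real \<Rightarrow> real" where
  "radial_avg f x = (LINT s|lborel. indicator {0<..<1} s * norm (disc_ext (deriv f) (of_real s)) * ((1 - s) / (1 - s + x)))"

lemma radial_avg_nonneg: "0 \<le> x \<Longrightarrow> radial_avg f x \<ge> 0"
  unfolding radial_avg_def by (intro Bochner_Integration.integral_nonneg) (auto simp: indicator_def)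

text \<open>\<open>radial_avg\<close> is a Bochner integral and would be \<open>0\<close> for a
  divergent integrand. The denominator is at least \<open>x > 0\<close>, so the finiteness
  hypothesis gives integrability and the two integrals agree.\<close>

lemma nn_integral_radial_avg:
  assumes f: "f holomorphic_on ball 0 1" and x: "x > 0"
    and fin: "(\<integral>\<^sup>+s. ennreal (norm (disc_ext (deriv f) (of_real s)) * (1 - s)) * indicator {0<..<1} s \<partial>lborel) < \<infinity>"
  shows "(\<integral>\<^sup>+s. ennreal (norm (disc_ext (deriv f) (of_real s)) * ((1 - s) / (1 - s + x))) * indicator {0<..<1} s \<partial>lborel) = ennreal (radial_avg f x)"
proof -
  note disc_ext_measurable[OF holomorphic_deriv_disc[OF f], measurable]
  define \<phi> where "\<phi> s = norm (disc_ext (deriv f) (of_real s))" for s :: real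
  have [measurable]: "\<phi> \<in> borel_measurable borel" unfolding \<phi>_def by measurable
  have \<phi>: "\<phi> s \<ge> 0" for s by (simp add: \<phi>_def)
  define h where "h s = indicator {0<..<1} s * \<phi> s * ((1 - s) / (1 - s + x))" for s
  have h0: "h s \<ge> 0" for s using x \<phi> by (auto simp: h_def indicator_def)
  have [measurable]: "h \<in> borel_measurable borel" unfolding h_def by measurable
  have "integrable lborel h"
  proof (rule integrableI_nonneg)
    have "(\<integral>\<^sup>+s. ennreal (h s) \<partial>lborel) \<le> (\<integral>\<^sup>+s. ennreal (1/x) * (ennreal (\<phi> s * (1 - s)) * indicator {0<..<1} s) \<partial>lborel)"
    proof (rule nn_integral_mono)
      fix s :: real
      show "ennreal (h s) \<le> ennreal (1/x) * (ennreal (\<phi> s * (1 - s)) * indicator {0<..<1} s)"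
      proof (cases "s \<in> {0<..<1}")
        case True
        have "(1 - s) / (1 - s + x) \<le> (1 - s) / x" using True x by (intro divide_left_mono) auto
        then have "\<phi> s * ((1 - s) / (1 - s + x)) \<le> \<phi> s * ((1 - s) / x)" using \<phi> by (intro mult_left_mono) auto
        then show ?thesis using True x by (simp add: h_def ennreal_mult'[symmetric] ennreal_leI)
      qed (simp add: h_def)
    qed
    also have "\<dots> = ennreal (1/x) * (\<integral>\<^sup>+s. ennreal (\<phi> s * (1 - s)) * indicator {0<..<1} s \<partial>lborel)"
      by (rule nn_integral_cmult) measurable
    also have "\<dots> < \<infinity>" using fin by (simp add: \<phi>_def ennreal_mult_less_top)
    finally show "(\<integral>\<^sup>+s. ennreal (h s) \<partial>lborel) < \<infinity>" .
  qed (use h0 in auto)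
  then have "(\<integral>\<^sup>+s. ennreal (h s) \<partial>lborel) = ennreal (LINT s|lborel. h s)"
    using h0 by (intro nn_integral_eq_integral) auto
  moreover have "(\<integral>\<^sup>+s. ennreal (h s) \<partial>lborel) = (\<integral>\<^sup>+s. ennreal (\<phi> s * ((1 - s) / (1 - s + x))) * indicator {0<..<1} s \<partial>lborel)"
    by (intro nn_integral_cong) (auto simp: h_def indicator_def)
  ultimately show ?thesis by (simp add: h_def \<phi>_def radial_avg_def)
qed

locale gen_hilbert_growth = growth p "1/p" C g for p C g +
  fixes \<alpha> :: real
  assumes \<alpha>: "p - 2 < \<alpha>" "\<alpha> \<le> p - 1"
begin

definition "\<nu> = 2 - 1/p"
definition "C2 = C * 2 powr (\<nu>)"

lemma \<nu>: "\<nu> > 1" using p by (simp add: \<nu>_def)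
lemma C2: "C2 > 0" using C by (simp add: C2_def)

lemma second_deriv_growth:
  assumes r: "0 \<le> r" "r < 1"
  shows "pmean p (deriv (deriv g)) r \<le> ennreal ((C2 * (1 - r) powr (-\<nu>)) powr p)"
proof -
  have "pmean p (deriv (deriv g)) r \<le> ennreal ((C * 2 powr ((1 - 1/p) + 1) * (1 - r) powr (-(1 - 1/p)-1)) powr p)"
    using p C r growth by (intro pmean_deriv_bound[OF p holomorphic_deriv_disc[OF hol]]) auto
  also have "(1 - 1/p) + 1 = \<nu>" by (simp add: \<nu>_def)
  also have "-(1 - 1/p) - 1 = -\<nu>" by (simp add: \<nu>_def)
  finally show ?thesis by (simp add: C2_def)
qed

text \<open>Minkowski over \<open>t\<close> in the formula for the derivative of the image:
  \<open>g''\<close> enters through its mean on the circle of radius \<open>t * r\<close>, which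
  yields the factor \<open>(1 - t * r) powr (-\<nu>)\<close>; the remaining factor \<open>t\<close>
  is bounded by 1.\<close>

lemma pmean_image:
  assumes f: "f holomorphic_on ball 0 1" and f1: "set_integrable lborel {0..<1} (\<lambda>t. f (complex_of_real t))"
    and r: "0 \<le> r" "r < 1" and A: "A \<ge> 0"
    and bd: "(\<integral>\<^sup>+t. ennreal (norm (disc_ext f (of_real t))) * ennreal ((1 - t * r) powr (-\<nu>)) * indicator {0..<1} t \<partial>lborel) \<le> ennreal A"
  shows "pmean p (deriv (gen_hilbert g f)) r \<le> ennreal ((C2 * A) powr p)"
proof -
  note hol2 = holomorphic_deriv_disc[OF holomorphic_deriv_disc[OF hol]]
  note disc_ext_measurable[OF f, measurable] disc_ext_measurable[OF hol2, measurable]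
  define H where "H \<theta> t = indicator {0..<1} t *\<^sub>R (disc_ext f (of_real t) * (of_real t * disc_ext (deriv (deriv g)) (of_real (t * r) * cis \<theta>)))" for \<theta> t
  define N where "N t = indicator {0..<1} t * (C2 * (norm (disc_ext f (of_real t)) * (1 - t * r) powr (-\<nu>)))" for t
  have tr: "0 \<le> t * r" "t * r < 1" if "t \<in> {0..<1}" for t
    using that r mult_le_one[of t r] mult_left_le[of r t] by (auto intro: le_less_trans)
  have repr: "deriv (gen_hilbert g f) (of_real r * cis \<theta>) = (LINT t|lborel. H \<theta> t)" for \<theta>
  proof -
    have "deriv (gen_hilbert g f) (of_real r * cis \<theta>) = (LINT t:{0..<1}|lborel. f (of_real t) * (of_real t * deriv (deriv g) (of_real t * (of_real r * cis \<theta>))))"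
      using r by (intro gen_hilbert_deriv hol f1) (simp add: norm_mult)
    also have "\<dots> = (LINT t|lborel. H \<theta> t)"
      unfolding set_lebesgue_integral_def
    proof (intro Bochner_Integration.integral_cong refl)
      fix t
      show "indicat_real {0..<1} t *\<^sub>R (f (of_real t) * (of_real t * deriv (deriv g) (of_real t * (of_real r * cis \<theta>)))) = H \<theta> t"
      proof (cases "t \<in> {0..<1}")
        case True
        then show ?thesis using tr[OF True] by (simp add: H_def norm_mult mult.assoc)
      qed (simp add: H_def)
    qed
    finally show ?thesis .
  qed
  have "(\<integral>\<^sup>+\<theta>. ennreal (norm (LINT t|lborel. H \<theta> t) powr p) \<partial>circ) \<le> ennreal ((C2 * A) powr p)"
  proof (rule Minkowski_integral_bound[where N=N])
    show "(\<lambda>(x, y). H x y) \<in> borel_measurable (circ \<Otimes>\<^sub>M lborel)" unfolding H_def by measurable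
    show "N \<in> borel_measurable lborel" unfolding N_def by measurable
    show "N t \<ge> 0" for t using C2 by (simp add: N_def)
    show "H \<theta> t = 0" if "N t = 0" for \<theta> t
    proof (cases "t \<in> {0..<1}")
      case True
      then show ?thesis using that C2 tr[OF True] by (auto simp: N_def H_def)
    qed (simp add: H_def)
    have "(\<integral>\<^sup>+t. ennreal (N t) \<partial>lborel) = (\<integral>\<^sup>+t. ennreal C2 * (ennreal (norm (disc_ext f (of_real t))) * ennreal ((1 - t * r) powr (-\<nu>)) * indicator {0..<1} t) \<partial>lborel)"
      using C2 by (intro nn_integral_cong) (auto simp: N_def indicator_def ennreal_mult')
    also have "\<dots> = ennreal C2 * (\<integral>\<^sup>+t. ennreal (norm (disc_ext f (of_real t))) * ennreal ((1 - t * r) powr (-\<nu>)) * indicator {0..<1} t \<partial>lborel)"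
      by (rule nn_integral_cmult) measurable
    also have "\<dots> \<le> ennreal C2 * ennreal A" by (intro mult_left_mono bd) auto
    finally show "(\<integral>\<^sup>+t. ennreal (N t) \<partial>lborel) \<le> ennreal (C2 * A)" using C2 by (simp add: ennreal_mult')
    show "(\<integral>\<^sup>+\<theta>. ennreal (norm (H \<theta> t) powr p) \<partial>circ) \<le> ennreal (N t powr p)" for t
    proof (cases "t \<in> {0..<1}")
      case True
      define a where "a = norm (disc_ext f (of_real t))"
      note [measurable] = circle_measurable[OF hol2, of "t * r"]
      have "(\<integral>\<^sup>+\<theta>. ennreal (norm (H \<theta> t) powr p) \<partial>circ) \<le> (\<integral>\<^sup>+\<theta>. ennreal (a powr p) * ennreal (norm (deriv (deriv g) (of_real (t * r) * cis \<theta>)) powr p) \<partial>circ)"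
      proof (rule nn_integral_mono)
        fix \<theta>
        have nt: "norm (of_real (t * r) * cis \<theta>) < 1" using tr[OF True] by (simp only: norm_mult norm_cis norm_of_real)
        have "norm (H \<theta> t) = a * (t * norm (deriv (deriv g) (of_real (t * r) * cis \<theta>)))"
          unfolding H_def disc_ext_eq[OF nt] using True by (simp add: norm_mult a_def)
        also have "\<dots> \<le> a * (1 * norm (deriv (deriv g) (of_real (t * r) * cis \<theta>)))"
          using True by (intro mult_left_mono mult_right_mono) (auto simp: a_def)
        finally have "norm (H \<theta> t) powr p \<le> (a * norm (deriv (deriv g) (of_real (t * r) * cis \<theta>))) powr p"
          using p by (intro powr_mono2) auto
        then show "ennreal (norm (H \<theta> t) powr p) \<le> ennreal (a powr p) * ennreal (norm (deriv (deriv g) (of_real (t * r) * cis \<theta>)) powr p)"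
          by (simp add: ennreal_mult'[symmetric] powr_mult a_def ennreal_leI)
      qed
      also have "\<dots> = ennreal (a powr p) * pmean p (deriv (deriv g)) (t * r)"
        unfolding pmean_def using circle_measurable[OF hol2, of "t * r"] tr[OF True] by (intro nn_integral_cmult) simp
      also have "\<dots> \<le> ennreal (a powr p) * ennreal ((C2 * (1 - t * r) powr (-\<nu>)) powr p)"
        using tr[OF True] by (intro mult_left_mono second_deriv_growth) auto
      also have "\<dots> = ennreal (N t powr p)"
        using True C2 by (simp add: N_def a_def ennreal_mult'[symmetric] powr_mult mult_ac)
      finally show ?thesis .
    qed (simp add: H_def)
  qed (use p A C2 circ.sigma_finite_measure_axioms lborel.sigma_finite_measure_axioms in auto)
  then show ?thesis by (simp add: pmean_def repr)
qed

text \<open>At radius \<open>1 - x\<close> the kernel tail bound reduces the mean to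
  \<open>f(0)\<close> and \<open>radial_avg f x\<close>. After multiplication by the area weight,
  the first contributes \<open>1 / (e + 1)\<close>, and the second falls under
  \<open>Schur_Hardy\<close>, whose right-hand weight \<open>p + e = \<alpha> + 1\<close> is that of
  the trace integral.\<close>

lemma energy_image:
  obtains K where "K \<ge> 0" "\<And>f \<tau>. \<lbrakk>f holomorphic_on ball 0 1; \<tau> \<ge> 0;
      (\<integral>\<^sup>+t. ennreal (norm (disc_ext (deriv f) (of_real t)) powr p * (1 - t) powr (\<alpha> + 1)) * indicator {0<..<1} t \<partial>lborel) \<le> ennreal \<tau>;
      set_integrable lborel {0..<1} (\<lambda>t. f (complex_of_real t))\<rbrakk>
      \<Longrightarrow> energy p \<alpha> (deriv (gen_hilbert g f)) \<le> ennreal (K * (norm (f 0) powr p + \<tau>))"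
proof -
  obtain c where c: "c > 0" and tail: "\<And>r s. \<lbrakk>0 \<le> r; r < 1; 0 \<le> s; s < 1\<rbrakk> \<Longrightarrow>
    (\<integral>\<^sup>+t. ennreal ((1 - t * r) powr (-\<nu>)) * indicator {s..<1} t \<partial>lborel) \<le> ennreal (c * (1 - r) powr (1 - \<nu>) * ((1 - s) / (1 - s + (1 - r))))"
    using kernel_tail_bound[OF \<nu>] by blast
  \<comment> \<open>The sum of \<open>p * (1 - \<nu>) = 1 - p\<close>, from the p-th power of the
    kernel factor, and of \<alpha>, from the area weight.\<close>
  define e where "e = 1 - p + \<alpha>"
  have e: "-1 < e" "e \<le> 0" using \<alpha> by (auto simp: e_def)
  obtain S where S: "S > 0" and Sch: "\<And>\<phi>. \<lbrakk>\<phi> \<in> borel_measurable borel; \<And>s. \<phi> s \<ge> 0\<rbrakk> \<Longrightarrow>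
     (\<integral>\<^sup>+x. ennreal (x powr e * (LINT s|lborel. indicator {0<..<1} s * \<phi> s * ((1 - s) / (1 - s + x))) powr p) * indicator {0<..<1} x \<partial>lborel)
     \<le> ennreal S * (\<integral>\<^sup>+s. ennreal (\<phi> s powr p * (1 - s) powr (p + e)) * indicator {0<..<1} s \<partial>lborel)"
    using Schur_Hardy[OF p e] by blast
  define L where "L = (C2 * c) powr p * 2 powr p"
  define K where "K = 2 * pi * 2 powr \<bar>\<alpha>\<bar> * (L * (1 / (e + 1) + S))"
  show thesis
  proof (rule that)
    show "K \<ge> 0" using e S by (simp add: K_def L_def)
    fix f \<tau> assume f: "f holomorphic_on ball 0 1" and \<tau>: "\<tau> \<ge> 0"
      and T: "(\<integral>\<^sup>+t. ennreal (norm (disc_ext (deriv f) (of_real t)) powr p * (1 - t) powr (\<alpha> + 1)) * indicator {0<..<1} t \<partial>lborel) \<le> ennreal \<tau>"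
      and f1: "set_integrable lborel {0..<1} (\<lambda>t. f (complex_of_real t))"
    note disc_ext_measurable[OF f, measurable] disc_ext_measurable[OF holomorphic_deriv_disc[OF f], measurable]
    have fin: "(\<integral>\<^sup>+s. ennreal (norm (disc_ext (deriv f) (of_real s)) * (1 - s)) * indicator {0<..<1} s \<partial>lborel) < \<infinity>"
      using radial_L1_bound(1)[OF p \<alpha>(2) f \<tau> T] by (auto intro: le_less_trans)
    define F where "F = gen_hilbert g f"
    have holF: "F holomorphic_on ball 0 1" unfolding F_def by (rule gen_hilbert_holomorphic[OF hol f1])
    note holF' = holomorphic_deriv_disc[OF holF]
    have avg_meas [measurable]: "radial_avg f \<in> borel_measurable borel" unfolding radial_avg_def[abs_def] by measurable
    have mean: "pmean p (deriv F) (1 - x) \<le> ennreal (L * x powr (p * (1 - \<nu>)) * (norm (f 0) powr p + radial_avg f x powr p))" if x: "0 < x" "x < 1" for x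
    proof -
      define r where "r = 1 - x"
      have r: "0 \<le> r" "r < 1" "1 - r = x" using x by (auto simp: r_def)
      define d where "d = c * x powr (1 - \<nu>)"
      have d: "d \<ge> 0" using c by (simp add: d_def)
      have "(\<integral>\<^sup>+t. ennreal (norm (disc_ext f (of_real t))) * ennreal ((1 - t * r) powr (-\<nu>)) * indicator {0..<1} t \<partial>lborel)
        \<le> ennreal (norm (f 0)) * (\<integral>\<^sup>+t. ennreal ((1 - t * r) powr (-\<nu>)) * indicator {0..<1} t \<partial>lborel)
          + (\<integral>\<^sup>+s. ennreal (norm (disc_ext (deriv f) (of_real s))) * (\<integral>\<^sup>+t. ennreal ((1 - t * r) powr (-\<nu>)) * indicator {s..<1} t \<partial>lborel) * indicator {0<..<1} s \<partial>lborel)"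
        by (rule weighted_radial_integral_le[OF f]) measurable
      also have "\<dots> \<le> ennreal (norm (f 0)) * ennreal d + (\<integral>\<^sup>+s. ennreal d * (ennreal (norm (disc_ext (deriv f) (of_real s)) * ((1 - s) / (1 - s + x))) * indicator {0<..<1} s) \<partial>lborel)"
      proof (rule add_mono[OF mult_left_mono nn_integral_mono])
        have "(1 - 0) / (1 - 0 + (1 - r)) \<le> 1" using r x by simp
        then have "d * ((1 - 0) / (1 - 0 + (1 - r))) \<le> d * 1" using d by (intro mult_left_mono)
        then show "(\<integral>\<^sup>+t. ennreal ((1 - t * r) powr (-\<nu>)) * indicator {0..<1} t \<partial>lborel) \<le> ennreal d"
          using order_trans[OF tail[OF r(1,2), of 0] ennreal_leI] unfolding r(3) d_def[symmetric] by simp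
        fix s :: real
        show "ennreal (norm (disc_ext (deriv f) (of_real s))) * (\<integral>\<^sup>+t. ennreal ((1 - t * r) powr (-\<nu>)) * indicator {s..<1} t \<partial>lborel) * indicator {0<..<1} s
          \<le> ennreal d * (ennreal (norm (disc_ext (deriv f) (of_real s)) * ((1 - s) / (1 - s + x))) * indicator {0<..<1} s)"
        proof (cases "s \<in> {0<..<1}")
          case True
          then have "ennreal (norm (disc_ext (deriv f) (of_real s))) * (\<integral>\<^sup>+t. ennreal ((1 - t * r) powr (-\<nu>)) * indicator {s..<1} t \<partial>lborel) \<le> ennreal (norm (disc_ext (deriv f) (of_real s))) * ennreal (d * ((1 - s) / (1 - s + x)))"
            using tail[OF r(1,2), of s] unfolding r(3) d_def[symmetric] by (intro mult_left_mono) auto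
          also have "\<dots> = ennreal d * ennreal (norm (disc_ext (deriv f) (of_real s)) * ((1 - s) / (1 - s + x)))"
          proof -
            have "ennreal a * ennreal (d * w) = ennreal d * ennreal (a * w)" if "a \<ge> 0" for a w
            proof -
              have "ennreal a * ennreal (d * w) = ennreal (a * (d * w))" by (rule ennreal_mult'[OF that, symmetric])
              also have "a * (d * w) = d * (a * w)" by simp
              also have "ennreal (d * (a * w)) = ennreal d * ennreal (a * w)" by (rule ennreal_mult'[OF d])
              finally show ?thesis .
            qed
            from this[OF norm_ge_zero] show ?thesis .
          qed
          finally show ?thesis using True by simp
        qed simp
      qed simp
      also have "(\<integral>\<^sup>+s. ennreal d * (ennreal (norm (disc_ext (deriv f) (of_real s)) * ((1 - s) / (1 - s + x))) * indicator {0<..<1} s) \<partial>lborel)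
         = ennreal d * (\<integral>\<^sup>+s. ennreal (norm (disc_ext (deriv f) (of_real s)) * ((1 - s) / (1 - s + x))) * indicator {0<..<1} s \<partial>lborel)"
        by (rule nn_integral_cmult) measurable
      also have "\<dots> = ennreal d * ennreal (radial_avg f x)"
        by (simp only: nn_integral_radial_avg[OF f x(1) fin])
      also have "ennreal (norm (f 0)) * ennreal d + ennreal d * ennreal (radial_avg f x) = ennreal (d * (norm (f 0) + radial_avg f x))"
        using d radial_avg_nonneg[of x f] x by (simp add: ennreal_mult'[symmetric] ennreal_plus[symmetric] distrib_left mult.commute del: ennreal_plus)
      finally have bd: "(\<integral>\<^sup>+t. ennreal (norm (disc_ext f (of_real t))) * ennreal ((1 - t * r) powr (-\<nu>)) * indicator {0..<1} t \<partial>lborel) \<le> ennreal (d * (norm (f 0) + radial_avg f x))" .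
      have "pmean p (deriv F) r \<le> ennreal ((C2 * (d * (norm (f 0) + radial_avg f x))) powr p)"
        unfolding F_def using d radial_avg_nonneg[of x f] x by (intro pmean_image[OF f f1 r(1,2) _ bd]) auto
      also have "(C2 * (d * (norm (f 0) + radial_avg f x))) powr p = (C2 * c) powr p * x powr (p * (1 - \<nu>)) * (norm (f 0) + radial_avg f x) powr p"
      proof -
        have "(x powr (1 - \<nu>)) powr p = x powr (p * (1 - \<nu>))" by (simp add: powr_powr mult.commute)
        then show ?thesis using C2 c x radial_avg_nonneg[of x f] by (simp add: d_def powr_mult)
      qed
      also have "\<dots> \<le> (C2 * c) powr p * x powr (p * (1 - \<nu>)) * (2 powr p * (norm (f 0) powr p + radial_avg f x powr p))"
        using radial_avg_nonneg[of x f] x p by (intro mult_left_mono powr_add_le) auto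
      also have "\<dots> = L * x powr (p * (1 - \<nu>)) * (norm (f 0) powr p + radial_avg f x powr p)" by (simp add: L_def)
      finally show ?thesis by (simp add: r_def ennreal_leI)
    qed
    have "energy p \<alpha> (deriv F) \<le> ennreal (2 * pi * 2 powr \<bar>\<alpha>\<bar>) * (\<integral>\<^sup>+s. pmean p (disc_ext (deriv F)) s * ennreal ((1 - s) powr \<alpha>) * indicator {0<..<1} s \<partial>lborel)"
      by (rule energy_le_pmean[OF holF'])
    also have "(\<integral>\<^sup>+s. pmean p (disc_ext (deriv F)) s * ennreal ((1 - s) powr \<alpha>) * indicator {0<..<1} s \<partial>lborel)
       \<le> (\<integral>\<^sup>+s. ennreal L * (ennreal ((1 - s) powr e * (norm (f 0) powr p + radial_avg f (1 - s) powr p)) * indicator {0<..<1} (1 - s)) \<partial>lborel)"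
    proof (rule nn_integral_mono)
      fix s :: real
      show "pmean p (disc_ext (deriv F)) s * ennreal ((1 - s) powr \<alpha>) * indicator {0<..<1} s \<le> ennreal L * (ennreal ((1 - s) powr e * (norm (f 0) powr p + radial_avg f (1 - s) powr p)) * indicator {0<..<1} (1 - s))"
      proof (cases "s \<in> {0<..<1}")
        case True
        define x where "x = 1 - s"
        have x: "0 < x" "x < 1" "s = 1 - x" using True by (auto simp: x_def)
        have "pmean p (disc_ext (deriv F)) s * ennreal (x powr \<alpha>) \<le> ennreal (L * x powr (p * (1 - \<nu>)) * (norm (f 0) powr p + radial_avg f x powr p)) * ennreal (x powr \<alpha>)"
          using mean[OF x(1,2)] True by (intro mult_right_mono) (auto simp: pmean_disc_ext x(3)[symmetric])
        also have "\<dots> = ennreal ((L * x powr (p * (1 - \<nu>)) * (norm (f 0) powr p + radial_avg f x powr p)) * x powr \<alpha>)"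
          by (intro ennreal_mult'[symmetric]) (simp add: L_def)
        also have "(L * x powr (p * (1 - \<nu>)) * (norm (f 0) powr p + radial_avg f x powr p)) * x powr \<alpha> = L * (x powr e * (norm (f 0) powr p + radial_avg f x powr p))"
        proof -
          have "p * (1 - \<nu>) = 1 - p" using p by (simp add: \<nu>_def algebra_simps)
          then have "x powr e = x powr (p * (1 - \<nu>)) * x powr \<alpha>" by (simp add: e_def powr_add[symmetric])
          then show ?thesis by simp
        qed
        also have "ennreal (L * (x powr e * (norm (f 0) powr p + radial_avg f x powr p))) = ennreal L * ennreal (x powr e * (norm (f 0) powr p + radial_avg f x powr p))"
          by (intro ennreal_mult') (simp add: L_def)
        finally show ?thesis using True by (simp add: x_def)
      qed simp
    qed
    also have "\<dots> = (\<integral>\<^sup>+x. ennreal L * (ennreal (x powr e * (norm (f 0) powr p + radial_avg f x powr p)) * indicator {0<..<1} x) \<partial>lborel)"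
      by (rule nn_integral_reflect[of "\<lambda>x. ennreal L * (ennreal (x powr e * (norm (f 0) powr p + radial_avg f x powr p)) * indicator {0<..<1} x)"]) measurable
    also have "\<dots> = ennreal L * (\<integral>\<^sup>+x. ennreal (x powr e * (norm (f 0) powr p + radial_avg f x powr p)) * indicator {0<..<1} x \<partial>lborel)"
      by (rule nn_integral_cmult) measurable
    also have "(\<integral>\<^sup>+x. ennreal (x powr e * (norm (f 0) powr p + radial_avg f x powr p)) * indicator {0<..<1} x \<partial>lborel)
       \<le> (\<integral>\<^sup>+x. ennreal (norm (f 0) powr p) * (ennreal (x powr e) * indicator {0..1} x) + ennreal (x powr e * radial_avg f x powr p) * indicator {0<..<1} x \<partial>lborel)"
      by (intro nn_integral_mono) (auto simp: indicator_def ennreal_mult'[symmetric] ennreal_plus[symmetric] distrib_left mult.commute simp del: ennreal_plus)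
    also have "\<dots> = ennreal (norm (f 0) powr p) * (\<integral>\<^sup>+x. ennreal (x powr e) * indicator {0..1} x \<partial>lborel) + (\<integral>\<^sup>+x. ennreal (x powr e * radial_avg f x powr p) * indicator {0<..<1} x \<partial>lborel)"
      by (subst nn_integral_add, measurable, subst nn_integral_cmult, measurable)
    also have "(\<integral>\<^sup>+x. ennreal (x powr e) * indicator {0..1} x \<partial>lborel) = ennreal (1 / (e + 1))"
      using nn_integral_powr_0[of e 1] e by simp
    also have "(\<integral>\<^sup>+x. ennreal (x powr e * radial_avg f x powr p) * indicator {0<..<1} x \<partial>lborel) \<le> ennreal (S * \<tau>)"
    proof -
      have "(\<integral>\<^sup>+x. ennreal (x powr e * radial_avg f x powr p) * indicator {0<..<1} x \<partial>lborel) \<le> ennreal S * (\<integral>\<^sup>+s. ennreal (norm (disc_ext (deriv f) (of_real s)) powr p * (1 - s) powr (p + e)) * indicator {0<..<1} s \<partial>lborel)"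
        unfolding radial_avg_def by (rule Sch) auto
      also have "p + e = \<alpha> + 1" by (simp add: e_def)
      also have "ennreal S * (\<integral>\<^sup>+s. ennreal (norm (disc_ext (deriv f) (of_real s)) powr p * (1 - s) powr (\<alpha> + 1)) * indicator {0<..<1} s \<partial>lborel) \<le> ennreal S * ennreal \<tau>"
        by (intro mult_left_mono T) auto
      finally show ?thesis using S by (simp add: ennreal_mult')
    qed
    also have "ennreal (norm (f 0) powr p) * ennreal (1 / (e + 1)) + ennreal (S * \<tau>) \<le> ennreal ((1 / (e + 1) + S) * (norm (f 0) powr p + \<tau>))"
    proof -
      have "norm (f 0) powr p * (1 / (e + 1)) + S * \<tau> \<le> (1 / (e + 1) + S) * (norm (f 0) powr p + \<tau>)"
        using e S \<tau> by (simp add: distrib_left distrib_right add_increasing)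
      then show ?thesis using e S \<tau> by (simp add: ennreal_mult'[symmetric] ennreal_plus[symmetric] ennreal_leI del: ennreal_plus)
    qed
    finally have "energy p \<alpha> (deriv F) \<le> ennreal (2 * pi * 2 powr \<bar>\<alpha>\<bar>) * (ennreal L * ennreal ((1 / (e + 1) + S) * (norm (f 0) powr p + \<tau>)))"
      by (simp add: mult_left_mono add_left_mono)
    also have "\<dots> = ennreal (K * (norm (f 0) powr p + \<tau>))"
      unfolding K_def L_def by (simp add: ennreal_mult'[symmetric] mult_ac)
    finally show "energy p \<alpha> (deriv (gen_hilbert g f)) \<le> ennreal (K * (norm (f 0) powr p + \<tau>))" by (simp add: F_def)
  qed
qed

text \<open>What the operator asks of an element of the space: the trace bound, convergence of the
  defining integral, and control of the image at 0, which the energy does not see. The constant in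
  \<open>\<tau>\<close> is that of \<open>radial_trace_bound\<close>.\<close>

lemma dirichlet_integrable:
  assumes f: "f \<in> dirichlet_space p \<alpha>"
  defines "\<tau> \<equiv> 8 * 2 powr \<alpha> * 2 powr \<bar>\<alpha>\<bar> * enn2real (energy p \<alpha> (deriv f))"
  shows "(\<integral>\<^sup>+t. ennreal (norm (disc_ext (deriv f) (of_real t)) powr p * (1 - t) powr (\<alpha> + 1)) * indicator {0<..<1} t \<partial>lborel) \<le> ennreal \<tau>"
    and "set_integrable lborel {0..<1} (\<lambda>t. f (complex_of_real t))"
    and "norm (gen_hilbert g f 0) \<le> (norm (f 0) + \<tau> powr (1/p)) * norm (deriv g 0)"
proof -
  have fh: "f holomorphic_on ball 0 1" and E: "energy p \<alpha> (deriv f) < \<infinity>" using f by (auto simp: dirichlet_space_iff)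
  note disc_ext_measurable[OF fh, measurable]
  have \<tau>: "\<tau> \<ge> 0" by (simp add: \<tau>_def)
  have "ennreal (8 * 2 powr \<alpha> * 2 powr \<bar>\<alpha>\<bar>) * energy p \<alpha> (deriv f) = ennreal \<tau>"
    using E unfolding \<tau>_def by (subst ennreal_mult') auto
  then show T: "(\<integral>\<^sup>+t. ennreal (norm (disc_ext (deriv f) (of_real t)) powr p * (1 - t) powr (\<alpha> + 1)) * indicator {0<..<1} t \<partial>lborel) \<le> ennreal \<tau>"
    using radial_trace_bound[OF p holomorphic_deriv_disc[OF fh], of \<alpha>] by simp
  note L1 = radial_L1_bound(2)[OF p \<alpha>(2) fh \<tau> T]
  define h where "h t = indicat_real {0..<1} t *\<^sub>R f (complex_of_real t)" for t
  have h: "h = (\<lambda>t. indicator {0..<1} t *\<^sub>R disc_ext f (of_real t))" by (auto simp: h_def indicator_def fun_eq_iff)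
  have nh: "(\<integral>\<^sup>+t. ennreal (norm (h t)) \<partial>lborel) = (\<integral>\<^sup>+t. ennreal (norm (disc_ext f (of_real t))) * indicator {0..<1} t \<partial>lborel)"
    unfolding h by (intro nn_integral_cong) (auto simp: indicator_def)
  have "integrable lborel h"
  proof (rule integrableI_bounded)
    show "h \<in> borel_measurable lborel" unfolding h by measurable
    show "(\<integral>\<^sup>+t. ennreal (norm (h t)) \<partial>lborel) < \<infinity>" unfolding nh using L1 by (auto intro: le_less_trans)
  qed
  then show "set_integrable lborel {0..<1} (\<lambda>t. f (complex_of_real t))"
    by (simp add: set_integrable_def h_def[abs_def])
  have "ennreal (norm (LINT t|lborel. h t)) \<le> ennreal (norm (f 0) + \<tau> powr (1/p))"
    using norm_integral_le_nn_integral[of lborel h] L1 unfolding nh by (rule order_trans)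
  then have "norm (LINT t|lborel. h t) \<le> norm (f 0) + \<tau> powr (1/p)"
    by (subst (asm) ennreal_le_iff) auto
  then have "norm (LINT t|lborel. h t) * norm (deriv g 0) \<le> (norm (f 0) + \<tau> powr (1/p)) * norm (deriv g 0)"
    by (intro mult_right_mono) auto
  then show "norm (gen_hilbert g f 0) \<le> (norm (f 0) + \<tau> powr (1/p)) * norm (deriv g 0)"
    unfolding gen_hilbert_0 set_lebesgue_integral_def h_def[symmetric] by (simp add: norm_mult)
qed

lemma gen_hilbert_bounded: "bounded_on_dirichlet p \<alpha> (gen_hilbert g)"
proof -
  obtain K where K: "K \<ge> 0" and image: "\<And>f \<tau>. \<lbrakk>f holomorphic_on ball 0 1; \<tau> \<ge> 0;
      (\<integral>\<^sup>+t. ennreal (norm (disc_ext (deriv f) (of_real t)) powr p * (1 - t) powr (\<alpha> + 1)) * indicator {0<..<1} t \<partial>lborel) \<le> ennreal \<tau>;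
      set_integrable lborel {0..<1} (\<lambda>t. f (complex_of_real t))\<rbrakk>
      \<Longrightarrow> energy p \<alpha> (deriv (gen_hilbert g f)) \<le> ennreal (K * (norm (f 0) powr p + \<tau>))"
    using energy_image by blast
  have \<alpha>1: "\<alpha> > -1" using \<alpha> p by simp
  define b where "b = 8 * 2 powr \<alpha> * 2 powr \<bar>\<alpha>\<bar>"
  define q where "q = (\<alpha> + 1) / pi"
  have q: "q > 0" using \<alpha>1 by (simp add: q_def)
  define M where "M = norm (deriv g 0) powr p * 2 powr p + q * K"
  have M: "M \<ge> 0" using K q by (simp add: M_def)
  \<comment> \<open>\<open>M\<close> bounds the image in terms of \<open>|f(0)|^p + \<tau>\<close>;
    the factor \<open>1 + b / q\<close> converts \<open>\<tau>\<close>, which is \<open>b\<close>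
    times the energy, into the part of the norm that is \<open>q\<close> times the energy.\<close>
  define W where "W = M * (1 + b / q)"
  have b: "b \<ge> 0" by (simp add: b_def)
  have W: "W \<ge> 0" using M b q by (simp add: W_def)
  have main: "gen_hilbert g f \<in> dirichlet_space p \<alpha> \<and> dirichlet_norm p \<alpha> (gen_hilbert g f) \<le> W powr (1/p) * dirichlet_norm p \<alpha> f"
    if f: "f \<in> dirichlet_space p \<alpha>" for f
  proof
    have fh: "f holomorphic_on ball 0 1" and E: "energy p \<alpha> (deriv f) < \<infinity>" using f by (auto simp: dirichlet_space_iff)
    define \<tau> where "\<tau> = b * enn2real (energy p \<alpha> (deriv f))"
    have \<tau>: "\<tau> \<ge> 0" by (simp add: \<tau>_def b_def)
    note di = dirichlet_integrable[OF f, folded b_def, folded \<tau>_def]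
    define F where "F = gen_hilbert g f"
    have holF: "F holomorphic_on ball 0 1" unfolding F_def by (rule gen_hilbert_holomorphic[OF hol di(2)])
    have EF: "energy p \<alpha> (deriv F) \<le> ennreal (K * (norm (f 0) powr p + \<tau>))"
      unfolding F_def by (rule image[OF fh \<tau> di(1,2)])
    then have "energy p \<alpha> (deriv F) < \<infinity>" by (auto intro: le_less_trans)
    then show "gen_hilbert g f \<in> dirichlet_space p \<alpha>" using holF by (simp add: dirichlet_space_iff F_def)
    define n where "n = dirichlet_norm p \<alpha> f"
    have n: "n powr p = norm (f 0) powr p + q * enn2real (energy p \<alpha> (deriv f))"
      unfolding n_def q_def using p by (intro dirichlet_norm_powr fh \<alpha>1) simp
    have sum_le: "norm (f 0) powr p + \<tau> \<le> (1 + b / q) * n powr p"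
    proof -
      have "(1 + b / q) * n powr p = norm (f 0) powr p + \<tau> + (q * enn2real (energy p \<alpha> (deriv f)) + b / q * norm (f 0) powr p)"
        unfolding n \<tau>_def using q by (simp add: field_simps)
      moreover have "q * enn2real (energy p \<alpha> (deriv f)) + b / q * norm (f 0) powr p \<ge> 0"
        using q b by simp
      ultimately show ?thesis by linarith
    qed
    have F0: "norm (F 0) powr p \<le> norm (deriv g 0) powr p * 2 powr p * (norm (f 0) powr p + \<tau>)"
    proof -
      have "norm (F 0) powr p \<le> ((norm (f 0) + \<tau> powr (1/p)) * norm (deriv g 0)) powr p"
        unfolding F_def using p di(3) by (intro powr_mono2) auto
      also have "\<dots> = norm (deriv g 0) powr p * (norm (f 0) + \<tau> powr (1/p)) powr p" by (simp add: powr_mult)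
      also have "\<dots> \<le> norm (deriv g 0) powr p * (2 powr p * (norm (f 0) powr p + (\<tau> powr (1/p)) powr p))"
        using p by (intro mult_left_mono powr_add_le) auto
      finally show ?thesis using p \<tau> by (simp add: powr_powr)
    qed
    have "dirichlet_norm p \<alpha> F powr p = norm (F 0) powr p + q * enn2real (energy p \<alpha> (deriv F))"
      unfolding q_def using p by (intro dirichlet_norm_powr holF \<alpha>1) simp
    also have "\<dots> \<le> norm (deriv g 0) powr p * 2 powr p * (norm (f 0) powr p + \<tau>) + q * (K * (norm (f 0) powr p + \<tau>))"
    proof (rule add_mono[OF F0 mult_left_mono])
      show "enn2real (energy p \<alpha> (deriv F)) \<le> K * (norm (f 0) powr p + \<tau>)"
        using EF K \<tau> by (intro enn2real_leI) auto
    qed (use q in simp)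
    also have "\<dots> = M * (norm (f 0) powr p + \<tau>)" by (simp add: M_def algebra_simps)
    also have "\<dots> \<le> M * ((1 + b / q) * n powr p)" by (intro mult_left_mono sum_le M)
    also have "\<dots> = W * n powr p" by (simp add: W_def)
    finally have "(dirichlet_norm p \<alpha> F powr p) powr (1/p) \<le> (W * n powr p) powr (1/p)"
      using p by (intro powr_mono2) auto
    then show "dirichlet_norm p \<alpha> (gen_hilbert g f) \<le> W powr (1/p) * dirichlet_norm p \<alpha> f"
      using p W dirichlet_norm_nonneg[of p \<alpha> F] dirichlet_norm_nonneg[of p \<alpha> f]
      by (simp add: powr_mult powr_powr F_def n_def)
  qed
  then show ?thesis unfolding bounded_on_dirichlet_def by blast
qed
end

section \<open>Necessity\<close>

lemma energy_mono_scale: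
  assumes F: "F holomorphic_on ball 0 1" and le: "\<And>z. norm z < 1 \<Longrightarrow> norm (G z) \<le> m * norm (F z)" and m: "m \<ge> 0" and p: "p \<ge> 0"
  shows "energy p \<alpha> G \<le> ennreal (m powr p) * energy p \<alpha> F"
proof -
  note disc_ext_measurable[OF F, measurable]
  have "energy p \<alpha> G \<le> (\<integral>\<^sup>+z. ennreal (m powr p) * (ennreal (norm (disc_ext F z) powr p * (1 - (norm z)\<^sup>2) powr \<alpha>) * indicator (ball 0 1) z) \<partial>lborel)"
    unfolding energy_def
  proof (rule nn_integral_mono)
    fix z :: complex
    show "ennreal (norm (disc_ext G z) powr p * (1 - (norm z)\<^sup>2) powr \<alpha>) * indicator (ball 0 1) z \<le> ennreal (m powr p) * (ennreal (norm (disc_ext F z) powr p * (1 - (norm z)\<^sup>2) powr \<alpha>) * indicator (ball 0 1) z)"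
    proof (cases "z \<in> ball 0 1")
      case True
      then have z: "norm z < 1" by simp
      have "norm (G z) powr p \<le> (m * norm (F z)) powr p" using le[OF z] p by (intro powr_mono2) auto
      then have "norm (G z) powr p * (1 - (norm z)\<^sup>2) powr \<alpha> \<le> (m powr p * norm (F z) powr p) * (1 - (norm z)\<^sup>2) powr \<alpha>"
        using m by (intro mult_right_mono) (auto simp: powr_mult)
      then show ?thesis using z by (simp add: ennreal_mult'[symmetric] mult.assoc ennreal_leI)
    qed simp
  qed
  also have "\<dots> = ennreal (m powr p) * energy p \<alpha> F"
    unfolding energy_def by (rule nn_integral_cmult) measurable
  finally show ?thesis .
qed

text \<open>The means increase with the radius, so the mean at \<open>r\<close> is below all those
  further out, whose weighted integral the energy controls. The mass of the weight near the
  boundary, of order \<open>(1 - r) powr (\<alpha> + 1)\<close>, is then divided out.\<close>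

lemma pmean_le_energy_at:
  assumes p: "p > 1" and \<alpha>: "\<alpha> > -1" and F: "F holomorphic_on ball 0 1" and r: "0 \<le> r" "r < 1"
  shows "pmean p F r \<le> ennreal ((\<alpha> + 1) * 2 powr (\<alpha> + 1) * 2 powr \<bar>\<alpha>\<bar> * (1 - r) powr (-\<alpha>-1)) * energy p \<alpha> F"
proof -
  \<comment> \<open>The energy bound sees radii beyond \<open>1/2\<close> only; the maximum shortens
    the distance to the boundary by at most half.\<close>
  define \<rho> where "\<rho> = max r (1/2)"
  have \<rho>: "r \<le> \<rho>" "1/2 \<le> \<rho>" "\<rho> < 1" "(1 - r) / 2 \<le> 1 - \<rho>" using r by (auto simp: \<rho>_def max_def)
  have I: "(\<integral>\<^sup>+s. ennreal ((1 - s) powr \<alpha>) * indicator {\<rho><..<1} s \<partial>lborel) = ennreal ((1 - \<rho>) powr (\<alpha>+1) / (\<alpha>+1))"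
  proof -
    have "(\<integral>\<^sup>+s. ennreal ((1 - s) powr \<alpha>) * indicator {\<rho><..<1} s \<partial>lborel) = (\<integral>\<^sup>+s. ennreal ((1 - s) powr \<alpha>) * indicator {0..1 - \<rho>} (1 - s) \<partial>lborel)"
    proof (rule nn_integral_cong_AE)
      show "AE s in lborel. ennreal ((1 - s) powr \<alpha>) * indicator {\<rho><..<1} s = ennreal ((1 - s) powr \<alpha>) * indicator {0..1 - \<rho>} (1 - s)"
        using AE_lborel_singleton[of \<rho>] AE_lborel_singleton[of 1] by eventually_elim (auto simp: indicator_def)
    qed
    also have "\<dots> = (\<integral>\<^sup>+s. ennreal (s powr \<alpha>) * indicator {0..1 - \<rho>} s \<partial>lborel)"
      by (rule nn_integral_reflect[of "\<lambda>s. ennreal (s powr \<alpha>) * indicator {0..1 - \<rho>} s"]) measurable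
    finally show ?thesis using \<alpha> \<rho> by (simp add: nn_integral_powr_0)
  qed
  have "pmean p F r * ennreal ((1 - \<rho>) powr (\<alpha>+1) / (\<alpha>+1)) = (\<integral>\<^sup>+s. pmean p F r * (ennreal ((1 - s) powr \<alpha>) * indicator {\<rho><..<1} s) \<partial>lborel)"
    by (subst nn_integral_cmult) (auto simp: I)
  also have "\<dots> \<le> (\<integral>\<^sup>+s. pmean p (disc_ext F) s * ennreal ((1 - s) powr \<alpha>) * indicator {1/2<..<1} s \<partial>lborel)"
  proof (rule nn_integral_mono)
    fix s :: real
    show "pmean p F r * (ennreal ((1 - s) powr \<alpha>) * indicator {\<rho><..<1} s) \<le> pmean p (disc_ext F) s * ennreal ((1 - s) powr \<alpha>) * indicator {1/2<..<1} s"
    proof (cases "s \<in> {\<rho><..<1}")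
      case True
      then have "pmean p F r \<le> pmean p F s" using \<rho> r by (intro pmean_mono p F) auto
      then have "pmean p F r * ennreal ((1 - s) powr \<alpha>) \<le> pmean p F s * ennreal ((1 - s) powr \<alpha>)" by (rule mult_right_mono) simp
      then show ?thesis using True \<rho> r by (simp add: pmean_disc_ext)
    qed simp
  qed
  also have "\<dots> \<le> ennreal (2 powr \<bar>\<alpha>\<bar>) * energy p \<alpha> F" by (rule pmean_le_energy[OF F])
  finally have le: "pmean p F r * ennreal ((1 - \<rho>) powr (\<alpha>+1) / (\<alpha>+1)) \<le> ennreal (2 powr \<bar>\<alpha>\<bar>) * energy p \<alpha> F" .
  \<comment> \<open>\<open>k\<close> dominates the reciprocal of the mass of the weight beyond
    \<open>\<rho>\<close>; multiplying by it replaces a division in \<open>ennreal\<close>.\<close>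
  define k where "k = (\<alpha> + 1) * 2 powr (\<alpha> + 1) * (1 - r) powr (-\<alpha>-1)"
  have k: "k \<ge> 0" using \<alpha> by (simp add: k_def)
  have "1 \<le> (1 - \<rho>) powr (\<alpha>+1) / (\<alpha>+1) * k"
  proof -
    have "((1 - r) / 2) powr (\<alpha>+1) \<le> (1 - \<rho>) powr (\<alpha>+1)" using \<rho> r \<alpha> by (intro powr_mono2) auto
    then have "((1 - r) / 2) powr (\<alpha>+1) * (2 powr (\<alpha> + 1) * (1 - r) powr (-\<alpha>-1)) \<le> (1 - \<rho>) powr (\<alpha>+1) * (2 powr (\<alpha> + 1) * (1 - r) powr (-\<alpha>-1))"
      by (intro mult_right_mono) auto
    moreover have "((1 - r) / 2) powr (\<alpha>+1) * (2 powr (\<alpha> + 1) * (1 - r) powr (-\<alpha>-1)) = 1"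
    proof -
      have "((1 - r) / 2) powr (\<alpha>+1) * 2 powr (\<alpha> + 1) = (1 - r) powr (\<alpha>+1)" using r by (simp add: powr_divide)
      moreover have "(1 - r) powr (\<alpha>+1) * (1 - r) powr (-\<alpha>-1) = 1" using r by (simp add: powr_add[symmetric])
      ultimately show ?thesis by (simp only: mult.assoc[symmetric])
    qed
    moreover have "(1 - \<rho>) powr (\<alpha>+1) * (2 powr (\<alpha> + 1) * (1 - r) powr (-\<alpha>-1)) = (1 - \<rho>) powr (\<alpha>+1) / (\<alpha>+1) * k"
      using \<alpha> by (simp add: k_def)
    ultimately show ?thesis by simp
  qed
  then have "ennreal 1 \<le> ennreal ((1 - \<rho>) powr (\<alpha>+1) / (\<alpha>+1) * k)" by (rule ennreal_leI)
  then have "pmean p F r * 1 \<le> pmean p F r * ennreal ((1 - \<rho>) powr (\<alpha>+1) / (\<alpha>+1) * k)"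
    by (intro mult_left_mono) auto
  also have "\<dots> = (pmean p F r * ennreal ((1 - \<rho>) powr (\<alpha>+1) / (\<alpha>+1))) * ennreal k"
    by (simp only: ennreal_mult''[OF k] mult.assoc)
  also have "\<dots> \<le> (ennreal (2 powr \<bar>\<alpha>\<bar>) * energy p \<alpha> F) * ennreal k"
    by (intro mult_right_mono le) simp
  also have "\<dots> = ennreal (2 powr \<bar>\<alpha>\<bar>) * ennreal k * energy p \<alpha> F" by (simp only: mult_ac)
  also have "ennreal (2 powr \<bar>\<alpha>\<bar>) * ennreal k = ennreal (2 powr \<bar>\<alpha>\<bar> * k)" by (rule ennreal_mult'[symmetric]) simp
  also have "2 powr \<bar>\<alpha>\<bar> * k = (\<alpha> + 1) * 2 powr (\<alpha> + 1) * 2 powr \<bar>\<alpha>\<bar> * (1 - r) powr (-\<alpha>-1)" by (simp add: k_def mult_ac)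
  finally show ?thesis by simp
qed

section \<open>Test functions and their norms\<close>

text \<open>The family is closed under what the inversion identity requires: differentiation raises
  \<open>k\<close> by one up to the factor \<open>k * a\<close>, and for \<open>k = 1\<close> the
  derivative of \<open>z\<close> times the function is the member with \<open>k = 2\<close>.\<close>

definition test_fn :: "real \<Rightarrow> nat \<Rightarrow> complex \<Rightarrow> complex" where
  "test_fn a k z = 1 / (1 - of_real a * z) ^ k"

lemma test_fn_nonzero:
  assumes "0 \<le> a" "a < 1" "norm z \<le> 1"
  shows "1 - of_real a * z \<noteq> (0::complex)"
proof
  assume "1 - of_real a * z = 0"
  then have "norm (of_real a * z) = 1" by (metis eq_iff_diff_eq_0 norm_one)
  moreover have "a * norm z \<le> a * 1" using assms by (intro mult_left_mono) auto
  ultimately show False using assms by (simp add: norm_mult)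
qed

lemma test_fn_deriv:
  assumes "0 \<le> a" "a < 1" "norm z \<le> 1"
  shows "(test_fn a k has_field_derivative of_nat k * of_real a * test_fn a (Suc k) z) (at z)"
proof -
  note nz = test_fn_nonzero[OF assms]
  define u where "u w = 1 - of_real a * w" for w :: complex
  have u: "u z \<noteq> 0" using nz by (simp add: u_def)
  have "(u has_field_derivative - of_real a) (at z)"
    unfolding u_def[abs_def] by (auto intro!: derivative_eq_intros)
  from DERIV_inverse_fun[OF DERIV_power[OF this, of k]] u
  have "((\<lambda>w. inverse (u w ^ k)) has_field_derivative - (inverse (u z ^ k) * (of_nat k * (- of_real a * u z ^ (k - Suc 0))) * inverse (u z ^ k))) (at z)"
    by (simp add: mult_ac)
  also have "- (inverse (u z ^ k) * (of_nat k * (- of_real a * u z ^ (k - Suc 0))) * inverse (u z ^ k)) = of_nat k * of_real a * test_fn a (Suc k) z"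
  proof -
    have t: "test_fn a (Suc k) z = 1 / u z ^ Suc k" by (simp add: test_fn_def u_def)
    show ?thesis unfolding t using u by (cases k) (simp_all add: field_simps)
  qed
  finally show ?thesis by (simp add: test_fn_def[abs_def] u_def[abs_def] divide_inverse)
qed

lemma test_fn_holomorphic:
  assumes a: "0 \<le> a" "a < 1"
  shows "test_fn a k holomorphic_on ball 0 1"
  unfolding test_fn_def[abs_def]
  by (intro holomorphic_intros) (use test_fn_nonzero[OF a] in auto)

text \<open>On the circle of radius \<open>s\<close> the denominator has the modulus of
  \<open>cis \<theta> - b\<close> with \<open>b = a * s\<close>. Two of its powers are kept for the
  Poisson kernel, whose mass is 1; the remaining exponent \<open>2 - k * p\<close> is nonpositive,
  so these powers are bounded by those of \<open>1 - b\<close>.\<close>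

lemma pmean_test_fn:
  assumes p: "p > 0" "real k * p \<ge> 2" and a: "0 \<le> a" "a < 1" and s: "0 \<le> s" "s < 1"
  shows "pmean p (test_fn a k) s \<le> ennreal ((1 - a * s) powr (1 - real k * p))"
proof -
  define b where "b = a * s"
  have b: "0 \<le> b" "b < 1" using a s mult_left_le[of s a] by (auto simp: b_def intro: le_less_trans)
  define w where "w \<theta> = norm (cis \<theta> - of_real b)" for \<theta>
  have w: "w \<theta> \<ge> 1 - b" for \<theta>
    using norm_triangle_ineq2[of "cis \<theta>" "of_real b"] b by (simp add: w_def)
  have nt: "norm (test_fn a k (of_real s * cis \<theta>)) = 1 / w \<theta> ^ k" for \<theta>
  proof -
    have "cnj (cis \<theta> - of_real b) = cis (-\<theta>) * (1 - of_real b * cis \<theta>)"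
      by (simp add: algebra_simps cis_mult cis_cnj)
    then have "norm (cnj (cis \<theta> - of_real b)) = norm (1 - of_real b * cis \<theta>)" by (simp only: norm_mult norm_cis mult_1)
    then have "norm (1 - of_real b * cis \<theta>) = w \<theta>" unfolding w_def complex_mod_cnj by simp
    moreover have "test_fn a k (of_real s * cis \<theta>) = 1 / (1 - of_real b * cis \<theta>) ^ k"
      by (simp add: test_fn_def b_def mult.assoc)
    ultimately show ?thesis by (simp add: norm_divide norm_power)
  qed
  have K: "(\<integral>\<^sup>+\<theta>. ennreal ((1 - b\<^sup>2) / (w \<theta>)\<^sup>2) \<partial>circ) = 1"
    using Poisson_kernel_integral[of "of_real b" 1] b by (simp add: w_def)
  have "pmean p (test_fn a k) s \<le> (\<integral>\<^sup>+\<theta>. ennreal ((1 - b) powr (1 - real k * p)) * ennreal ((1 - b\<^sup>2) / (w \<theta>)\<^sup>2) \<partial>circ)"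
    unfolding pmean_def
  proof (rule nn_integral_mono)
    fix \<theta>
    have w0: "w \<theta> > 0" using w[of \<theta>] b by linarith
    have "norm (test_fn a k (of_real s * cis \<theta>)) powr p = w \<theta> powr (2 - real k * p) * w \<theta> powr (-2)"
      unfolding nt using w0 by (simp add: powr_divide powr_realpow[symmetric] powr_powr powr_minus_divide[symmetric] powr_add[symmetric])
    also have "\<dots> \<le> (1 - b) powr (2 - real k * p) * w \<theta> powr (-2)"
      using w[of \<theta>] b p by (intro mult_right_mono powr_mono2') auto
    also have "\<dots> = (1 - b) powr (1 - real k * p) * ((1 - b) / (w \<theta>)\<^sup>2)"
    proof -
      have "(1 - b) powr (2 - real k * p) = (1 - b) powr (1 - real k * p) * (1 - b) powr 1" unfolding powr_add[symmetric] by simp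
      moreover have "w \<theta> powr (-2) = 1 / (w \<theta>)\<^sup>2" using w0 by (simp add: powr_minus_divide powr_numeral)
      ultimately show ?thesis using b by simp
    qed
    also have "\<dots> \<le> (1 - b) powr (1 - real k * p) * ((1 - b\<^sup>2) / (w \<theta>)\<^sup>2)"
      using b w0 by (intro mult_left_mono divide_right_mono) (auto simp: power2_eq_square mult_left_le)
    finally show "ennreal (norm (test_fn a k (of_real s * cis \<theta>)) powr p) \<le> ennreal ((1 - b) powr (1 - real k * p)) * ennreal ((1 - b\<^sup>2) / (w \<theta>)\<^sup>2)"
      by (simp add: ennreal_mult'[symmetric] ennreal_leI)
  qed
  also have "\<dots> = ennreal ((1 - b) powr (1 - real k * p)) * (\<integral>\<^sup>+\<theta>. ennreal ((1 - b\<^sup>2) / (w \<theta>)\<^sup>2) \<partial>circ)"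
    unfolding w_def by (rule nn_integral_cmult) measurable
  finally show ?thesis unfolding K by (simp add: b_def)
qed

text \<open>Integration of the means in polar coordinates. Since
  \<open>1 - a * s = (1 - a) + a * (1 - s)\<close> and \<open>a \<ge> 1/2\<close>, this is at least
  half of \<open>(1 - a) + (1 - s)\<close>, and the power kernel estimate applies;
  \<open>k * p > \<alpha> + 2\<close> is its convergence at infinity.\<close>

lemma energy_test_fn:
  assumes p: "p > 1" and \<alpha>: "\<alpha> > -1" and k: "real k * p \<ge> 2" "real k * p > \<alpha> + 2"
  obtains C where "C > 0" "\<And>a. 1/2 \<le> a \<Longrightarrow> a < 1 \<Longrightarrow> energy p \<alpha> (test_fn a k) \<le> ennreal (C * (1 - a) powr (\<alpha> + 2 - real k * p))"
proof -
  define q where "q = real k * p - 1"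
  obtain S where S: "S > 0" "\<And>d. d > 0 \<Longrightarrow> (\<integral>\<^sup>+x. ennreal (x powr \<alpha> * (d + x) powr (-q)) * indicator {0<..} x \<partial>lborel) \<le> ennreal (S * d powr (\<alpha> - q + 1))"
    using nn_integral_powr_kernel[of \<alpha> q] \<alpha> k by (auto simp: q_def)
  define c where "c = 2 * pi * 2 powr \<bar>\<alpha>\<bar>"
  have c: "c > 0" by (simp add: c_def)
  show thesis
  proof (rule that)
    show "c * 2 powr q * S > 0" using c S by simp
    fix a :: real assume a: "1/2 \<le> a" "a < 1"
    have hol: "test_fn a k holomorphic_on ball 0 1" using a by (intro test_fn_holomorphic) auto
    have "energy p \<alpha> (test_fn a k) \<le> ennreal c * (\<integral>\<^sup>+s. pmean p (disc_ext (test_fn a k)) s * ennreal ((1 - s) powr \<alpha>) * indicator {0<..<1} s \<partial>lborel)"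
      unfolding c_def by (rule energy_le_pmean[OF hol])
    also have "(\<integral>\<^sup>+s. pmean p (disc_ext (test_fn a k)) s * ennreal ((1 - s) powr \<alpha>) * indicator {0<..<1} s \<partial>lborel)
      \<le> (\<integral>\<^sup>+s. ennreal (2 powr q) * (ennreal ((1 - s) powr \<alpha> * ((1 - a) + (1 - s)) powr (-q)) * indicator {0<..} (1 - s)) \<partial>lborel)"
    proof (rule nn_integral_mono)
      fix s :: real
      show "pmean p (disc_ext (test_fn a k)) s * ennreal ((1 - s) powr \<alpha>) * indicator {0<..<1} s \<le> ennreal (2 powr q) * (ennreal ((1 - s) powr \<alpha> * ((1 - a) + (1 - s)) powr (-q)) * indicator {0<..} (1 - s))"
      proof (cases "s \<in> {0<..<1}")
        case True
        have "(1/2) * (1 - s) \<le> a * (1 - s)" using True a by (intro mult_right_mono) auto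
        moreover have "(1/2) * (1 - s) \<le> v \<Longrightarrow> ((1 - a) + (1 - s)) / 2 \<le> (1 - a) + v" for v using a by simp
        ultimately have "((1 - a) + (1 - s)) / 2 \<le> (1 - a) + a * (1 - s)" by blast
        also have "(1 - a) + a * (1 - s) = 1 - a * s" by (simp add: right_diff_distrib)
        finally have h: "((1 - a) + (1 - s)) / 2 \<le> 1 - a * s" .
        have "(1 - a * s) powr (-q) \<le> (((1 - a) + (1 - s)) / 2) powr (-q)"
          using h True a k by (intro powr_mono2') (auto simp: q_def)
        also have "\<dots> = 2 powr q * ((1 - a) + (1 - s)) powr (-q)"
          using True a by (simp add: powr_divide powr_minus field_simps)
        finally have b: "(1 - a * s) powr (-q) \<le> 2 powr q * ((1 - a) + (1 - s)) powr (-q)" .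
        have "pmean p (test_fn a k) s * ennreal ((1 - s) powr \<alpha>) \<le> ennreal ((1 - a * s) powr (1 - real k * p)) * ennreal ((1 - s) powr \<alpha>)"
          using True a p k by (intro mult_right_mono pmean_test_fn) auto
        also have "1 - real k * p = -q" by (simp add: q_def)
        also have "ennreal ((1 - a * s) powr (-q)) * ennreal ((1 - s) powr \<alpha>) \<le> ennreal (2 powr q * ((1 - a) + (1 - s)) powr (-q)) * ennreal ((1 - s) powr \<alpha>)"
          by (intro mult_right_mono ennreal_leI b) auto
        also have "\<dots> = ennreal (2 powr q) * ennreal ((1 - s) powr \<alpha> * ((1 - a) + (1 - s)) powr (-q))"
        proof -
          have "ennreal (A * B) * ennreal D = ennreal A * ennreal (D * B)" if "A \<ge> 0" "B \<ge> 0" "D \<ge> 0" for A B D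
            using that by (simp add: ennreal_mult mult_ac)
          then show ?thesis by (simp only: powr_ge_zero)
        qed
        finally show ?thesis using True by (simp add: pmean_disc_ext)
      qed simp
    qed
    also have "\<dots> = (\<integral>\<^sup>+x. ennreal (2 powr q) * (ennreal (x powr \<alpha> * ((1 - a) + x) powr (-q)) * indicator {0<..} x) \<partial>lborel)"
      by (rule nn_integral_reflect[of "\<lambda>x. ennreal (2 powr q) * (ennreal (x powr \<alpha> * ((1 - a) + x) powr (-q)) * indicator {0<..} x)"]) measurable
    also have "\<dots> = ennreal (2 powr q) * (\<integral>\<^sup>+x. ennreal (x powr \<alpha> * ((1 - a) + x) powr (-q)) * indicator {0<..} x \<partial>lborel)"
      by (rule nn_integral_cmult) measurable
    also have "\<dots> \<le> ennreal (2 powr q) * ennreal (S * (1 - a) powr (\<alpha> - q + 1))"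
      using a by (intro mult_left_mono S(2)) auto
    also have "\<alpha> - q + 1 = \<alpha> + 2 - real k * p" by (simp add: q_def)
    finally have "energy p \<alpha> (test_fn a k) \<le> ennreal c * (ennreal (2 powr q) * ennreal (S * (1 - a) powr (\<alpha> + 2 - real k * p)))"
      by (simp add: mult_left_mono)
    also have "\<dots> = ennreal (c * 2 powr q * S * (1 - a) powr (\<alpha> + 2 - real k * p))"
      using c S by (simp add: ennreal_mult mult.assoc)
    finally show "energy p \<alpha> (test_fn a k) \<le> ennreal (c * 2 powr q * S * (1 - a) powr (\<alpha> + 2 - real k * p))" .
  qed
qed

lemma powr_root: "x \<ge> 0 \<Longrightarrow> p \<noteq> 0 \<Longrightarrow> ((x::real) powr (1/p)) powr p = x"
  by (simp add: powr_powr)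

section \<open>The bounded operator on the test functions\<close>

locale gen_hilbert_bounded_op =
  fixes p \<alpha> :: real and g :: "complex \<Rightarrow> complex"
  assumes p: "1 < p" and \<alpha>: "p - 2 < \<alpha>" "\<alpha> \<le> p - 1" and hol: "g holomorphic_on ball 0 1"
    and bdd: "bounded_on_dirichlet p \<alpha> (gen_hilbert g)"
begin

lemma \<alpha>1: "\<alpha> > -1" using p \<alpha> by simp

lemma test_fn_integrable:
  assumes a: "0 \<le> a" "a < 1"
  shows "set_integrable lborel {0..<1} (\<lambda>t. test_fn a k (complex_of_real t))"
proof (rule set_integrable_half_open)
  show "continuous_on {0..1} (\<lambda>t. test_fn a k (complex_of_real t))"
    unfolding test_fn_def using test_fn_nonzero[OF a] by (intro continuous_intros) auto
qed

lemma image_holomorphic: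
  assumes a: "0 \<le> a" "a < 1"
  shows "gen_hilbert g (test_fn a k) holomorphic_on ball 0 1"
  by (rule gen_hilbert_holomorphic[OF hol test_fn_integrable[OF a]])

text \<open>The derivative of the test function of order \<open>k\<close> is a bounded multiple of
  that of order \<open>k + 1\<close>, whose energy is known. From \<open>k \<ge> 1\<close> one has
  \<open>(k + 1) * p \<ge> 2 * p > \<alpha> + 2\<close>, the range of that estimate.\<close>

lemma image_energy:
  assumes k: "k \<ge> 1"
  obtains C where "C > 0" "\<And>a. 1/2 \<le> a \<Longrightarrow> a < 1 \<Longrightarrow> energy p \<alpha> (deriv (gen_hilbert g (test_fn a k))) \<le> ennreal (C * (1 - a) powr (\<alpha> + 2 - real (Suc k) * p))"
proof -
  have "2 * p \<le> real (Suc k) * p" using k p by (intro mult_right_mono) auto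
  then have kp: "real (Suc k) * p \<ge> 2" "real (Suc k) * p > \<alpha> + 2" using p \<alpha> by linarith+
  obtain C1 where C1: "C1 > 0" and E1: "\<And>a. 1/2 \<le> a \<Longrightarrow> a < 1 \<Longrightarrow> energy p \<alpha> (test_fn a (Suc k)) \<le> ennreal (C1 * (1 - a) powr (\<alpha> + 2 - real (Suc k) * p))"
    using energy_test_fn[OF p \<alpha>1 kp] by blast
  obtain B where B: "\<And>f. f \<in> dirichlet_space p \<alpha> \<Longrightarrow> dirichlet_norm p \<alpha> (gen_hilbert g f) \<le> B * dirichlet_norm p \<alpha> f"
    and D: "\<And>f. f \<in> dirichlet_space p \<alpha> \<Longrightarrow> gen_hilbert g f \<in> dirichlet_space p \<alpha>"
    using bdd unfolding bounded_on_dirichlet_def by blast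
  \<comment> \<open>The definition of boundedness gives a constant of unknown sign; a positive one
    is needed to raise the inequality to the power \<open>p\<close>.\<close>
  define M where "M = max B 1"
  define q where "q = (\<alpha> + 1) / pi"
  have q: "q > 0" using \<alpha>1 by (simp add: q_def)
  define C where "C = M powr p * (1 + q * (real k powr p * C1)) / q"
  show thesis
  proof (rule that)
    show "C > 0" unfolding C_def using C1 q by (intro divide_pos_pos mult_pos_pos) (auto simp: M_def intro!: add_pos_nonneg)
    fix a :: real assume a: "1/2 \<le> a" "a < 1"
    then have a0: "0 \<le> a" "a < 1" by auto
    define f where "f = test_fn a k"
    define X where "X = (1 - a) powr (\<alpha> + 2 - real (Suc k) * p)"
    \<comment> \<open>The exponent is negative, so \<open>X\<close> absorbs the term
      \<open>|f(0)|^p = 1\<close> of the norm.\<close>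
    have X1: "X \<ge> 1" using powr_mono'[of "\<alpha> + 2 - real (Suc k) * p" 0 "1 - a"] a kp by (simp add: X_def)
    have fh: "f holomorphic_on ball 0 1" unfolding f_def by (rule test_fn_holomorphic[OF a0])
    have "energy p \<alpha> (deriv f) \<le> ennreal (real k powr p) * energy p \<alpha> (test_fn a (Suc k))"
    proof (rule energy_mono_scale[OF test_fn_holomorphic[OF a0]])
      fix z :: complex assume z: "norm z < 1"
      have "deriv f z = of_nat k * of_real a * test_fn a (Suc k) z"
        unfolding f_def using z by (intro DERIV_imp_deriv test_fn_deriv a0) simp
      then have "norm (deriv f z) = real k * (a * norm (test_fn a (Suc k) z))" using a0 by (simp add: norm_mult)
      also have "\<dots> \<le> real k * (1 * norm (test_fn a (Suc k) z))" using a0 by (intro mult_left_mono mult_right_mono) auto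
      finally show "norm (deriv f z) \<le> real k * norm (test_fn a (Suc k) z)" by simp
    qed (use p in auto)
    also have "\<dots> \<le> ennreal (real k powr p) * ennreal (C1 * X)"
      unfolding X_def by (intro mult_left_mono E1 a) simp
    finally have Ef: "energy p \<alpha> (deriv f) \<le> ennreal (real k powr p * C1 * X)" by (simp add: ennreal_mult' mult.assoc)
    then have fD: "f \<in> dirichlet_space p \<alpha>" using fh by (auto simp: dirichlet_space_iff intro: le_less_trans)
    define F where "F = gen_hilbert g f"
    have FD: "F \<in> dirichlet_space p \<alpha>" unfolding F_def by (rule D[OF fD])
    then have Fh: "F holomorphic_on ball 0 1" and Ffin: "energy p \<alpha> (deriv F) < \<infinity>" by (auto simp: dirichlet_space_iff)
    have "dirichlet_norm p \<alpha> F \<le> B * dirichlet_norm p \<alpha> f" unfolding F_def by (rule B[OF fD])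
    also have "\<dots> \<le> M * dirichlet_norm p \<alpha> f" by (intro mult_right_mono dirichlet_norm_nonneg) (simp add: M_def)
    finally have "dirichlet_norm p \<alpha> F powr p \<le> (M * dirichlet_norm p \<alpha> f) powr p"
      using p by (intro powr_mono2 dirichlet_norm_nonneg) auto
    also have "\<dots> = M powr p * dirichlet_norm p \<alpha> f powr p"
      by (simp add: powr_mult dirichlet_norm_nonneg M_def)
    also have "dirichlet_norm p \<alpha> f powr p = norm (f 0) powr p + q * enn2real (energy p \<alpha> (deriv f))"
      unfolding q_def using p by (intro dirichlet_norm_powr fh \<alpha>1) simp
    also have "f 0 = 1" by (simp add: f_def test_fn_def)
    also have "M powr p * (norm (1::complex) powr p + q * enn2real (energy p \<alpha> (deriv f))) \<le> M powr p * (X + q * (real k powr p * C1 * X))"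
    proof (intro mult_left_mono add_mono)
      show "enn2real (energy p \<alpha> (deriv f)) \<le> real k powr p * C1 * X"
        using Ef C1 X1 by (intro enn2real_leI) auto
    qed (use X1 q in auto)
    finally have n: "dirichlet_norm p \<alpha> F powr p \<le> M powr p * (X + q * (real k powr p * C1 * X))" .
    have "dirichlet_norm p \<alpha> F powr p = norm (F 0) powr p + q * enn2real (energy p \<alpha> (deriv F))"
      unfolding q_def using p by (intro dirichlet_norm_powr Fh \<alpha>1) simp
    then have "q * enn2real (energy p \<alpha> (deriv F)) \<le> M powr p * (X + q * (real k powr p * C1 * X))"
      using n powr_ge_zero[of "norm (F 0)" p] by linarith
    then have "enn2real (energy p \<alpha> (deriv F)) \<le> M powr p * (X + q * (real k powr p * C1 * X)) / q"
      using q by (simp add: pos_le_divide_eq mult.commute)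
    also have "\<dots> = C * X" by (simp add: C_def algebra_simps)
    finally have "ennreal (enn2real (energy p \<alpha> (deriv F))) \<le> ennreal (C * X)" by (rule ennreal_leI)
    then show "energy p \<alpha> (deriv (gen_hilbert g (test_fn a k))) \<le> ennreal (C * (1 - a) powr (\<alpha> + 2 - real (Suc k) * p))"
      using Ffin by (simp add: F_def f_def X_def)
  qed
qed

text \<open>For \<open>f(w) = 1 / (1 - a w)\<close> both ingredients of the integration by parts
  stay in the family: the derivative of \<open>w f(w)\<close> is \<open>1 / (1 - a w)^2\<close>, and
  \<open>f(1) = 1 / (1 - a)\<close> is the large factor that makes the test effective.\<close>

lemma test_identity:
  assumes a: "0 \<le> a" "a < 1" and z: "norm z < 1"
  shows "deriv g z / (1 - of_real a) = gen_hilbert g (test_fn a 2) z + z * deriv (gen_hilbert g (test_fn a 1)) z"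
proof -
  \<comment> \<open>For \<open>a < 1\<close> this open disc contains the whole closed segment, in
    particular the point 1, and \<open>1 - a w\<close> has no zero in it.\<close>
  define S where "S = {w::complex. norm (of_real a * w) < 1}"
  have S: "open S" unfolding S_def by (intro open_Collect_less continuous_intros)
  have nz: "1 - of_real a * w \<noteq> 0" if "w \<in> S" for w using that by (auto simp: S_def)
  have "test_fn a 1 1 * deriv g z = gen_hilbert g (\<lambda>w. test_fn a 1 w + w * deriv (test_fn a 1) w) z + z * deriv (gen_hilbert g (test_fn a 1)) z"
  proof (rule gen_hilbert_parts[OF hol _ S _ z])
    show "test_fn a 1 holomorphic_on S" unfolding test_fn_def[abs_def] using nz by (intro holomorphic_intros) auto
    fix t :: real assume "t \<in> {0..1}"
    then show "complex_of_real t \<in> S" using a mult_left_le[of t a] by (auto simp: S_def norm_mult intro: le_less_trans)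
  qed
  also have "gen_hilbert g (\<lambda>w. test_fn a 1 w + w * deriv (test_fn a 1) w) z = gen_hilbert g (test_fn a 2) z"
    unfolding gen_hilbert_def set_lebesgue_integral_def
  proof (intro Bochner_Integration.integral_cong refl)
    fix t :: real
    show "indicat_real {0..<1} t *\<^sub>R ((test_fn a 1 (of_real t) + of_real t * deriv (test_fn a 1) (of_real t)) * deriv g (of_real t * z)) = indicat_real {0..<1} t *\<^sub>R (test_fn a 2 (of_real t) * deriv g (of_real t * z))"
    proof (cases "t \<in> {0..<1}")
      case True
      then have nt: "norm (of_real t :: complex) \<le> 1" by simp
      define v where "v = 1 - of_real a * (of_real t :: complex)"
      have v: "v \<noteq> 0" unfolding v_def by (rule test_fn_nonzero[OF a nt])
      have "deriv (test_fn a 1) (of_real t) = of_real a / v\<^sup>2"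
        using DERIV_imp_deriv[OF test_fn_deriv[OF a nt, of 1]] by (simp add: test_fn_def v_def power2_eq_square)
      moreover have "test_fn a 1 (of_real t) = 1 / v" "test_fn a 2 (of_real t) = 1 / v\<^sup>2" by (simp_all add: test_fn_def v_def)
      moreover have "1 / v + of_real t * (of_real a / v\<^sup>2) = 1 / v\<^sup>2"
      proof -
        have "1 / v + of_real t * (of_real a / v\<^sup>2) = (v + of_real t * of_real a) / v\<^sup>2" using v by (simp add: field_simps power2_eq_square)
        also have "v + of_real t * of_real a = 1" by (simp add: v_def)
        finally show ?thesis .
      qed
      ultimately show ?thesis by simp
    qed simp
  qed
  also have "test_fn a 1 1 = 1 / (1 - of_real a)" by (simp add: test_fn_def)
  finally show ?thesis by simp
qed

lemma second_deriv_identity: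
  assumes a: "0 \<le> a" "a < 1" and z: "norm z < 1"
  shows "deriv (deriv g) z / (1 - of_real a) = deriv (gen_hilbert g (test_fn a 2)) z + deriv (gen_hilbert g (test_fn a 1)) z + z * deriv (deriv (gen_hilbert g (test_fn a 1))) z"
proof -
  note h1 = image_holomorphic[OF a, of 1] and h2 = image_holomorphic[OF a, of 2]
  have zb: "z \<in> ball 0 1" using z by simp
  have d: "(F has_field_derivative deriv F z) (at z)" if "F holomorphic_on ball 0 1" for F
    by (rule holomorphic_derivI[OF that open_ball zb])
  have "((\<lambda>w. deriv g w / (1 - of_real a)) has_field_derivative deriv (deriv g) z / (1 - of_real a)) (at z)"
    by (intro DERIV_cdivide d holomorphic_deriv_disc hol)
  moreover have "((\<lambda>w. deriv g w / (1 - of_real a)) has_field_derivative deriv (gen_hilbert g (test_fn a 2)) z + (1 * deriv (gen_hilbert g (test_fn a 1)) z + deriv (deriv (gen_hilbert g (test_fn a 1))) z * z)) (at z)"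
  proof (rule has_field_derivative_transform_within_open[OF _ open_ball zb])
    show "((\<lambda>w. gen_hilbert g (test_fn a 2) w + w * deriv (gen_hilbert g (test_fn a 1)) w) has_field_derivative deriv (gen_hilbert g (test_fn a 2)) z + (1 * deriv (gen_hilbert g (test_fn a 1)) z + deriv (deriv (gen_hilbert g (test_fn a 1))) z * z)) (at z)"
      by (intro DERIV_add DERIV_mult DERIV_ident d h1 h2 holomorphic_deriv_disc)
    show "gen_hilbert g (test_fn a 2) w + w * deriv (gen_hilbert g (test_fn a 1)) w = deriv g w / (1 - of_real a)" if "w \<in> ball 0 1" for w
      using test_identity[OF a, of w] that by simp
  qed
  ultimately have "deriv (deriv g) z / (1 - of_real a) = deriv (gen_hilbert g (test_fn a 2)) z + (1 * deriv (gen_hilbert g (test_fn a 1)) z + deriv (deriv (gen_hilbert g (test_fn a 1))) z * z)"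
    by (rule DERIV_unique)
  then show ?thesis by (simp add: algebra_simps)
qed

lemma image_pmean:
  assumes k: "k \<ge> 1"
  obtains C where "C > 0" "\<And>a s. 1/2 \<le> a \<Longrightarrow> a < 1 \<Longrightarrow> 0 \<le> s \<Longrightarrow> s < 1 \<Longrightarrow>
     pmean p (deriv (gen_hilbert g (test_fn a k))) s \<le> ennreal (C * (1 - a) powr (\<alpha> + 2 - real (Suc k) * p) * (1 - s) powr (-\<alpha>-1))"
proof -
  obtain C where C: "C > 0" and E: "\<And>a. 1/2 \<le> a \<Longrightarrow> a < 1 \<Longrightarrow> energy p \<alpha> (deriv (gen_hilbert g (test_fn a k))) \<le> ennreal (C * (1 - a) powr (\<alpha> + 2 - real (Suc k) * p))"
    using image_energy[OF k] by blast
  define c where "c = (\<alpha> + 1) * 2 powr (\<alpha> + 1) * 2 powr \<bar>\<alpha>\<bar>"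
  have c: "c > 0" using \<alpha>1 by (simp add: c_def)
  show thesis
  proof (rule that)
    show "c * C > 0" using c C by simp
    fix a s :: real assume a: "1/2 \<le> a" "a < 1" and s: "0 \<le> s" "s < 1"
    have "gen_hilbert g (test_fn a k) holomorphic_on ball 0 1" using a by (intro image_holomorphic) auto
    then have "pmean p (deriv (gen_hilbert g (test_fn a k))) s \<le> ennreal (c * (1 - s) powr (-\<alpha>-1)) * energy p \<alpha> (deriv (gen_hilbert g (test_fn a k)))"
      unfolding c_def by (intro pmean_le_energy_at p \<alpha>1 holomorphic_deriv_disc s)
    also have "\<dots> \<le> ennreal (c * (1 - s) powr (-\<alpha>-1)) * ennreal (C * (1 - a) powr (\<alpha> + 2 - real (Suc k) * p))"
      by (intro mult_left_mono E a) simp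
    also have "\<dots> = ennreal ((c * (1 - s) powr (-\<alpha>-1)) * (C * (1 - a) powr (\<alpha> + 2 - real (Suc k) * p)))"
      by (rule ennreal_mult'[symmetric]) (use c in simp)
    also have "(c * (1 - s) powr (-\<alpha>-1)) * (C * (1 - a) powr (\<alpha> + 2 - real (Suc k) * p)) = c * C * (1 - a) powr (\<alpha> + 2 - real (Suc k) * p) * (1 - s) powr (-\<alpha>-1)"
      by simp
    finally show "pmean p (deriv (gen_hilbert g (test_fn a k))) s \<le> ennreal (c * C * (1 - a) powr (\<alpha> + 2 - real (Suc k) * p) * (1 - s) powr (-\<alpha>-1))" .
  qed
qed

text \<open>Seen as a p-th power, the mean of the first derivative grows with exponent
  \<open>\<gamma> = (\<alpha> + 1) / p\<close>. One more derivative adds 1 to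
  \<open>\<gamma>\<close> and hence \<open>p\<close> to the exponent of
  \<open>pmean\<close>.\<close>

lemma image_second_deriv_pmean:
  obtains C where "C > 0" "\<And>a s. 1/2 \<le> a \<Longrightarrow> a < 1 \<Longrightarrow> 0 \<le> s \<Longrightarrow> s < 1 \<Longrightarrow>
     pmean p (deriv (deriv (gen_hilbert g (test_fn a 1)))) s \<le> ennreal (C * (1 - a) powr (\<alpha> + 2 - 2 * p) * (1 - s) powr (-\<alpha>-1-p))"
proof -
  obtain C where C: "C > 0" and P: "\<And>a s. 1/2 \<le> a \<Longrightarrow> a < 1 \<Longrightarrow> 0 \<le> s \<Longrightarrow> s < 1 \<Longrightarrow>
     pmean p (deriv (gen_hilbert g (test_fn a 1))) s \<le> ennreal (C * (1 - a) powr (\<alpha> + 2 - real (Suc 1) * p) * (1 - s) powr (-\<alpha>-1))"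
    using image_pmean[of 1] by blast
  define \<gamma> where "\<gamma> = (\<alpha> + 1) / p"
  have \<gamma>: "\<gamma> \<ge> 0" "\<gamma> * p = \<alpha> + 1" using \<alpha>1 p by (auto simp: \<gamma>_def)
  show thesis
  proof (rule that)
    show "C * 2 powr (\<alpha> + 1 + p) > 0" using C by simp
    fix a s :: real assume a: "1/2 \<le> a" "a < 1" and s: "0 \<le> s" "s < 1"
    define Y where "Y = C * (1 - a) powr (\<alpha> + 2 - 2 * p)"
    have Y: "Y > 0" using C a by (simp add: Y_def)
    have "gen_hilbert g (test_fn a 1) holomorphic_on ball 0 1" using a by (intro image_holomorphic) auto
    then have h: "deriv (gen_hilbert g (test_fn a 1)) holomorphic_on ball 0 1" by (rule holomorphic_deriv_disc)
    have "pmean p (deriv (deriv (gen_hilbert g (test_fn a 1)))) s \<le> ennreal ((Y powr (1/p) * 2 powr (\<gamma> + 1) * (1 - s) powr (-\<gamma>-1)) powr p)"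
    proof (rule pmean_deriv_bound[OF p h _ \<gamma>(1) _ s])
      show "Y powr (1/p) > 0" using Y by simp
      fix r :: real assume r: "0 \<le> r" "r < 1"
      have "(Y powr (1/p) * (1 - r) powr (-\<gamma>)) powr p = (Y powr (1/p)) powr p * ((1 - r) powr (-\<gamma>)) powr p"
        using r by (simp add: powr_mult)
      also have "((1 - r) powr (-\<gamma>)) powr p = (1 - r) powr (-\<alpha>-1)" using \<gamma>(2) by (simp add: powr_powr)
      also have "(Y powr (1/p)) powr p = Y" using Y p by (intro powr_root) auto
      finally show "pmean p (deriv (gen_hilbert g (test_fn a 1))) r \<le> ennreal ((Y powr (1/p) * (1 - r) powr (-\<gamma>)) powr p)"
        using P[OF a r] by (simp add: Y_def)
    qed
    also have "(Y powr (1/p) * 2 powr (\<gamma> + 1) * (1 - s) powr (-\<gamma>-1)) powr p = (Y powr (1/p)) powr p * (2 powr (\<gamma> + 1)) powr p * ((1 - s) powr (-\<gamma>-1)) powr p"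
      using s by (simp add: powr_mult)
    also have "(Y powr (1/p)) powr p = Y" using Y p by (intro powr_root) auto
    also have "(2 powr (\<gamma> + 1)) powr p = (2::real) powr (\<alpha> + 1 + p)" using \<gamma>(2) by (simp add: powr_powr distrib_right)
    also have "((1 - s) powr (-\<gamma>-1)) powr p = (1 - s) powr (-\<alpha>-1-p)" using \<gamma>(2) by (simp add: powr_powr left_diff_distrib)
    also have "Y * 2 powr (\<alpha> + 1 + p) * (1 - s) powr (-\<alpha>-1-p) = C * 2 powr (\<alpha> + 1 + p) * (1 - a) powr (\<alpha> + 2 - 2 * p) * (1 - s) powr (-\<alpha>-1-p)"
      by (simp add: Y_def)
    finally show "pmean p (deriv (deriv (gen_hilbert g (test_fn a 1)))) s \<le> ennreal (C * 2 powr (\<alpha> + 1 + p) * (1 - a) powr (\<alpha> + 2 - 2 * p) * (1 - s) powr (-\<alpha>-1-p))" .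
  qed
qed

text \<open>Parameter and radius are tied together by \<open>a = r\<close>. Then \<alpha> drops out
  of every exponent: the first term and the second-derivative term both carry
  \<open>1 - 3 * p\<close>. The factor \<open>1 - a\<close> in front of the images supplies the
  missing \<open>p\<close>, which gives \<open>1 - 2 * p\<close>.\<close>

lemma second_deriv_growth_half:
  obtains C where "C > 0" "\<And>r. 1/2 \<le> r \<Longrightarrow> r < 1 \<Longrightarrow> pmean p (deriv (deriv g)) r \<le> ennreal (C * (1 - r) powr (1 - 2 * p))"
proof -
  obtain C1 where C1: "C1 > 0" and P1: "\<And>a s. 1/2 \<le> a \<Longrightarrow> a < 1 \<Longrightarrow> 0 \<le> s \<Longrightarrow> s < 1 \<Longrightarrow>
     pmean p (deriv (gen_hilbert g (test_fn a 1))) s \<le> ennreal (C1 * (1 - a) powr (\<alpha> + 2 - real (Suc 1) * p) * (1 - s) powr (-\<alpha>-1))"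
    using image_pmean[of 1] by blast
  obtain C2 where C2: "C2 > 0" and P2: "\<And>a s. 1/2 \<le> a \<Longrightarrow> a < 1 \<Longrightarrow> 0 \<le> s \<Longrightarrow> s < 1 \<Longrightarrow>
     pmean p (deriv (gen_hilbert g (test_fn a 2))) s \<le> ennreal (C2 * (1 - a) powr (\<alpha> + 2 - real (Suc 2) * p) * (1 - s) powr (-\<alpha>-1))"
    using image_pmean[of 2] by auto
  obtain C3 where C3: "C3 > 0" and P3: "\<And>a s. 1/2 \<le> a \<Longrightarrow> a < 1 \<Longrightarrow> 0 \<le> s \<Longrightarrow> s < 1 \<Longrightarrow>
     pmean p (deriv (deriv (gen_hilbert g (test_fn a 1)))) s \<le> ennreal (C3 * (1 - a) powr (\<alpha> + 2 - 2 * p) * (1 - s) powr (-\<alpha>-1-p))"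
    using image_second_deriv_pmean by blast
  show thesis
  proof (rule that)
    show "3 powr p * (C2 + C1 + C3) > 0" using C1 C2 C3 by simp
    fix r :: real assume r: "1/2 \<le> r" "r < 1"
    define \<delta> where "\<delta> = 1 - r"
    have \<delta>: "0 < \<delta>" "\<delta> \<le> 1" "1 - r = \<delta>" using r by (auto simp: \<delta>_def)
    have r0: "0 \<le> r" using r by simp
    note h1 = image_holomorphic[OF r0 r(2), of 1] and h2 = image_holomorphic[OF r0 r(2), of 2]
    define U V W where "U = deriv (gen_hilbert g (test_fn r 2))" and "V = deriv (gen_hilbert g (test_fn r 1))" and "W = deriv V"
    have hU: "U holomorphic_on ball 0 1" and hV: "V holomorphic_on ball 0 1" unfolding U_def V_def by (intro holomorphic_deriv_disc h1 h2)+
    have hW: "W holomorphic_on ball 0 1" unfolding W_def by (rule holomorphic_deriv_disc[OF hV])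
    have r1: "\<bar>r\<bar> < 1" using r by simp
    note circle_measurable[OF hU r1, measurable] circle_measurable[OF hV r1, measurable] circle_measurable[OF hW r1, measurable]
    have X: "pmean p U r \<le> ennreal (C2 * \<delta> powr (1 - 3 * p))" 
    proof -
      have "\<delta> powr (\<alpha> + 2 - real (Suc 2) * p) * \<delta> powr (-\<alpha>-1) = \<delta> powr (1 - 3 * p)" by (simp add: powr_add[symmetric])
      then show ?thesis using P2[OF r r0 r(2)] by (simp add: U_def \<delta>(3) mult.assoc)
    qed
    have Y: "pmean p V r \<le> ennreal (C1 * \<delta> powr (1 - 3 * p))"
    proof -
      have "\<delta> powr (\<alpha> + 2 - real (Suc 1) * p) * \<delta> powr (-\<alpha>-1) = \<delta> powr (1 - 2 * p)" by (simp add: powr_add[symmetric])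
      then have "pmean p V r \<le> ennreal (C1 * \<delta> powr (1 - 2 * p))" using P1[OF r r0 r(2)] by (simp add: V_def \<delta>(3) mult.assoc)
      \<comment> \<open>The middle term is smaller by \<open>\<delta> powr p\<close>; it is weakened
        so that all three share one exponent.\<close>
      also have "\<dots> \<le> ennreal (C1 * \<delta> powr (1 - 3 * p))"
        using C1 \<delta> p by (intro ennreal_leI mult_left_mono powr_mono') auto
      finally show ?thesis .
    qed
    have Z: "pmean p W r \<le> ennreal (C3 * \<delta> powr (1 - 3 * p))"
    proof -
      have "\<delta> powr (\<alpha> + 2 - 2 * p) * \<delta> powr (-\<alpha>-1-p) = \<delta> powr (1 - 3 * p)" by (simp add: powr_add[symmetric])
      then show ?thesis using P3[OF r r0 r(2)] by (simp add: W_def V_def \<delta>(3) mult.assoc)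
    qed
    have "pmean p (deriv (deriv g)) r \<le> (\<integral>\<^sup>+\<theta>. ennreal (\<delta> powr p * 3 powr p) * (ennreal (norm (U (of_real r * cis \<theta>)) powr p) + ennreal (norm (V (of_real r * cis \<theta>)) powr p) + ennreal (norm (W (of_real r * cis \<theta>)) powr p)) \<partial>circ)"
      unfolding pmean_def
    proof (rule nn_integral_mono)
      fix \<theta>
      define z where "z = of_real r * cis \<theta>"
      have z: "norm z = r" using r0 by (simp add: z_def norm_mult)
      have d0: "(of_real \<delta> :: complex) \<noteq> 0" using \<delta> by simp
      have "deriv (deriv g) z / of_real \<delta> = U z + V z + z * W z"
        using second_deriv_identity[OF r0 r(2), of z] z r(2) by (simp add: U_def V_def W_def \<delta>_def)
      then have "deriv (deriv g) z = of_real \<delta> * (U z + V z + z * W z)" using d0 by (simp add: field_simps)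
      then have "norm (deriv (deriv g) z) = \<delta> * norm (U z + V z + z * W z)" using \<delta> by (simp add: norm_mult)
      also have "\<dots> \<le> \<delta> * (norm (U z) + norm (V z) + norm (W z))"
      proof (rule mult_left_mono)
        have "norm (z * W z) \<le> 1 * norm (W z)" using z r unfolding norm_mult by (intro mult_right_mono) auto
        then show "norm (U z + V z + z * W z) \<le> norm (U z) + norm (V z) + norm (W z)"
          using norm_triangle_ineq[of "U z + V z" "z * W z"] norm_triangle_ineq[of "U z" "V z"] by linarith
      qed (use \<delta> in simp)
      finally have "norm (deriv (deriv g) z) powr p \<le> (\<delta> * (norm (U z) + norm (V z) + norm (W z))) powr p"
        using p by (intro powr_mono2) auto
      also have "\<dots> = \<delta> powr p * (norm (U z) + norm (V z) + norm (W z)) powr p" using \<delta> by (simp add: powr_mult)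
      also have "\<dots> \<le> \<delta> powr p * (3 powr p * (norm (U z) powr p + norm (V z) powr p + norm (W z) powr p))"
        using p by (intro mult_left_mono powr_add3_le) auto
      finally have "ennreal (norm (deriv (deriv g) z) powr p) \<le> ennreal ((\<delta> powr p * 3 powr p) * (norm (U z) powr p + norm (V z) powr p + norm (W z) powr p))"
        by (simp add: ennreal_leI mult.assoc)
      also have "\<dots> = ennreal (\<delta> powr p * 3 powr p) * (ennreal (norm (U z) powr p) + ennreal (norm (V z) powr p) + ennreal (norm (W z) powr p))"
        by (subst ennreal_mult') auto
      finally show "ennreal (norm (deriv (deriv g) (of_real r * cis \<theta>)) powr p) \<le> ennreal (\<delta> powr p * 3 powr p) * (ennreal (norm (U (of_real r * cis \<theta>)) powr p) + ennreal (norm (V (of_real r * cis \<theta>)) powr p) + ennreal (norm (W (of_real r * cis \<theta>)) powr p))"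
        by (simp add: z_def)
    qed
    also have "\<dots> = ennreal (\<delta> powr p * 3 powr p) * (pmean p U r + pmean p V r + pmean p W r)"
      unfolding pmean_def by (subst nn_integral_cmult, measurable, subst nn_integral_add, measurable, subst nn_integral_add, measurable)
    also have "\<dots> \<le> ennreal (\<delta> powr p * 3 powr p) * (ennreal (C2 * \<delta> powr (1 - 3 * p)) + ennreal (C1 * \<delta> powr (1 - 3 * p)) + ennreal (C3 * \<delta> powr (1 - 3 * p)))"
      by (intro mult_left_mono add_mono X Y Z) auto
    also have "\<dots> = ennreal ((\<delta> powr p * 3 powr p) * (C2 * \<delta> powr (1 - 3 * p) + C1 * \<delta> powr (1 - 3 * p) + C3 * \<delta> powr (1 - 3 * p)))"
      using C1 C2 C3 by (subst ennreal_mult') auto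
    also have "(\<delta> powr p * 3 powr p) * (C2 * \<delta> powr (1 - 3 * p) + C1 * \<delta> powr (1 - 3 * p) + C3 * \<delta> powr (1 - 3 * p)) = 3 powr p * (C2 + C1 + C3) * (\<delta> powr p * \<delta> powr (1 - 3 * p))"
      by (simp add: algebra_simps)
    also have "\<delta> powr p * \<delta> powr (1 - 3 * p) = \<delta> powr (1 - 2 * p)" by (simp add: powr_add[symmetric])
    finally show "pmean p (deriv (deriv g)) r \<le> ennreal (3 powr p * (C2 + C1 + C3) * (1 - r) powr (1 - 2 * p))" by (simp add: \<delta>(3))
  qed
qed

text \<open>Below \<open>1/2\<close> the mean is at most that at \<open>1/2\<close>, because means
  increase with the radius, while the right-hand power is at least 1.\<close>

lemma second_deriv_growth_all:
  obtains C where "C > 0" "\<And>r. 0 \<le> r \<Longrightarrow> r < 1 \<Longrightarrow> pmean p (deriv (deriv g)) r \<le> ennreal ((C * (1 - r) powr (1/p - 2)) powr p)"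
proof -
  obtain C where C: "C > 0" and P: "\<And>r. 1/2 \<le> r \<Longrightarrow> r < 1 \<Longrightarrow> pmean p (deriv (deriv g)) r \<le> ennreal (C * (1 - r) powr (1 - 2 * p))"
    using second_deriv_growth_half by blast
  note h = holomorphic_deriv_disc[OF holomorphic_deriv_disc[OF hol]]
  define K where "K = C * (1/2) powr (1 - 2 * p)"
  have h1: "(1::real) \<le> (1/2) powr (1 - 2 * p)" using powr_mono'[of "1 - 2 * p" 0 "1/2"] p by simp
  have K: "K > 0" "C \<le> K" using C h1 mult_left_mono[OF h1, of C] by (auto simp: K_def)
  have all: "pmean p (deriv (deriv g)) r \<le> ennreal (K * (1 - r) powr (1 - 2 * p))" if r: "0 \<le> r" "r < 1" for r
  proof (cases "1/2 \<le> r")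
    case True
    have "pmean p (deriv (deriv g)) r \<le> ennreal (C * (1 - r) powr (1 - 2 * p))" by (rule P[OF True r(2)])
    also have "\<dots> \<le> ennreal (K * (1 - r) powr (1 - 2 * p))" using K by (intro ennreal_leI mult_right_mono) auto
    finally show ?thesis .
  next
    case False
    then have "pmean p (deriv (deriv g)) r \<le> pmean p (deriv (deriv g)) (1/2)" using r by (intro pmean_mono p h) auto
    also have "\<dots> \<le> ennreal (C * (1 - 1/2) powr (1 - 2 * p))" by (rule P) auto
    also have "\<dots> = ennreal (K * 1)" by (simp add: K_def)
    also have "\<dots> \<le> ennreal (K * (1 - r) powr (1 - 2 * p))"
      using K r p powr_mono'[of "1 - 2 * p" 0 "1 - r"] by (intro ennreal_leI mult_left_mono) auto
    finally show ?thesis .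
  qed
  show thesis
  proof (rule that)
    show "K powr (1/p) > 0" using K by simp
    fix r :: real assume r: "0 \<le> r" "r < 1"
    have "(K powr (1/p) * (1 - r) powr (1/p - 2)) powr p = (K powr (1/p)) powr p * ((1 - r) powr (1/p - 2)) powr p" using r by (simp add: powr_mult)
    also have "(K powr (1/p)) powr p = K" using K p by (intro powr_root) auto
    also have "((1 - r) powr (1/p - 2)) powr p = (1 - r) powr (1 - 2 * p)" using p by (simp add: powr_powr left_diff_distrib)
    finally show "pmean p (deriv (deriv g)) r \<le> ennreal ((K powr (1/p) * (1 - r) powr (1/p - 2)) powr p)" using all[OF r] by simp
  qed
qed

text \<open>\<open>g''\<close> is integrated from the centre along the radius. As
  \<open>1/p - 2 < -1\<close>, the integral is governed by its upper end and raises the exponent by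
  exactly one; the value at 0 is of lower order.\<close>

lemma deriv_growth:
  obtains C where "C > 0" "\<And>r. 0 \<le> r \<Longrightarrow> r < 1 \<Longrightarrow> pmean p (deriv g) r \<le> ennreal ((C * (1 - r) powr (1/p - 1)) powr p)"
proof -
  obtain C where C: "C > 0" and P: "\<And>r. 0 \<le> r \<Longrightarrow> r < 1 \<Longrightarrow> pmean p (deriv (deriv g)) r \<le> ennreal ((C * (1 - r) powr (1/p - 2)) powr p)"
    using second_deriv_growth_all by blast
  define \<beta> where "\<beta> = 1/p"
  have \<beta>: "0 < \<beta>" "\<beta> < 1" using p by (auto simp: \<beta>_def)
  note h = holomorphic_deriv_disc[OF hol]
  \<comment> \<open>The first summand is the constant of the integrated power, the second absorbs
    the value at 0, since \<open>(1 - r) powr (\<beta> - 1)\<close> is at least 1. Thus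
    \<open>y\<close> dominates both contributions.\<close>
  define m where "m = C / (1 - \<beta>) + norm (deriv g 0)"
  have m: "m > 0" using C \<beta> by (simp add: m_def add_pos_nonneg)
  define K where "K = 2 powr p * 2"
  show thesis
  proof (rule that)
    show "K powr (1/p) * m > 0" using m by (simp add: K_def)
    fix r :: real assume r: "0 \<le> r" "r < 1"
    define y where "y = m * (1 - r) powr (\<beta> - 1)"
    have x1: "1 \<le> (1 - r) powr (\<beta> - 1)" using powr_mono'[of "\<beta> - 1" 0 "1 - r"] \<beta> r by simp
    have y: "y > 0" unfolding y_def using m x1 by (intro mult_pos_pos) linarith+
    have ym: "m \<le> y" using mult_left_mono[OF x1, of m] m by (simp add: y_def)
    have D: "(\<integral>\<^sup>+\<theta>. ennreal (norm (deriv g (of_real r * cis \<theta>) - deriv g (of_real 0 * cis \<theta>)) powr p) \<partial>circ) \<le> ennreal (y powr p)"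
    proof (rule pmean_radial_diff[OF p h order_refl r, where N="\<lambda>s. C * (1 - s) powr (\<beta> - 2)"])
      show "C * (1 - s) powr (\<beta> - 2) > 0" if "s \<in> {0..r}" for s using that C r by auto
      show "pmean p (deriv (deriv g)) s \<le> ennreal ((C * (1 - s) powr (\<beta> - 2)) powr p)" if "s \<in> {0..r}" for s
        using P[of s] that r by (simp add: \<beta>_def)
      have "(\<integral>\<^sup>+s. ennreal (C * (1 - s) powr (\<beta> - 2)) * indicator {0..r} s \<partial>lborel) = ennreal (C * (1 - r) powr (\<beta> - 1) / (1 - \<beta>) - C * (1 - 0) powr (\<beta> - 1) / (1 - \<beta>))"
      proof (rule nn_integral_FTC_Icc[where F="\<lambda>s. C * (1 - s) powr (\<beta> - 1) / (1 - \<beta>)"])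
        fix s assume "s \<in> {0..r}"
        then have s: "0 \<le> s" "s \<le> r" by auto
        have eq: "C * ((\<beta> - 1) * (1 - s) powr (\<beta> - 1 - 1) * (-1)) / (1 - \<beta>) = C * (1 - s) powr (\<beta> - 2)"
        proof -
          have "C * ((\<beta> - 1) * (1 - s) powr (\<beta> - 1 - 1) * (-1)) = (1 - \<beta>) * (C * (1 - s) powr (\<beta> - 2))" by (simp add: algebra_simps)
          then show ?thesis using \<beta> by simp
        qed
        have "((\<lambda>s. C * (1 - s) powr (\<beta> - 1) / (1 - \<beta>)) has_real_derivative C * ((\<beta> - 1) * (1 - s) powr (\<beta> - 1 - 1) * (-1)) / (1 - \<beta>)) (at s)"
          using s r \<beta> by (auto intro!: derivative_eq_intros)
        then show "((\<lambda>s. C * (1 - s) powr (\<beta> - 1) / (1 - \<beta>)) has_real_derivative C * (1 - s) powr (\<beta> - 2)) (at s)"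
          unfolding eq .
      qed (use C r in auto)
      also have "\<dots> \<le> ennreal y"
      proof (rule ennreal_leI)
        have "C * (1 - r) powr (\<beta> - 1) / (1 - \<beta>) \<le> y"
          unfolding y_def m_def by (simp add: distrib_right)
        moreover have "C * (1 - 0) powr (\<beta> - 1) / (1 - \<beta>) \<ge> 0" using C \<beta> by simp
        ultimately show "C * (1 - r) powr (\<beta> - 1) / (1 - \<beta>) - C * (1 - 0) powr (\<beta> - 1) / (1 - \<beta>) \<le> y" by linarith
      qed
      finally show "(\<integral>\<^sup>+s. ennreal (C * (1 - s) powr (\<beta> - 2)) * indicator {0..r} s \<partial>lborel) \<le> ennreal y" .
    qed (use y in auto)
    have r1: "\<bar>r\<bar> < 1" using r by simp
    note circle_measurable[OF h r1, measurable]
    have "pmean p (deriv g) r \<le> (\<integral>\<^sup>+\<theta>. ennreal (2 powr p) * (ennreal (norm (deriv g (of_real r * cis \<theta>) - deriv g (of_real 0 * cis \<theta>)) powr p) + ennreal (y powr p)) \<partial>circ)"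
      unfolding pmean_def
    proof (rule nn_integral_mono)
      fix \<theta>
      let ?u = "deriv g (of_real r * cis \<theta>)"
      have "norm (deriv g 0) \<le> m" using C \<beta> by (simp add: m_def)
      then have "norm ?u \<le> norm (?u - deriv g 0) + y" using norm_triangle_ineq[of "?u - deriv g 0" "deriv g 0"] ym by simp
      then have "norm ?u powr p \<le> (norm (?u - deriv g 0) + y) powr p" using p by (intro powr_mono2) auto
      also have "\<dots> \<le> 2 powr p * (norm (?u - deriv g 0) powr p + y powr p)" using p y by (intro powr_add_le) auto
      finally have "ennreal (norm ?u powr p) \<le> ennreal (2 powr p * (norm (?u - deriv g 0) powr p + y powr p))" by (rule ennreal_leI)
      also have "\<dots> = ennreal (2 powr p) * (ennreal (norm (?u - deriv g 0) powr p) + ennreal (y powr p))" by (subst ennreal_mult') auto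
      finally show "ennreal (norm ?u powr p) \<le> ennreal (2 powr p) * (ennreal (norm (?u - deriv g (of_real 0 * cis \<theta>)) powr p) + ennreal (y powr p))" by simp
    qed
    also have "\<dots> = ennreal (2 powr p) * ((\<integral>\<^sup>+\<theta>. ennreal (norm (deriv g (of_real r * cis \<theta>) - deriv g (of_real 0 * cis \<theta>)) powr p) \<partial>circ) + ennreal (y powr p))"
      by (subst nn_integral_cmult, simp, subst nn_integral_add) auto
    also have "\<dots> \<le> ennreal (2 powr p) * (ennreal (y powr p) + ennreal (y powr p))"
      by (intro mult_left_mono add_mono D) auto
    also have "\<dots> = ennreal (K * y powr p)" by (simp add: K_def ennreal_plus[symmetric] ennreal_mult'[symmetric] del: ennreal_plus)
    also have "K * y powr p = (K powr (1/p) * m * (1 - r) powr (1/p - 1)) powr p"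
    proof -
      have "(K powr (1/p) * m * (1 - r) powr (1/p - 1)) powr p = (K powr (1/p) * y) powr p" by (simp add: y_def \<beta>_def mult.assoc)
      also have "\<dots> = (K powr (1/p)) powr p * y powr p" using y by (simp add: powr_mult)
      also have "(K powr (1/p)) powr p = K" using p by (intro powr_root) (auto simp: K_def)
      finally show ?thesis by simp
    qed
    finally show "pmean p (deriv g) r \<le> ennreal ((K powr (1/p) * m * (1 - r) powr (1/p - 1)) powr p)" .
  qed
qed
end

theorem theorem4:
  fixes p \<alpha> :: real and g :: "complex \<Rightarrow> complex"
  assumes "1 < p" and "p - 2 < \<alpha>" and "\<alpha> \<le> p - 1"
    and "g holomorphic_on ball 0 1"
  shows "bounded_on_dirichlet p \<alpha> (gen_hilbert g) \<longleftrightarrow> g \<in> mean_lipschitz p (1 / p)"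
proof
  assume "bounded_on_dirichlet p \<alpha> (gen_hilbert g)"
  then interpret gen_hilbert_bounded_op p \<alpha> g using assms by unfold_locales
  obtain C where C: "C > 0" "\<And>r. 0 \<le> r \<Longrightarrow> r < 1 \<Longrightarrow> pmean p (deriv g) r \<le> ennreal ((C * (1 - r) powr (1/p - 1)) powr p)"
    using deriv_growth by blast
  interpret growth p "1/p" C g using assms C by unfold_locales auto
  show "g \<in> mean_lipschitz p (1 / p)" by (rule in_mean_lipschitz)
next
  assume g: "g \<in> mean_lipschitz p (1 / p)"
  obtain C where C: "C > 0" "\<And>r. 0 \<le> r \<Longrightarrow> r < 1 \<Longrightarrow> pmean p (deriv g) r \<le> ennreal ((C * (1 - r) powr (1/p - 1)) powr p)"
    by (rule mean_lipschitz_deriv_growth[OF assms(1) _ _ g]) (use assms in auto)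
  interpret gen_hilbert_growth p C g \<alpha> using assms C by unfold_locales auto
  show "bounded_on_dirichlet p \<alpha> (gen_hilbert g)" by (rule gen_hilbert_bounded)
qed

end
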